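(* Let $X$ be a Fréchet sequence space in which $(e_n)_{n\ge0}$ is an unconditional basis. Let $I\subset\mathbb R$ be a nonempty interval, let $d\ge1$ and let $\Lambda\subset I^d$ be $\sigma$-compact. Let $(B_{w(a)})_{a\in I}$ be a continuous family of weighted shifts on $X$ and assume that $a\in I\mapsto w_n(a)$ is nondecreasing for each $n\geq 1$. For $n\ge1$ put $f_n(a)=\sum_{k=1}^n\log(w_k(a))$. Assume also that there exist a nondecreasing map $F$ from the positive integers to the positive integers and $c,C>0$ such that, for all $n\ge1$, $$\forall(a,b)\in I^2,\quad cF(n)|a-b|\le|f_n(a)-f_n(b)|\le CF(n)|a-b|,$$ $$\forall(a,b)\in I^2,\quad\frac{w_n(a)}{w_n(b)}\ge c.$$ Then the following assertions are equivalent: (a) $(B_{w(\lambda(1))}\times\cdots\times B_{w(\lambda(d))})_{\lambda\in\Lambda}$ possesses a dense $G_\delta$ set of common hypercyclic vectors in $X^d$. (b) $(B_{w(\lambda(1))}\times\cdots\times B_{w(\lambda(d))})_{\lambda\in\Lambda}$ admits a common hypercyclic vector in $X^d$. (c) For all $\tau>0$, all integers $N\ge1$, all $\varepsilon>0$ and all compact $K\subset\Lambda$, there exist finitely many integers $n_1,\dots,n_q$ with $n_1\ge N$ and $n_{k+1}\ge n_k+N$ for $k=1,\dots,q-1$, and elements $\lambda_1,\dots,\lambda_q\in I^d$, such that (i) $K\subset\bigcup_{k=1}^q\prod_{i=1}^d\left[\lambda_k(i)-\frac{\tau}{F(n_k)},\lambda_k(i)\right]$; (ii) for all $i=1,\dots,d$,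 $$\left\|\sum_{k=1}^q\frac{1}{w_1(\lambda_k(i))\cdots w_{n_k}(\lambda_k(i))}e_{n_k}\right\|<\varepsilon;$$ (iii) for all $k=1,\dots,q-1$, all $i=1,\dots,d$ and all $l=0,\dots,N$, $$\left\|\sum_{j=k+1}^q\frac{w_{n_j-n_k+l+1}(\lambda_k(i))\cdots w_{n_j+l}(\lambda_k(i))}{w_{l+1}(\lambda_j(i))\cdots w_{n_j+l}(\lambda_j(i))}e_{n_j-n_k+l}\right\|<\varepsilon.$$
   Context: A Fréchet sequence space is a Fréchet space $X$ contained in the space $\mathbb C^{\mathbb N}$ of all complex sequences $(x_n)_{n\ge0}$ such that each coordinate functional $(x_n)_n\mapsto x_m$ is continuous. Its topology is given by an increasing family of seminorms $(\|\cdot\|_p)_{p\ge1}$, and $\|\cdot\|$ denotes the $F$-norm $\|x\|=\sum_{p\ge1}2^{-p}\min(1,\|x\|_p)$, which defines the topology of $X$. $(e_n)_{n\ge0}$ is the sequence of canonical unit sequences. For a sequence $w=(w_n)_{n\ge1}$ of positive numbers, $B_w$ is the weighted backward shift: $B_we_0=0$, $B_we_n=w_ne_{n-1}$ for $n\ge1$. A continuous family of weighted shifts $(B_{w(a)})_{a\in I}$ on $X$ means: each $w(a)=(w_n(a))_{n\ge1}$ is a sequence of positive numbers such that $B_{w(a)}$ is a continuous operator on $X$, and $a\mapsto w_n(a)$ is continuous on $I$ for each $n\geq 1$. Products of operators act coordinatewise on $X^d$; $\lambda=(\lambda(1),\dots,\lambda(d))$. A common hypercyclic vector for a family of operators is a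 vector $x$ whose orbit $\{T^nx:n\ge0\}$ is dense for every $T$ in the family. *)

theory Defs
  imports "HOL-Analysis.Analysis" "HOL-Library.Function_Algebras"
begin

section \<open>Frechet sequence spaces\<close>

definition cscale :: "complex \<Rightarrow> (nat \<Rightarrow> complex) \<Rightarrow> nat \<Rightarrow> complex" where
  "cscale c x = (\<lambda>n. c * x n)"

lemma cscale_apply [simp]: "cscale c x n = c * x n"
  by (simp add: cscale_def)

interpretation cseq: vector_space cscale
  by unfold_locales (auto simp: fun_eq_iff algebra_simps)

text \<open>A fundamental system of seminorms on \<open>X\<close>. It is indexed by the integers \<open>p \<ge> 1\<close>
  (the value at \<open>p = 0\<close> is never used), and the values outside \<open>X\<close> are irrelevant.\<close>

definition seminorm_on :: "(nat \<Rightarrow> complex) set \<Rightarrow> ((nat \<Rightarrow> complex) \<Rightarrow> real) \<Rightarrow> bool" where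
  "seminorm_on X s \<longleftrightarrow>
     (\<forall>x\<in>X. 0 \<le> s x) \<and>
     (\<forall>x\<in>X. \<forall>y\<in>X. s (x + y) \<le> s x + s y) \<and>
     (\<forall>c. \<forall>x\<in>X. s (cscale c x) = cmod c * s x)"

definition seminorm_system ::
    "(nat \<Rightarrow> complex) set \<Rightarrow> (nat \<Rightarrow> (nat \<Rightarrow> complex) \<Rightarrow> real) \<Rightarrow> bool" where
  "seminorm_system X nrm \<longleftrightarrow>
     cseq.subspace X \<and>
     (\<forall>p\<ge>1. seminorm_on X (nrm p)) \<and>
     (\<forall>p\<ge>1. \<forall>x\<in>X. nrm p x \<le> nrm (Suc p) x) \<and>
     (\<forall>x\<in>X. (\<forall>p\<ge>1. nrm p x = 0) \<longrightarrow> x = 0)"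

definition Fnorm :: "(nat \<Rightarrow> (nat \<Rightarrow> complex) \<Rightarrow> real) \<Rightarrow> (nat \<Rightarrow> complex) \<Rightarrow> real" where
  "Fnorm nrm x = (\<Sum>p. min 1 (nrm (Suc p) x) / 2 ^ Suc p)"

text \<open>The cut-off outside \<open>X\<close> is only there because \<^locale>\<open>Metric_space\<close> requires
  nonnegativity and symmetry of the distance on the whole type.\<close>

definition Fdist ::
    "(nat \<Rightarrow> complex) set \<Rightarrow> (nat \<Rightarrow> (nat \<Rightarrow> complex) \<Rightarrow> real)
      \<Rightarrow> (nat \<Rightarrow> complex) \<Rightarrow> (nat \<Rightarrow> complex) \<Rightarrow> real" where
  "Fdist X nrm x y = (if x \<in> X \<and> y \<in> X then Fnorm nrm (x - y) else 0)"

definition seqtop ::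
    "(nat \<Rightarrow> complex) set \<Rightarrow> (nat \<Rightarrow> (nat \<Rightarrow> complex) \<Rightarrow> real) \<Rightarrow> (nat \<Rightarrow> complex) topology" where
  "seqtop X nrm = Metric_space.mtopology X (Fdist X nrm)"

definition frechet_sequence_space ::
    "(nat \<Rightarrow> complex) set \<Rightarrow> (nat \<Rightarrow> (nat \<Rightarrow> complex) \<Rightarrow> real) \<Rightarrow> bool" where
  "frechet_sequence_space X nrm \<longleftrightarrow>
     seminorm_system X nrm \<and>
     Metric_space.mcomplete X (Fdist X nrm) \<and>
     (\<forall>m. continuous_map (seqtop X nrm) euclidean (\<lambda>x. x m))"

lemma Fnorm_summable:
  assumes "seminorm_system X nrm" "x \<in> X"
  shows "summable (\<lambda>p. min 1 (nrm (Suc p) x) / 2 ^ Suc p)"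
proof (rule summable_comparison_test')
  show "summable (\<lambda>p. (1/2) ^ Suc p :: real)"
    by (subst summable_Suc_iff) (simp add: summable_geometric)
  fix p :: nat
  have "0 \<le> nrm (Suc p) x"
    using assms by (auto simp: seminorm_system_def seminorm_on_def)
  then show "norm (min 1 (nrm (Suc p) x) / 2 ^ Suc p) \<le> (1/2) ^ Suc p"
    by (simp add: field_simps)
qed

lemma Metric_space_Fdist:
  assumes S: "seminorm_system X nrm"
  shows "Metric_space X (Fdist X nrm)"
proof -
  have sub: "cseq.subspace X" and
    nn: "\<And>p x. x \<in> X \<Longrightarrow> 0 \<le> nrm (Suc p) x" and
    tri: "\<And>p x y. x \<in> X \<Longrightarrow> y \<in> X \<Longrightarrow> nrm (Suc p) (x + y) \<le> nrm (Suc p) x + nrm (Suc p) y" and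
    hom: "\<And>p c x. x \<in> X \<Longrightarrow> nrm (Suc p) (cscale c x) = cmod c * nrm (Suc p) x"
    using S by (auto simp: seminorm_system_def seminorm_on_def)
  have sep: "x = 0" if "x \<in> X" "\<And>p. nrm (Suc p) x = 0" for x
  proof -
    have "nrm p x = 0" if "p \<ge> 1" for p
      using that \<open>\<And>p. nrm (Suc p) x = 0\<close> by (cases p) auto
    then show ?thesis
      using S \<open>x \<in> X\<close> by (auto simp: seminorm_system_def)
  qed
  have diff: "x - y \<in> X" if "x \<in> X" "y \<in> X" for x y
    using cseq.subspace_diff[OF sub that] .
  have ge0: "0 \<le> Fnorm nrm x" if "x \<in> X" for x
    unfolding Fnorm_def using nn[OF that]
    by (intro suminf_nonneg Fnorm_summable[OF S that]) auto
  have eq0: "x = 0" if "x \<in> X" "Fnorm nrm x = 0" for x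
  proof -
    have "min 1 (nrm (Suc p) x) / 2 ^ Suc p = 0" for p
      using suminf_eq_zero_iff[OF Fnorm_summable[OF S that(1)]] nn[OF that(1)] that(2)
      unfolding Fnorm_def by auto
    then have "min 1 (nrm (Suc p) x) = 0" for p
      by simp
    then have "nrm (Suc p) x = 0" for p
      by (metis min_def zero_neq_one)
    then show ?thesis using sep that by blast
  qed
  have zeroX: "0 \<in> X" using cseq.subspace_0[OF sub] .
  have "nrm (Suc p) 0 = 0" for p
    using hom[OF zeroX, of p 0] by (simp add: cseq.scale_zero_left)
  then have F0: "Fnorm nrm 0 = 0"
    by (simp add: Fnorm_def)
  have "nrm (Suc p) (x - y) = nrm (Suc p) (y - x)" if "x \<in> X" "y \<in> X" for p x y
  proof -
    have "y - x = cscale (-1) (x - y)"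
      by (auto simp: fun_eq_iff)
    then show ?thesis
      using hom[OF diff[OF that], of p "-1"] by simp
  qed
  then have sym: "Fnorm nrm (x - y) = Fnorm nrm (y - x)" if "x \<in> X" "y \<in> X" for x y
    using that by (simp add: Fnorm_def)
  have Ftri: "Fnorm nrm (x + y) \<le> Fnorm nrm x + Fnorm nrm y" if "x \<in> X" "y \<in> X" for x y
  proof -
    have xy: "x + y \<in> X" using cseq.subspace_add[OF sub that] .
    have "min 1 (nrm (Suc p) (x + y)) \<le> min 1 (nrm (Suc p) x) + min 1 (nrm (Suc p) y)" for p
      using tri[OF that, of p] nn[OF that(1), of p] nn[OF that(2), of p] by (auto simp: min_def)
    then have "Fnorm nrm (x + y)
        \<le> (\<Sum>p. min 1 (nrm (Suc p) x) / 2 ^ Suc p + min 1 (nrm (Suc p) y) / 2 ^ Suc p)"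
      unfolding Fnorm_def
      by (intro suminf_le Fnorm_summable[OF S xy] summable_add Fnorm_summable[OF S that(1)]
            Fnorm_summable[OF S that(2)])
         (simp add: add_divide_distrib[symmetric] divide_right_mono)
    also have "\<dots> = Fnorm nrm x + Fnorm nrm y"
      unfolding Fnorm_def
      by (intro suminf_add[symmetric] Fnorm_summable[OF S that(1)] Fnorm_summable[OF S that(2)])
    finally show ?thesis .
  qed
  show ?thesis
  proof
    show "0 \<le> Fdist X nrm x y" for x y
      by (auto simp: Fdist_def intro: ge0 diff)
    show "Fdist X nrm x y = Fdist X nrm y x" for x y
      by (auto simp: Fdist_def intro: sym)
    show "Fdist X nrm x y = 0 \<longleftrightarrow> x = y" if "x \<in> X" "y \<in> X" for x y
      using that eq0[OF diff[OF that]] F0 by (auto simp: Fdist_def)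
    show "Fdist X nrm x z \<le> Fdist X nrm x y + Fdist X nrm y z"
      if "x \<in> X" "y \<in> X" "z \<in> X" for x y z
      using that Ftri[OF diff[of x y] diff[of y z]] by (simp add: Fdist_def)
  qed
qed

lemma topspace_seqtop [simp]:
  "seminorm_system X nrm \<Longrightarrow> topspace (seqtop X nrm) = X"
  by (simp add: seqtop_def Metric_space.topspace_mtopology[OF Metric_space_Fdist])

section \<open>Unconditional bases\<close>

definition unit_seq :: "nat \<Rightarrow> nat \<Rightarrow> complex" where
  "unit_seq n = (\<lambda>m. if m = n then 1 else 0)"

definition series_to ::
    "(nat \<Rightarrow> complex) topology \<Rightarrow> (nat \<Rightarrow> nat \<Rightarrow> complex) \<Rightarrow> (nat \<Rightarrow> complex) \<Rightarrow> bool" where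
  "series_to T u x \<longleftrightarrow> limitin T (\<lambda>N. \<Sum>n<N. u n) x sequentially"

definition basis_of :: "(nat \<Rightarrow> complex) topology \<Rightarrow> (nat \<Rightarrow> nat \<Rightarrow> complex) \<Rightarrow> bool" where
  "basis_of T b \<longleftrightarrow>
     (\<forall>n. b n \<in> topspace T) \<and>
     (\<forall>x\<in>topspace T. \<exists>!a. series_to T (\<lambda>n. cscale (a n) (b n)) x)"

definition unconditional_basis_of ::
    "(nat \<Rightarrow> complex) topology \<Rightarrow> (nat \<Rightarrow> nat \<Rightarrow> complex) \<Rightarrow> bool" where
  "unconditional_basis_of T b \<longleftrightarrow>
     basis_of T b \<and>
     (\<forall>x a \<pi>. series_to T (\<lambda>n. cscale (a n) (b n)) x \<longrightarrow> bij \<pi> \<longrightarrow>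
        series_to T (\<lambda>n. cscale (a (\<pi> n)) (b (\<pi> n))) x)"

section \<open>Weighted shifts and hypercyclicity\<close>

text \<open>Only the weights \<open>w 1, w 2, \<dots>\<close> are used.\<close>

definition wshift :: "(nat \<Rightarrow> real) \<Rightarrow> (nat \<Rightarrow> complex) \<Rightarrow> nat \<Rightarrow> complex" where
  "wshift w x = (\<lambda>n. of_real (w (Suc n)) * x (Suc n))"

lemma wshift_unit_seq_0: "wshift w (unit_seq 0) = 0"
  by (auto simp: wshift_def unit_seq_def)

lemma wshift_unit_seq:
  "n \<ge> 1 \<Longrightarrow> wshift w (unit_seq n) = cscale (of_real (w n)) (unit_seq (n - 1))"
  by (auto simp: wshift_def unit_seq_def fun_eq_iff)

text \<open>Conversely, the action on the unit sequences determines the operator.\<close>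

lemma wshift_unique:
  assumes X: "frechet_sequence_space X nrm" and b: "basis_of (seqtop X nrm) unit_seq"
    and T: "continuous_map (seqtop X nrm) (seqtop X nrm) T"
    and add: "\<And>x y. x \<in> X \<Longrightarrow> y \<in> X \<Longrightarrow> T (x + y) = T x + T y"
    and scale: "\<And>c x. x \<in> X \<Longrightarrow> T (cscale c x) = cscale c (T x)"
    and T0: "T (unit_seq 0) = 0"
    and Tn: "\<And>n. n \<ge> 1 \<Longrightarrow> T (unit_seq n) = cscale (of_real (w n)) (unit_seq (n - 1))"
    and x: "x \<in> X"
  shows "T x = wshift w x"
proof
  fix m
  have S: "seminorm_system X nrm"
    and coord: "\<And>m. continuous_map (seqtop X nrm) euclidean (\<lambda>x. x m)"
    using X by (auto simp: frechet_sequence_space_def)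
  have sub: "cseq.subspace X" using S by (simp add: seminorm_system_def)
  have eX: "unit_seq n \<in> X" for n
    using b S by (simp add: basis_of_def)
  obtain a where a: "series_to (seqtop X nrm) (\<lambda>n. cscale (a n) (unit_seq n)) x"
    using b S x by (auto simp: basis_of_def)
  define s where "s N = (\<Sum>n<N. cscale (a n) (unit_seq n))" for N
  have sX: "s N \<in> X" for N
    unfolding s_def by (intro cseq.subspace_sum[OF sub] cseq.subspace_scale[OF sub] eX)
  have lim: "limitin (seqtop X nrm) s x sequentially"
    using a by (simp add: series_to_def s_def[abs_def])
  have s0: "T 0 = 0"
    using scale[OF eX, of 0] by (simp add: cseq.scale_zero_left)
  have s_apply: "s N k = (if k < N then a k else 0)" for N k
    by (induction N) (auto simp: s_def unit_seq_def less_Suc_eq)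
  have sSuc: "s (Suc N) = s N + cscale (a N) (unit_seq N)" for N
    by (simp add: s_def)
  have Ts: "T (s N) = wshift w (s N)" for N
  proof (induction N)
    case 0
    have "wshift w 0 = 0" by (simp add: wshift_def fun_eq_iff)
    moreover have "s 0 = 0" by (simp add: s_def fun_eq_iff)
    ultimately show ?case using s0 by metis
  next
    case (Suc N)
    have "T (unit_seq N) = wshift w (unit_seq N)"
      using T0 Tn[of N] wshift_unit_seq_0 wshift_unit_seq[of N w] by (cases N) auto
    then have "T (s (Suc N)) = wshift w (s N) + cscale (a N) (wshift w (unit_seq N))"
      using Suc add[OF sX cseq.subspace_scale[OF sub eX]] scale[OF eX] by (simp add: sSuc)
    also have "\<dots> = wshift w (s (Suc N))"
      unfolding sSuc by (simp add: wshift_def fun_eq_iff algebra_simps)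
    finally show ?case .
  qed
  have l1: "((\<lambda>N. s N k) \<longlongrightarrow> x k) sequentially" for k
    using continuous_map_limit[OF coord lim] by (simp add: o_def)
  have l2: "((\<lambda>N. T (s N) m) \<longlongrightarrow> T x m) sequentially"
    using continuous_map_limit[OF coord continuous_map_limit[OF T lim]] by (simp add: o_def)
  have "((\<lambda>N. T (s N) m) \<longlongrightarrow> wshift w x m) sequentially"
    unfolding Ts wshift_def by (intro tendsto_intros l1)
  with l2 show "T x m = wshift w x m"
    using LIMSEQ_unique by blast
qed

definition power_space :: "'a topology \<Rightarrow> ('d \<Rightarrow> 'a) topology" where
  "power_space T = product_topology (\<lambda>_. T) UNIV"

definition prod_op :: "('d \<Rightarrow> 'a \<Rightarrow> 'a) \<Rightarrow> ('d \<Rightarrow> 'a) \<Rightarrow> 'd \<Rightarrow> 'a" where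
  "prod_op S x = (\<lambda>i. S i (x i))"

definition hypercyclic_vector :: "'a topology \<Rightarrow> ('a \<Rightarrow> 'a) \<Rightarrow> 'a \<Rightarrow> bool" where
  "hypercyclic_vector T S x \<longleftrightarrow>
     x \<in> topspace T \<and> T closure_of (range (\<lambda>n. (S ^^ n) x)) = topspace T"

definition common_hypercyclic_vector ::
    "'a topology \<Rightarrow> ('l \<Rightarrow> 'a \<Rightarrow> 'a) \<Rightarrow> 'l set \<Rightarrow> 'a \<Rightarrow> bool" where
  "common_hypercyclic_vector T S L x \<longleftrightarrow>
     x \<in> topspace T \<and> (\<forall>l\<in>L. hypercyclic_vector T (S l) x)"

definition sigma_compact :: "'a::topological_space set \<Rightarrow> bool" where
  "sigma_compact S \<longleftrightarrow> (\<exists>K :: nat \<Rightarrow> 'a set. (\<forall>n. compact (K n)) \<and> S = (\<Union>n. K n))"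

end

theory Submission
  imports Defs
begin

text \<open>
  Unconditionality and the Baire category theorem show that the topology of \<open>X\<close> is given by solid
  seminorms, \<open>|y\<^sub>n| \<le> |x\<^sub>n|\<close> for all \<open>n\<close> implying \<open>sn p y \<le> sn p x\<close>. Since \<open>w\<^sub>n(a)/w\<^sub>n(b) \<ge> c\<close>,
  the powers \<open>B\<^sub>a\<^sup>n\<close>, \<open>a \<in> I\<close>, are then equicontinuous for each \<open>n\<close>.

  (c) implies (a): given \<open>u, v\<close> supported in \<open>[0, L)\<close>, take the times \<open>m\<^sub>k = n\<^sub>k - L\<close> and add to \<open>u\<close> the
  preimages of \<open>v\<close> under \<open>B\<^sup>m\<close>, \<open>m = m\<^sub>k\<close>, for the parameter \<open>\<lambda>\<^sub>k\<close>. Condition (ii) makes the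
  perturbation small, (iii) makes the later preimages harmless at time \<open>m\<^sub>k\<close>, and for \<open>\<lambda>\<close> in the \<open>k\<close>-th
  cube the weights differ from those of \<open>\<lambda>\<^sub>k\<close> by a factor at most \<open>exp (2 C \<tau>)\<close>. By equicontinuity
  a whole neighbourhood of the constructed vector hits the target, and Baire's theorem applies.

  (b) implies (c): let \<open>x\<close> be a common hypercyclic vector and collect, for each \<open>n\<close>, the parameters for
  which the \<open>n\<close>-th iterate of \<open>x\<close> is close to \<open>e\<^sub>0 - e\<^sub>1 - \<dots> - e\<^sub>N\<close>. Each such set has diameter at
  most \<open>\<tau> / F(n)\<close>, the signs separate the times by more than \<open>N\<close>, and (ii) and (iii) are dominated
  by a tail of \<open>x\<close> and by the error of approximation.
\<close>

section \<open>Seminorms of a Frechet sequence space\<close>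

text \<open>The given seminorms allow no coordinatewise comparison. Once they are solid, each norm
  in (ii) and (iii) is bounded by naming one vector of X whose coordinates dominate the
  coefficients. Times are lowered by L because (ii) controls a single position n_k, whereas a target
  supported in [0, L) needs preimages at the L positions m_k + l. These are reached from n_k by L -
  l further shifts, and exchanging L weights between parameters costs at most (1/c)^L. The exponent
  2 C \<tau> carries a 2 because a product of weights starting at l + 1 is a quotient of two
  products starting at 1, each with logarithm varying by at most C \<tau>. Monotonicity of the
  weights makes the right corner the worst parameter of a cube. In the converse, the corners are
  built one coordinate at a time as maxima of compact sets of admissible parameters. Their
  coordinates may come from different elements of \<Lambda>, which is why (c) places the corners in
  I^d.\<close>

definition restr :: "nat set \<Rightarrow> (nat \<Rightarrow> complex) \<Rightarrow> nat \<Rightarrow> complex" where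
  "restr J x = (\<lambda>n. if n \<in> J then x n else 0)"

lemma sum_fun_apply: "(\<Sum>k\<in>A. g k) n = (\<Sum>k\<in>A. g k n)" for g :: "'k \<Rightarrow> 'a \<Rightarrow> 'b::comm_monoid_add"
  by (induction A rule: infinite_finite_induct) auto

lemma restr_eq_sum: "finite J \<Longrightarrow> (\<Sum>n\<in>J. cscale (x n) (unit_seq n)) = restr J x"
  by (rule ext)
    (simp add: sum_fun_apply restr_def unit_seq_def sum.delta if_distrib[of "\<lambda>y. _ * y"] cong: if_cong)

locale unconditional_frechet =
  fixes X :: "(nat \<Rightarrow> complex) set" and nrm :: "nat \<Rightarrow> (nat \<Rightarrow> complex) \<Rightarrow> real"
  assumes frechet: "frechet_sequence_space X nrm"
    and unconditional: "unconditional_basis_of (seqtop X nrm) unit_seq"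
begin

lemma system: "seminorm_system X nrm"
  using frechet by (simp add: frechet_sequence_space_def)

lemma subspace: "cseq.subspace X"
  using system by (simp add: seminorm_system_def)

lemmas X_add = cseq.subspace_add[OF subspace]
  and X_diff = cseq.subspace_diff[OF subspace]
  and X_scale = cseq.subspace_scale[OF subspace]
  and X_0 = cseq.subspace_0[OF subspace]
  and X_sum = cseq.subspace_sum[OF subspace]

lemma X_unit: "unit_seq n \<in> X"
  using unconditional topspace_seqtop[OF system]
  by (auto simp: unconditional_basis_of_def basis_of_def)

lemma X_restr: "finite J \<Longrightarrow> restr J x \<in> X"
  by (subst restr_eq_sum[symmetric]) (auto intro!: X_sum X_scale X_unit)

text \<open>Indexing from 0 absorbs the restriction p \<ge> 1 on the given system, so every index is
  admissible from here on.\<close>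

definition sem :: "nat \<Rightarrow> (nat \<Rightarrow> complex) \<Rightarrow> real" where
  "sem p = nrm (Suc p)"

lemma sem_nonneg: "x \<in> X \<Longrightarrow> 0 \<le> sem p x"
  and sem_triangle: "x \<in> X \<Longrightarrow> y \<in> X \<Longrightarrow> sem p (x + y) \<le> sem p x + sem p y"
  and sem_scale: "x \<in> X \<Longrightarrow> sem p (cscale a x) = cmod a * sem p x"
  and sem_Suc: "x \<in> X \<Longrightarrow> sem p x \<le> sem (Suc p) x"
  using system by (auto simp: sem_def seminorm_system_def seminorm_on_def)

lemma sem_mono: "p \<le> q \<Longrightarrow> x \<in> X \<Longrightarrow> sem p x \<le> sem q x"
  by (induction q rule: dec_induct) (auto intro: sem_Suc order_trans)

lemma sem_0: "sem p 0 = 0"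
  using sem_scale[OF X_0, of p 0] by (simp add: cseq.scale_zero_left)

lemma sem_separates: "x \<in> X \<Longrightarrow> (\<And>p. sem p x = 0) \<Longrightarrow> x = 0"
proof -
  assume x: "x \<in> X" "\<And>p. sem p x = 0"
  have "nrm p x = 0" if "p \<ge> 1" for p
    using x(2)[of "p - 1"] that by (simp add: sem_def)
  then show "x = 0" using system x(1) by (auto simp: seminorm_system_def)
qed

lemma sem_diff: "x \<in> X \<Longrightarrow> y \<in> X \<Longrightarrow> sem p (x - y) \<le> sem p x + sem p y"
proof -
  assume xy: "x \<in> X" "y \<in> X"
  have "x - y = x + cscale (-1) y" by (simp add: fun_eq_iff)
  then show ?thesis using sem_triangle[OF xy(1) X_scale[OF xy(2)], of p "-1"] sem_scale[OF xy(2), of p "-1"]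
    by simp
qed

lemma sem_minus_commute: "x \<in> X \<Longrightarrow> y \<in> X \<Longrightarrow> sem p (x - y) = sem p (y - x)"
proof -
  assume xy: "x \<in> X" "y \<in> X"
  have "x - y = cscale (-1) (y - x)" by (simp add: fun_eq_iff)
  then show ?thesis using sem_scale[OF X_diff[OF xy(2,1)], of p "-1"] by simp
qed

lemma sem_sum: "(\<And>k. k \<in> A \<Longrightarrow> g k \<in> X) \<Longrightarrow> sem p (\<Sum>k\<in>A. g k) \<le> (\<Sum>k\<in>A. sem p (g k))"
proof (induction A rule: infinite_finite_induct)
  case (insert a A)
  have "sem p (g a + sum g A) \<le> sem p (g a) + sem p (sum g A)"
    using sem_triangle[OF insert.prems[of a] X_sum[of A g], of p] insert.prems by blast
  moreover have "sem p (sum g A) \<le> (\<Sum>k\<in>A. sem p (g k))"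
    using insert by blast
  ultimately show ?case
    unfolding sum.insert[OF insert.hyps] by linarith
qed (auto simp: sem_0)

lemma sem_le_Fnorm: "x \<in> X \<Longrightarrow> min 1 (sem p x) / 2 ^ Suc p \<le> Fnorm nrm x"
proof -
  assume x: "x \<in> X"
  have "sum (\<lambda>p. min 1 (nrm (Suc p) x) / 2 ^ Suc p) {p}
      \<le> (\<Sum>p. min 1 (nrm (Suc p) x) / 2 ^ Suc p)"
    using sem_nonneg[OF x] by (intro sum_le_suminf Fnorm_summable[OF system x]) (auto simp: sem_def)
  then show ?thesis by (simp add: Fnorm_def sem_def)
qed

lemma Fnorm_small_imp_sem_small:
  assumes "\<epsilon> > 0"
  obtains \<delta> where "\<delta> > 0" "\<And>x. x \<in> X \<Longrightarrow> Fnorm nrm x < \<delta> \<Longrightarrow> sem p x < \<epsilon>"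
proof
  show "min 1 \<epsilon> / 2 ^ Suc p > 0" using assms by simp
  fix x assume "x \<in> X" "Fnorm nrm x < min 1 \<epsilon> / 2 ^ Suc p"
  with sem_le_Fnorm[of x p] have "min 1 (sem p x) / 2 ^ Suc p < min 1 \<epsilon> / 2 ^ Suc p" by linarith
  then have "min 1 (sem p x) < min 1 \<epsilon>" by (simp add: divide_less_cancel)
  then show "sem p x < \<epsilon>" by (auto simp: min_def split: if_splits)
qed

text \<open>The terms of index at most p are bounded by means of \<open>sem p x\<close> because the
  seminorms increase, the remaining ones by a geometric tail of total (1/2)^(p+1). The auxiliary
  \<open>g\<close> is this tail.\<close>

lemma Fnorm_le_sem: "x \<in> X \<Longrightarrow> Fnorm nrm x \<le> sem p x + (1/2) ^ Suc p"
proof -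
  assume x: "x \<in> X"
  have half: "(\<lambda>n. (1/2::real) ^ Suc n) sums 1" by (rule power_half_series)
  define g where "g k = (if k < Suc p then 0 else (1/2::real) ^ Suc k)" for k
  have g_shift: "(\<lambda>k. g (k + Suc p)) sums ((1/2) ^ Suc p)"
    using sums_mult[OF half, of "(1/2) ^ Suc p"] by (simp add: g_def power_add mult_ac)
  then have g: "g sums ((1/2) ^ Suc p)"
    using sums_iff_shift'[of g "Suc p" "(1/2) ^ Suc p"] by (simp add: g_def)
  have s: "(\<lambda>k. sem p x * (1/2) ^ Suc k + g k) sums (sem p x + (1/2) ^ Suc p)"
    using sums_add[OF sums_mult[OF half, of "sem p x"] g] by simp
  have "min 1 (nrm (Suc k) x) / 2 ^ Suc k \<le> sem p x * (1/2) ^ Suc k + g k" for k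
  proof (cases "k < Suc p")
    case True
    then have "min 1 (nrm (Suc k) x) \<le> sem p x"
      using sem_mono[of k p x] x by (simp add: sem_def min_def)
    then show ?thesis
      using True divide_right_mono[of "min 1 (nrm (Suc k) x)" "sem p x" "2 ^ Suc k"]
      by (simp add: g_def power_one_over divide_simps)
  next
    case False
    have "min 1 (nrm (Suc k) x) / 2 ^ Suc k \<le> 1 / 2 ^ Suc k"
      by (intro divide_right_mono) auto
    then show ?thesis
      using False sem_nonneg[OF x, of p] by (simp add: g_def power_one_over) (smt (verit) divide_nonneg_nonneg zero_le_power)
  qed
  then have "Fnorm nrm x \<le> (\<Sum>k. sem p x * (1/2) ^ Suc k + g k)"
    unfolding Fnorm_def by (intro suminf_le Fnorm_summable[OF system x] sums_summable[OF s])
  then show ?thesis using sums_unique[OF s] by simp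
qed

text \<open>The bound is given for every q \<ge> p, so that the index can later be enlarged to serve
  a second purpose.\<close>

lemma sem_small_imp_Fnorm_small:
  assumes "\<epsilon> > 0"
  obtains p where "\<And>q x. x \<in> X \<Longrightarrow> p \<le> q \<Longrightarrow> sem q x < \<epsilon> / 2 \<Longrightarrow> Fnorm nrm x < \<epsilon>"
proof -
  obtain p where p: "(1/2::real) ^ p < \<epsilon> / 2"
    using assms real_arch_pow_inv[of "\<epsilon>/2" "1/2"] by auto
  have "Fnorm nrm x < \<epsilon>" if "x \<in> X" "p \<le> q" "sem q x < \<epsilon> / 2" for q x
  proof -
    have "(1/2::real) ^ Suc q \<le> (1/2) ^ p" using that by (intro power_decreasing) auto
    then show ?thesis using Fnorm_le_sem[OF that(1), of q] that(3) p by linarith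
  qed
  then show ?thesis using that by blast
qed

text \<open>No finite intersections of seminorm balls occur: the system increases and the tail of
  the F-norm is uniformly small, so one seminorm and one radius describe a neighbourhood.\<close>

lemma openin_seqtop_sem:
  "openin (seqtop X nrm) U \<longleftrightarrow>
    U \<subseteq> X \<and> (\<forall>x\<in>U. \<exists>p. \<exists>\<delta>>0. \<forall>y\<in>X. sem p (y - x) < \<delta> \<longrightarrow> y \<in> U)"
proof -
  interpret M: Metric_space X "Fdist X nrm" by (rule Metric_space_Fdist[OF system])
  have "(\<exists>r>0. M.mball x r \<subseteq> U) \<longleftrightarrow> (\<exists>p. \<exists>\<delta>>0. \<forall>y\<in>X. sem p (y - x) < \<delta> \<longrightarrow> y \<in> U)"
    if "U \<subseteq> X" "x \<in> U" for x
  proof -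
    have x: "x \<in> X" using that by auto
    have mb: "y \<in> M.mball x r \<longleftrightarrow> y \<in> X \<and> Fnorm nrm (y - x) < r" for y r
      using M.commute[of x y] x by (auto simp: M.in_mball Fdist_def)
    show ?thesis
    proof
      assume "\<exists>r>0. M.mball x r \<subseteq> U"
      then obtain r where r: "r > 0" "\<And>y. y \<in> X \<Longrightarrow> Fnorm nrm (y - x) < r \<Longrightarrow> y \<in> U"
        by (metis mb subsetD)
      obtain p where "\<And>q x. x \<in> X \<Longrightarrow> p \<le> q \<Longrightarrow> sem q x < r / 2 \<Longrightarrow> Fnorm nrm x < r"
        using sem_small_imp_Fnorm_small[OF r(1)] by blast
      then show "\<exists>p. \<exists>\<delta>>0. \<forall>y\<in>X. sem p (y - x) < \<delta> \<longrightarrow> y \<in> U"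
        using r x X_diff half_gt_zero order_refl by blast
    next
      assume "\<exists>p. \<exists>\<delta>>0. \<forall>y\<in>X. sem p (y - x) < \<delta> \<longrightarrow> y \<in> U"
      then obtain p \<epsilon> where e: "\<epsilon> > 0" "\<And>y. y \<in> X \<Longrightarrow> sem p (y - x) < \<epsilon> \<Longrightarrow> y \<in> U"
        by blast
      obtain \<delta> where "\<delta> > 0" "\<And>x. x \<in> X \<Longrightarrow> Fnorm nrm x < \<delta> \<Longrightarrow> sem p x < \<epsilon>"
        using Fnorm_small_imp_sem_small[OF e(1), of p] by blast
      then show "\<exists>r>0. M.mball x r \<subseteq> U"
        unfolding subset_iff mb using e x X_diff by blast
    qed
  qed
  then show ?thesis
    unfolding seqtop_def M.openin_mtopology by blast
qed

lemma openin_sem_ball: "x \<in> X \<Longrightarrow> openin (seqtop X nrm) {y \<in> X. sem p (y - x) < \<epsilon>}"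
  unfolding openin_seqtop_sem
proof safe
  fix y assume xy: "x \<in> X" "y \<in> X" and y: "sem p (y - x) < \<epsilon>"
  have "sem p (z - x) < \<epsilon>" if "z \<in> X" "sem p (z - y) < \<epsilon> - sem p (y - x)" for z
    using sem_triangle[OF X_diff[OF that(1) xy(2)] X_diff[OF xy(2,1)], of p] that(2) by simp
  then show "\<exists>q. \<exists>\<delta>>0. \<forall>z\<in>X. sem q (z - y) < \<delta> \<longrightarrow> z \<in> {y \<in> X. sem p (y - x) < \<epsilon>}"
    using y by (intro exI[of _ p] exI[of _ "\<epsilon> - sem p (y - x)"]) auto
qed

lemma limitin_imp_sem_tendsto:
  assumes "limitin (seqtop X nrm) s x sequentially" "\<epsilon> > 0"
  shows "\<forall>\<^sub>F n in sequentially. s n \<in> X \<and> sem p (s n - x) < \<epsilon>"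
proof -
  have x: "x \<in> X" using assms(1) topspace_seqtop[OF system] by (simp add: limitin_def)
  have "\<forall>\<^sub>F n in sequentially. s n \<in> {y \<in> X. sem p (y - x) < \<epsilon>}"
    using assms x openin_sem_ball[OF x, of p \<epsilon>] sem_0 by (auto simp only: limitin_def mem_Collect_eq diff_self)
  then show ?thesis by simp
qed

lemma sem_Cauchy_imp_limit:
  assumes sX: "\<And>n. s n \<in> X"
    and cauchy: "\<And>p \<epsilon>. \<epsilon> > 0 \<Longrightarrow> \<exists>N. \<forall>m\<ge>N. \<forall>n\<ge>N. sem p (s m - s n) < \<epsilon>"
  obtains x where "limitin (seqtop X nrm) s x sequentially"
proof -
  interpret M: Metric_space X "Fdist X nrm" by (rule Metric_space_Fdist[OF system])
  have "M.MCauchy s"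
    unfolding M.MCauchy_def
  proof (intro conjI allI impI)
    show "range s \<subseteq> X" using sX by auto
    fix \<epsilon> :: real assume e: "\<epsilon> > 0"
    obtain p where p: "\<And>q x. x \<in> X \<Longrightarrow> p \<le> q \<Longrightarrow> sem q x < \<epsilon> / 2 \<Longrightarrow> Fnorm nrm x < \<epsilon>"
      using sem_small_imp_Fnorm_small[OF e] by blast
    obtain N where "\<forall>m\<ge>N. \<forall>n\<ge>N. sem p (s m - s n) < \<epsilon> / 2"
      using cauchy[of "\<epsilon>/2"] e by fastforce
    then show "\<exists>N. \<forall>n n'. N \<le> n \<longrightarrow> N \<le> n' \<longrightarrow> Fdist X nrm (s n) (s n') < \<epsilon>"
      using p[OF X_diff[OF sX sX] order_refl] sX unfolding Fdist_def by (metis)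
  qed
  moreover have "M.mcomplete" using frechet by (simp add: frechet_sequence_space_def)
  ultimately show ?thesis
    using that unfolding M.mcomplete_def seqtop_def by blast
qed

lemma coord_continuous: "continuous_map (seqtop X nrm) euclidean (\<lambda>x. x m)"
  using frechet by (simp add: frechet_sequence_space_def)

lemma limitin_coord: "limitin (seqtop X nrm) s x sequentially \<Longrightarrow> (\<lambda>n. s n m) \<longlonglongrightarrow> x m"
  using continuous_map_limit[OF coord_continuous, of s x sequentially m] by (simp add: o_def)

lemma series_to_iff_restr:
  "series_to (seqtop X nrm) (\<lambda>n. cscale (x n) (unit_seq n)) y
    \<longleftrightarrow> limitin (seqtop X nrm) (\<lambda>N. restr {..<N} x) y sequentially"
  by (simp add: series_to_def restr_eq_sum)

lemma series_limit_eq: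
  assumes "limitin (seqtop X nrm) (\<lambda>N. restr {..<N} x) y sequentially"
  shows "y = x"
proof
  fix m
  have "(\<lambda>N. restr {..<N} x m) \<longlonglongrightarrow> y m" using limitin_coord[OF assms] .
  moreover have "(\<lambda>N. restr {..<N} x m) \<longlonglongrightarrow> x m"
    by (rule tendsto_eventually) (rule eventually_mono[OF eventually_gt_at_top[of m]], simp add: restr_def)
  ultimately show "y m = x m" using LIMSEQ_unique by blast
qed

text \<open>The definition of a basis yields only some coefficient sequence. Continuity of the
  coordinates identifies it with x itself, since truncations are eventually constant in each
  coordinate.\<close>

lemma series_expansion:
  assumes "x \<in> X"
  shows "series_to (seqtop X nrm) (\<lambda>n. cscale (x n) (unit_seq n)) x"
proof -
  obtain a where a: "series_to (seqtop X nrm) (\<lambda>n. cscale (a n) (unit_seq n)) x"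
    using unconditional assms topspace_seqtop[OF system]
    by (auto simp: unconditional_basis_of_def basis_of_def)
  then have "x = a" using series_limit_eq by (simp add: series_to_iff_restr)
  with a show ?thesis by simp
qed

end

section \<open>Unconditional convergence\<close>

lemma bij_betw_initial_segment:
  fixes a b :: nat
  assumes "J \<subseteq> {a..<b}"
  shows "\<exists>g. bij_betw g {a..<b} {a..<b} \<and> bij_betw g {a..<a + card J} J"
proof -
  have fin: "finite J" using assms finite_subset by blast
  have le: "a + card J \<le> b" if "J \<noteq> {}"
    using card_mono[OF finite_atLeastLessThan assms] that assms by fastforce
  have sub: "{a..<a + card J} \<subseteq> {a..<b}" using le by (cases "J = {}") auto
  obtain g1 where g1: "bij_betw g1 {a..<a + card J} J"
    using finite_same_card_bij[of "{a..<a + card J}" J] fin by auto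
  have "card ({a..<b} - {a..<a + card J}) = card ({a..<b} - J)"
    using assms fin sub by (simp add: card_Diff_subset)
  then obtain g2 where g2: "bij_betw g2 ({a..<b} - {a..<a + card J}) ({a..<b} - J)"
    using finite_same_card_bij[of "{a..<b} - {a..<a + card J}" "{a..<b} - J"] by auto
  define g where "g x = (if x \<in> {a..<a + card J} then g1 x else g2 x)" for x
  have "bij_betw g ({a..<a + card J} \<union> ({a..<b} - {a..<a + card J})) (J \<union> ({a..<b} - J))"
    unfolding g_def by (rule bij_betw_disjoint_Un[OF g1 g2]) auto
  moreover have "bij_betw g {a..<a + card J} J"
    using g1 by (rule bij_betw_cong[THEN iffD1, rotated]) (simp add: g_def)
  moreover have "{a..<a + card J} \<union> ({a..<b} - {a..<a + card J}) = {a..<b}" "J \<union> ({a..<b} - J) = {a..<b}"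
    using sub assms by auto
  ultimately show ?thesis by auto
qed

text \<open>Each block is permuted internally with \<open>J k\<close> moved to its front, so that
  after rearrangement the sum over \<open>J k\<close> is a difference of two partial sums. Large
  subsums will thus contradict convergence of a rearranged series.\<close>

lemma bij_gathering_blocks:
  fixes m :: "nat \<Rightarrow> nat"
  assumes m: "strict_mono m" "m 0 = 0" and J: "\<And>k. J k \<subseteq> {m k..<m (Suc k)}"
  obtains \<pi> where "bij \<pi>" "\<And>k. bij_betw \<pi> {m k..<m k + card (J k)} (J k)"
proof -
  let ?A = "\<lambda>k. {m k..<m (Suc k)}"
  have "\<forall>k. \<exists>g. bij_betw g (?A k) (?A k) \<and> bij_betw g {m k..<m k + card (J k)} (J k)"
    using bij_betw_initial_segment[OF J] by blast
  then obtain g where g: "\<And>k. bij_betw (g k) (?A k) (?A k)"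
    "\<And>k. bij_betw (g k) {m k..<m k + card (J k)} (J k)"
    by metis
  have disj: "k = k'" if "n \<in> ?A k" "n \<in> ?A k'" for n k k'
  proof (rule ccontr)
    assume "k \<noteq> k'"
    then have "Suc k \<le> k' \<or> Suc k' \<le> k" by auto
    then have "m (Suc k) \<le> m k' \<or> m (Suc k') \<le> m k"
      using m(1) by (auto simp: strict_mono_less_eq)
    then show False using that by auto
  qed
  have ex: "\<exists>k. n \<in> ?A k" for n
  proof (induction n)
    case 0
    show ?case using strict_monoD[OF m(1), of 0 1] m(2) by (intro exI[of _ 0]) auto
  next
    case (Suc n)
    then obtain k where k: "n \<in> ?A k" by blast
    show ?case
    proof (cases "Suc n < m (Suc k)")
      case True
      then show ?thesis using k by (intro exI[of _ k]) auto
    next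
      case False
      then show ?thesis
        using k strict_monoD[OF m(1), of "Suc k" "Suc (Suc k)"] by (intro exI[of _ "Suc k"]) auto
    qed
  qed
  define i where "i n = (THE k. n \<in> ?A k)" for n
  have i: "i n = k" if "n \<in> ?A k" for n k
    unfolding i_def using that disj by blast
  define \<pi> where "\<pi> n = g (i n) n" for n
  have "bij_betw \<pi> (\<Union>k\<in>UNIV. ?A k) (\<Union>k\<in>UNIV. ?A k)"
  proof (rule bij_betw_UNION_disjoint)
    show "disjoint_family_on ?A UNIV"
      unfolding disjoint_family_on_def using disj by blast
    show "bij_betw \<pi> (?A k) (?A k)" for k
      using g(1)[of k] by (rule bij_betw_cong[THEN iffD1, rotated]) (simp add: \<pi>_def i)
  qed
  moreover have "(\<Union>k\<in>UNIV. ?A k) = UNIV" using ex by blast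
  moreover have "bij_betw \<pi> {m k..<m k + card (J k)} (J k)" for k
  proof -
    have "card (J k) \<le> card (?A k)" using J by (intro card_mono) auto
    then have "{m k..<m k + card (J k)} \<subseteq> ?A k"
      using strict_monoD[OF m(1), of k "Suc k"] by auto
    then show ?thesis
      using g(2)[of k] by (intro bij_betw_cong[THEN iffD1, OF _ g(2)[of k]]) (auto simp: \<pi>_def i subset_iff)
  qed
  ultimately show ?thesis using that by metis
qed

text \<open>A point t of the cube [0,1]^J is a convex combination of vertices, and vertices
  correspond to subsets of J. The induction treats one coordinate at a time; z is arbitrary so that
  it can absorb the terms already chosen.\<close>

lemma convex_combination_subset_sums:
  fixes s :: "(nat \<Rightarrow> complex) \<Rightarrow> real" and t :: "nat \<Rightarrow> real"
  assumes X: "cseq.subspace X"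
    and tri: "\<And>x y. x \<in> X \<Longrightarrow> y \<in> X \<Longrightarrow> s (x + y) \<le> s x + s y"
    and hom: "\<And>a x. x \<in> X \<Longrightarrow> s (cscale a x) = cmod a * s x"
    and fin: "finite J" and uX: "\<And>n. n \<in> J \<Longrightarrow> u n \<in> X" and z: "z \<in> X"
    and t: "\<And>n. n \<in> J \<Longrightarrow> 0 \<le> t n \<and> t n \<le> 1"
    and bound: "\<And>J'. J' \<subseteq> J \<Longrightarrow> s (z + (\<Sum>n\<in>J'. u n)) \<le> M"
  shows "s (z + (\<Sum>n\<in>J. cscale (of_real (t n)) (u n))) \<le> M"
  using fin uX z t bound
proof (induction J arbitrary: z rule: finite_induct)
  case empty
  then show ?case by auto
next
  case (insert m J)
  let ?v = "\<Sum>n\<in>J. cscale (of_real (t n)) (u n)"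
  have vX: "?v \<in> X" by (intro cseq.subspace_sum[OF X] cseq.subspace_scale[OF X]) (use insert in auto)
  have um: "u m \<in> X" using insert by simp
  have 1: "s (z + ?v) \<le> M"
    using insert.prems by (intro insert.IH) auto
  have 2: "s ((z + u m) + ?v) \<le> M"
  proof (rule insert.IH)
    show "z + u m \<in> X" using cseq.subspace_add[OF X] insert.prems um by blast
    fix J' assume J': "J' \<subseteq> J"
    then have "m \<notin> J'" "finite J'" using insert.hyps finite_subset by auto
    then have "sum u (insert m J') = u m + sum u J'" by (intro sum.insert)
    then show "s (z + u m + sum u J') \<le> M"
      using insert.prems(4)[of "insert m J'"] J' by (metis add.assoc insert_mono)
  qed (use insert.prems in auto)
  have "z + (\<Sum>n\<in>insert m J. cscale (of_real (t n)) (u n)) = z + (cscale (of_real (t m)) (u m) + ?v)"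
    using insert.hyps by (metis (no_types, lifting) sum.insert)
  also have "\<dots> = cscale (of_real (1 - t m)) (z + ?v) + cscale (of_real (t m)) ((z + u m) + ?v)"
    by (rule ext) (simp add: algebra_simps)
  finally have eq: "z + (\<Sum>n\<in>insert m J. cscale (of_real (t n)) (u n))
    = cscale (of_real (1 - t m)) (z + ?v) + cscale (of_real (t m)) ((z + u m) + ?v)" .
  have "s (z + (\<Sum>n\<in>insert m J. cscale (of_real (t n)) (u n)))
    \<le> (1 - t m) * s (z + ?v) + t m * s ((z + u m) + ?v)"
  proof -
    have X1: "z + ?v \<in> X" "(z + u m) + ?v \<in> X"
      by (intro cseq.subspace_add[OF X] insert.prems(2) um vX)+
    have "cmod (complex_of_real (1 - t m)) = 1 - t m" "cmod (complex_of_real (t m)) = t m"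
      using insert.prems(3)[of m] unfolding norm_of_real by auto
    then show ?thesis
      using tri[OF cseq.subspace_scale[OF X X1(1), of "of_real (1 - t m)"]
          cseq.subspace_scale[OF X X1(2), of "of_real (t m)"]]
      by (simp only: eq hom[OF X1(1)] hom[OF X1(2)])
  qed
  also have "\<dots> \<le> (1 - t m) * M + t m * M"
  proof -
    have "0 \<le> 1 - t m" "0 \<le> t m" using insert.prems(3)[OF insertI1] by simp_all
    then show ?thesis using mult_left_mono[OF 1] mult_left_mono[OF 2] by (meson add_mono)
  qed
  also have "\<dots> = M" by (simp add: left_diff_distrib)
  finally show ?case .
qed

section \<open>Bounded multipliers: convergence by rearrangement, uniformity by Baire\<close>

context unconditional_frechet
begin

text \<open>Otherwise arbitrarily remote finite sets have subsums of size at least \<epsilon>.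
  Placed in successive blocks and gathered by a permutation, they keep a rearranged series from
  being Cauchy, against unconditionality.\<close>

lemma series_unordered_Cauchy:
  assumes x: "x \<in> X" and e: "\<epsilon> > 0"
  shows "\<exists>N. \<forall>J. finite J \<longrightarrow> J \<subseteq> {N..} \<longrightarrow> sem p (restr J x) < \<epsilon>"
proof (rule ccontr)
  assume "\<not> ?thesis"
  then have "\<forall>N. \<exists>J. finite J \<and> J \<subseteq> {N..} \<and> sem p (restr J x) \<ge> \<epsilon>"
    by (metis not_less)
  then obtain B where B: "\<And>N. finite (B N)" "\<And>N. B N \<subseteq> {N..}" "\<And>N. sem p (restr (B N) x) \<ge> \<epsilon>"
    by metis
  \<comment> \<open>Each block starts beyond every index of the preceding bad set; inserting N into
    the maximum makes the recursion increase without any knowledge of that set.\<close>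
  define m where "m k = ((\<lambda>N. Suc (Max (insert N (B N)))) ^^ k) 0" for k
  have m_0: "m 0 = 0" by (simp add: m_def)
  have m_Suc: "m (Suc k) = Suc (Max (insert (m k) (B (m k))))" for k
    by (simp add: m_def)
  have mono: "strict_mono m"
  proof (rule strict_mono_Suc_iff[THEN iffD2], rule allI)
    show "m k < m (Suc k)" for k
      unfolding m_Suc using B(1) by (meson Max_ge finite_insert insertI1 le_imp_less_Suc)
  qed
  have sub: "B (m k) \<subseteq> {m k..<m (Suc k)}" for k
  proof
    fix n assume n: "n \<in> B (m k)"
    then have "n \<le> Max (insert (m k) (B (m k)))" using B(1) by (intro Max_ge) auto
    then show "n \<in> {m k..<m (Suc k)}" using n B(2) by (auto simp: m_Suc)
  qed
  obtain \<pi> where \<pi>: "bij \<pi>" "\<And>k. bij_betw \<pi> {m k..<m k + card (B (m k))} (B (m k))"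
    using bij_gathering_blocks[OF mono _ sub] m_0 by blast
  define s where "s N = (\<Sum>n<N. cscale (x (\<pi> n)) (unit_seq (\<pi> n)))" for N
  have "limitin (seqtop X nrm) s x sequentially"
    using unconditional series_expansion[OF x] \<pi>(1)
    unfolding unconditional_basis_of_def series_to_def s_def[abs_def] by blast
  then have "\<forall>\<^sub>F n in sequentially. s n \<in> X \<and> sem p (s n - x) < \<epsilon> / 2"
    using limitin_imp_sem_tendsto e half_gt_zero by blast
  then obtain N where N: "\<And>n. n \<ge> N \<Longrightarrow> s n \<in> X \<and> sem p (s n - x) < \<epsilon> / 2"
    unfolding eventually_sequentially by blast
  let ?a = "m N" and ?b = "m N + card (B (m N))"
  have aN: "?a \<ge> N" using mono by (rule strict_mono_imp_increasing)
  have "restr (B (m N)) x = (\<Sum>n\<in>B (m N). cscale (x n) (unit_seq n))"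
    using B(1) by (simp add: restr_eq_sum)
  also have "\<dots> = (\<Sum>n\<in>{?a..<?b}. cscale (x (\<pi> n)) (unit_seq (\<pi> n)))"
    by (rule sum.reindex_bij_betw[OF \<pi>(2), symmetric])
  also have "\<dots> = s ?b - s ?a"
    unfolding s_def lessThan_atLeast0 by (rule sum_diff_nat_ivl[symmetric]) auto
  also have "\<dots> = (s ?b - x) - (s ?a - x)" by simp
  finally have eq: "restr (B (m N)) x = (s ?b - x) - (s ?a - x)" .
  have "sem p (restr (B (m N)) x) \<le> sem p (s ?b - x) + sem p (s ?a - x)"
    unfolding eq
    by (intro sem_diff X_diff x) (use N[of ?a] N[of ?b] aN in auto)
  also have "\<dots> < \<epsilon> / 2 + \<epsilon> / 2"
    by (intro add_strict_mono conjunct2[OF N]) (use aN in auto)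
  finally show False using B(3)[of "m N"] by simp
qed

text \<open>The factor 4 counts the positive and negative parts of the real and imaginary parts of
  t. Each is a multiplier with values in [0,1], to which convexity over subsets applies.\<close>

lemma sem_multiplier_le:
  assumes fin: "finite J" and t: "\<And>n. cmod (t n) \<le> 1"
    and bound: "\<And>J'. J' \<subseteq> J \<Longrightarrow> sem p (restr J' x) \<le> M"
  shows "sem p (restr J (t * x)) \<le> 4 * M"
proof -
  have real: "sem p (restr J ((\<lambda>n. of_real (r n)) * x)) \<le> M"
    if r: "\<And>n. 0 \<le> r n \<and> r n \<le> 1" for r :: "nat \<Rightarrow> real"
  proof -
    have "sem p (0 + (\<Sum>n\<in>J. cscale (of_real (r n)) (cscale (x n) (unit_seq n)))) \<le> M"
    proof (rule convex_combination_subset_sums[OF subspace sem_triangle sem_scale fin _ X_0 r])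
      show "sem p (0 + (\<Sum>n\<in>J'. cscale (x n) (unit_seq n))) \<le> M" if "J' \<subseteq> J" for J'
        using bound[OF that] restr_eq_sum[OF finite_subset[OF that fin], of x] by simp
      show "cscale (x n) (unit_seq n) \<in> X" for n
        by (intro X_scale X_unit)
    qed
    moreover have "(\<Sum>n\<in>J. cscale (of_real (r n)) (cscale (x n) (unit_seq n)))
        = restr J ((\<lambda>n. of_real (r n)) * x)"
      using restr_eq_sum[OF fin, of "(\<lambda>n. of_real (r n)) * x"] by simp
    ultimately show ?thesis by simp
  qed
  let ?P = "\<lambda>r. restr J ((\<lambda>n. complex_of_real (max (r n) 0)) * x)"
  have P: "?P r \<in> X" for r :: "nat \<Rightarrow> real"
    by (rule X_restr[OF fin])
  have PM: "sem p (?P r) \<le> M" if "\<And>n. \<bar>r n\<bar> \<le> 1" for r :: "nat \<Rightarrow> real"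
    by (rule real) (use that in \<open>auto simp: abs_le_iff\<close>)
  have re: "\<bar>Re (t n)\<bar> \<le> 1" "\<bar>Im (t n)\<bar> \<le> 1" "\<bar>- Re (t n)\<bar> \<le> 1" "\<bar>- Im (t n)\<bar> \<le> 1" for n
    using t[of n] abs_Re_le_cmod[of "t n"] abs_Im_le_cmod[of "t n"] by linarith+
  have split: "restr J (t * x) = (?P (\<lambda>n. Re (t n)) - ?P (\<lambda>n. - Re (t n)))
      + cscale \<i> (?P (\<lambda>n. Im (t n)) - ?P (\<lambda>n. - Im (t n)))"
  proof
    fix n
    have "t n = (of_real (max (Re (t n)) 0) - of_real (max (- Re (t n)) 0))
      + \<i> * (of_real (max (Im (t n)) 0) - of_real (max (- Im (t n)) 0))"
      by (rule complex_eqI) (auto simp: max_def)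
    then have "t n * x n = ((of_real (max (Re (t n)) 0) - of_real (max (- Re (t n)) 0))
      + \<i> * (of_real (max (Im (t n)) 0) - of_real (max (- Im (t n)) 0))) * x n" by simp
    then show "restr J (t * x) n = ((?P (\<lambda>n. Re (t n)) - ?P (\<lambda>n. - Re (t n)))
      + cscale \<i> (?P (\<lambda>n. Im (t n)) - ?P (\<lambda>n. - Im (t n)))) n"
      by (simp add: restr_def algebra_simps)
  qed
  have "sem p (restr J (t * x)) \<le> sem p (?P (\<lambda>n. Re (t n)) - ?P (\<lambda>n. - Re (t n)))
     + sem p (cscale \<i> (?P (\<lambda>n. Im (t n)) - ?P (\<lambda>n. - Im (t n))))"
    unfolding split by (intro sem_triangle X_scale X_diff P)
  also have "\<dots> \<le> (M + M) + (M + M)"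
  proof (rule add_mono)
    show "sem p (?P (\<lambda>n. Re (t n)) - ?P (\<lambda>n. - Re (t n))) \<le> M + M"
      by (rule order_trans[OF sem_diff[OF P P]]) (intro add_mono PM re)
    have "sem p (cscale \<i> (?P (\<lambda>n. Im (t n)) - ?P (\<lambda>n. - Im (t n))))
        = sem p (?P (\<lambda>n. Im (t n)) - ?P (\<lambda>n. - Im (t n)))"
      using sem_scale[OF X_diff[OF P P], of p \<i>] by (simp only: norm_ii mult_1)
    also have "\<dots> \<le> M + M"
      by (rule order_trans[OF sem_diff[OF P P]]) (intro add_mono PM re)
    finally show "sem p (cscale \<i> (?P (\<lambda>n. Im (t n)) - ?P (\<lambda>n. - Im (t n)))) \<le> M + M" .
  qed
  finally show ?thesis by simp
qed

lemma multiplier_in_X: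
  assumes x: "x \<in> X" and t: "\<And>n. cmod (t n) \<le> 1"
  shows "t * x \<in> X"
    and "limitin (seqtop X nrm) (\<lambda>N. restr {..<N} (t * x)) (t * x) sequentially"
proof -
  have "\<exists>N. \<forall>m\<ge>N. \<forall>n\<ge>N. sem p (restr {..<m} (t * x) - restr {..<n} (t * x)) < \<epsilon>"
    if e: "\<epsilon> > 0" for p \<epsilon>
  proof -
    \<comment> \<open>The factor 4 of the multiplier bound turns \<epsilon>/5 into 4\<epsilon>/5,
      still strictly below \<epsilon>.\<close>
    obtain N where N: "\<And>J. finite J \<Longrightarrow> J \<subseteq> {N..} \<Longrightarrow> sem p (restr J x) < \<epsilon> / 5"
      using series_unordered_Cauchy[OF x, of "\<epsilon>/5" p] e by auto
    have *: "sem p (restr {..<m} (t * x) - restr {..<n} (t * x)) < \<epsilon>" if "N \<le> n" "n \<le> m" for m n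
    proof -
      have eq: "restr {..<m} (t * x) - restr {..<n} (t * x) = restr {n..<m} (t * x)"
        using that by (auto simp: restr_def fun_eq_iff)
      have "sem p (restr {n..<m} (t * x)) \<le> 4 * (\<epsilon> / 5)"
        using that by (intro sem_multiplier_le t less_imp_le[OF N]) (auto intro: finite_subset)
      then show ?thesis unfolding eq using e by linarith
    qed
    show ?thesis
    proof (intro exI[of _ N] allI impI)
      fix m n assume "m \<ge> N" "n \<ge> N"
      then show "sem p (restr {..<m} (t * x) - restr {..<n} (t * x)) < \<epsilon>"
        using *[of n m] *[of m n] sem_minus_commute[OF X_restr X_restr, of "{..<m}" "{..<n}" p "t * x" "t * x"]
        by (cases "n \<le> m") auto
    qed
  qed
  then obtain y where y: "limitin (seqtop X nrm) (\<lambda>N. restr {..<N} (t * x)) y sequentially"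
    using sem_Cauchy_imp_limit[of "\<lambda>N. restr {..<N} (t * x)"] X_restr by blast
  then have "y = t * x" by (rule series_limit_eq)
  with y show "limitin (seqtop X nrm) (\<lambda>N. restr {..<N} (t * x)) (t * x) sequentially" by simp
  then show "t * x \<in> X" using topspace_seqtop[OF system] by (auto simp: limitin_def)
qed

text \<open>Beyond N unordered Cauchy convergence gives the bound 1, and below N only finitely many
  terms occur. The bound is a natural number so that the Baire argument runs over a countable
  family.\<close>

lemma restr_pointwise_bounded:
  assumes x: "x \<in> X"
  shows "\<exists>k::nat. \<forall>J. finite J \<longrightarrow> sem p (restr J x) \<le> real k"
proof -
  obtain N where N: "\<And>J. finite J \<Longrightarrow> J \<subseteq> {N..} \<Longrightarrow> sem p (restr J x) < 1"
    using series_unordered_Cauchy[OF x zero_less_one] by blast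
  define M where "M = (\<Sum>n<N. sem p (cscale (x n) (unit_seq n))) + 1"
  have "sem p (restr J x) \<le> M" if J: "finite J" for J
  proof -
    have eq: "restr J x = restr (J \<inter> {..<N}) x + restr (J \<inter> {N..}) x"
      by (auto simp: restr_def fun_eq_iff)
    have "sem p (restr (J \<inter> {..<N}) x) \<le> (\<Sum>n\<in>J \<inter> {..<N}. sem p (cscale (x n) (unit_seq n)))"
      using J by (subst restr_eq_sum[symmetric]) (auto intro!: sem_sum X_scale X_unit)
    also have "\<dots> \<le> (\<Sum>n<N. sem p (cscale (x n) (unit_seq n)))"
      by (intro sum_mono2 sem_nonneg X_scale X_unit) auto
    finally show ?thesis
      unfolding eq using sem_triangle[OF X_restr X_restr, of "J \<inter> {..<N}" "J \<inter> {N..}" p x x]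
        N[of "J \<inter> {N..}"] J by (simp add: M_def)
  qed
  moreover obtain k :: nat where "M \<le> real k" using real_arch_simple by blast
  ultimately show ?thesis by (meson order_trans)
qed

text \<open>No bound uniform in J is available yet, so continuity for one finite J comes from the
  coordinates: the variation is at most a finite combination \<open>g\<close> of coordinate
  differences.\<close>

lemma continuous_restr: "finite J \<Longrightarrow> continuous_map (seqtop X nrm) euclideanreal (\<lambda>x. sem p (restr J x))"
proof -
  assume J: "finite J"
  define M where "M = (\<Sum>n\<in>J. sem p (unit_seq n))"
  show ?thesis
    unfolding continuous_map_def
  proof (intro conjI allI impI)
    fix U :: "real set" assume "openin euclideanreal U"
    then have U: "open U" by simp
    show "openin (seqtop X nrm) {x \<in> topspace (seqtop X nrm). sem p (restr J x) \<in> U}"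
    proof (subst openin_subopen, safe)
      fix x assume xX: "x \<in> topspace (seqtop X nrm)" and xU: "sem p (restr J x) \<in> U"
      have x: "x \<in> X" using xX topspace_seqtop[OF system] by simp
      obtain e where e: "e > 0" "\<And>r. \<bar>r - sem p (restr J x)\<bar> < e \<Longrightarrow> r \<in> U"
        using U xU by (auto simp: open_dist dist_real_def)
      define g where "g y = (\<Sum>n\<in>J. cmod (y n - x n) * sem p (unit_seq n))" for y
      have gcont: "continuous_map (seqtop X nrm) euclideanreal g"
        unfolding g_def
        by (intro continuous_map_sum J continuous_map_real_mult continuous_map_norm continuous_map_diff
            coord_continuous) (auto)
      have g: "\<bar>sem p (restr J y) - sem p (restr J x)\<bar> \<le> g y" if "y \<in> X" for y
      proof -
        have d: "sem p (restr J (y - x)) \<le> g y"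
          unfolding g_def restr_eq_sum[OF J, symmetric]
          by (rule order_trans[OF sem_sum]) (auto simp: sem_scale X_unit intro!: X_scale X_unit sum_mono)
        have eqs: "restr J y = restr J x + restr J (y - x)" "restr J x = restr J y - restr J (y - x)"
          by (auto simp: restr_def fun_eq_iff)
        have "sem p (restr J y) \<le> sem p (restr J x) + sem p (restr J (y - x))"
          using sem_triangle[OF X_restr[OF J] X_restr[OF J]] eqs(1) by metis
        moreover have "sem p (restr J x) \<le> sem p (restr J y) + sem p (restr J (y - x))"
          using sem_diff[OF X_restr[OF J] X_restr[OF J]] eqs(2) by metis
        ultimately show ?thesis using d by linarith
      qed
      let ?V = "{y \<in> topspace (seqtop X nrm). g y \<in> {..<e}}"
      have "openin (seqtop X nrm) ?V"
        using gcont by (rule openin_continuous_map_preimage) auto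
      moreover have "x \<in> ?V" using xX e(1) by (simp add: g_def)
      moreover have "?V \<subseteq> {x \<in> topspace (seqtop X nrm). sem p (restr J x) \<in> U}"
        using e(2) g topspace_seqtop[OF system] by fastforce
      ultimately show "\<exists>T. openin (seqtop X nrm) T \<and> x \<in> T \<and>
           T \<subseteq> {x \<in> topspace (seqtop X nrm). sem p (restr J x) \<in> U}"
        by blast
    qed
  qed auto
qed

text \<open>Uniform boundedness principle: the closed sets \<open>A k\<close> exhaust X, hence one
  of them contains a ball around some z. Translating and rescaling this ball gives a bound
  independent of J.\<close>

lemma restr_equicontinuous:
  "\<exists>q M. \<forall>x\<in>X. \<forall>J. finite J \<longrightarrow> sem p (restr J x) \<le> M * sem q x"
proof -
  interpret M: Metric_space X "Fdist X nrm" by (rule Metric_space_Fdist[OF system])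
  define A where "A k = {x \<in> X. \<forall>J. finite J \<longrightarrow> sem p (restr J x) \<le> real k}" for k :: nat
  have clos: "closedin (seqtop X nrm) (A k)" for k
  proof -
    have "A k = (\<Inter>J\<in>Collect finite. {x \<in> topspace (seqtop X nrm). sem p (restr J x) \<in> {..real k}})"
      by (auto simp: A_def topspace_seqtop[OF system])
    also have "closedin (seqtop X nrm) \<dots>"
      by (intro closedin_INT closedin_continuous_map_preimage[OF continuous_restr]) auto
    finally show ?thesis .
  qed
  have "\<exists>k. seqtop X nrm interior_of (A k) \<noteq> {}"
  proof (rule ccontr)
    assume none: "\<not> ?thesis"
    have "M.mtopology interior_of \<Union>(range A) = {}"
    proof (rule M.metric_Baire_category_alt)
      show "M.mcomplete" using frechet by (simp add: frechet_sequence_space_def)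
      show "closedin M.mtopology T \<and> M.mtopology interior_of T = {}" if "T \<in> range A" for T
        using that none clos by (auto simp: seqtop_def)
    qed auto
    moreover have "\<Union>(range A) = X"
      using restr_pointwise_bounded by (auto simp: A_def)
    ultimately show False
      using X_0 interior_of_topspace[of M.mtopology] by auto
  qed
  then obtain k z where "z \<in> seqtop X nrm interior_of (A k)" by blast
  then obtain U where U: "openin (seqtop X nrm) U" "z \<in> U" "U \<subseteq> A k"
    by (auto simp: interior_of_def)
  then obtain q r where r: "r > 0" "\<And>y. y \<in> X \<Longrightarrow> sem q (y - z) < r \<Longrightarrow> y \<in> A k" and z: "z \<in> X"
    unfolding openin_seqtop_sem by (meson subsetD)
  have zk: "z \<in> A k" using U by auto
  have "sem p (restr J x) \<le> (2 * real k / r) * sem q x" if x: "x \<in> X" and J: "finite J" for x J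
  proof -
    \<comment> \<open>As \<open>sem q x\<close> may vanish, x cannot be normalised by it. Scaling by
      any a above \<open>sem q x / r\<close> brings z + x/a into the ball, and the bound at the
      infimum of these a follows by a limit.\<close>
    have small: "sem p (restr J x) \<le> (2 * real k) * a" if a: "a > sem q x / r" for a
    proof -
      have a0: "a > 0" using a r(1) sem_nonneg[OF x, of q] by (smt (verit) divide_nonneg_nonneg)
      have "sem q ((z + cscale (of_real (1/a)) x) - z) = (1/a) * sem q x"
        using sem_scale[OF x, of q "of_real (1/a)"] a0 by (simp add: norm_divide)
      also have "\<dots> < r" using a a0 r(1) by (simp add: field_simps)
      finally have "z + cscale (of_real (1/a)) x \<in> A k"
        by (intro r(2) X_add z X_scale x)
      then have 1: "sem p (restr J (z + cscale (of_real (1/a)) x)) \<le> real k"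
        using J by (simp only: A_def mem_Collect_eq)
      have 2: "sem p (restr J z) \<le> real k" using zk J by (simp add: A_def)
      have "restr J x = cscale (of_real a) (restr J (z + cscale (of_real (1/a)) x) - restr J z)"
        using a0 by (auto simp: restr_def fun_eq_iff)
      then have "sem p (restr J x) = a * sem p (restr J (z + cscale (of_real (1/a)) x) - restr J z)"
        using sem_scale[OF X_diff[OF X_restr[OF J] X_restr[OF J]], of p "of_real a"] a0
        by (metis norm_of_real abs_of_pos)
      also have "\<dots> \<le> a * (real k + real k)"
        by (intro mult_left_mono order_trans[OF sem_diff[OF X_restr[OF J] X_restr[OF J]] add_mono] 1 2
            less_imp_le[OF a0])
      finally show ?thesis by (simp add: mult_ac)
    qed
    have "sem p (restr J x) \<le> (2 * real k) * (sem q x / r) + e" if "e > 0" for e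
    proof -
      have "sem p (restr J x) \<le> (2 * real k) * (sem q x / r + e / (2 * real k + 1))"
        using that by (intro small) auto
      also have "\<dots> \<le> (2 * real k) * (sem q x / r) + e"
      proof -
        have "(2 * real k) * (e / (2 * real k + 1)) \<le> e"
          using that by (simp add: field_simps)
        then show ?thesis by (simp add: distrib_left)
      qed
      finally show ?thesis .
    qed
    then show ?thesis using field_le_epsilon[of "sem p (restr J x)" "(2 * real k) * (sem q x / r)"] by simp
  qed
  then show ?thesis by blast
qed

lemma multiplier_bound:
  "\<exists>q M. M > 0 \<and> (\<forall>x\<in>X. \<forall>t. (\<forall>n. cmod (t n) \<le> 1) \<longrightarrow> sem p (t * x) \<le> M * sem q x)"
proof -
  obtain q M where M: "\<And>x J. x \<in> X \<Longrightarrow> finite J \<Longrightarrow> sem p (restr J x) \<le> M * sem q x"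
    using restr_equicontinuous by metis
  have "sem p (t * x) \<le> (4 * max M 1) * sem q x" if x: "x \<in> X" and t: "\<And>n. cmod (t n) \<le> 1" for x t
  proof (rule field_le_epsilon)
    fix e :: real assume e: "e > 0"
    have "\<forall>\<^sub>F N in sequentially. restr {..<N} (t * x) \<in> X \<and> sem p (restr {..<N} (t * x) - t * x) < e"
      using limitin_imp_sem_tendsto[OF multiplier_in_X(2)[OF x t] e] .
    then obtain N where N: "sem p (restr {..<N} (t * x) - t * x) < e"
      using eventually_happens by fastforce
    have mX: "t * x \<in> X" using multiplier_in_X(1)[OF x t] .
    have "sem p (t * x) \<le> sem p (restr {..<N} (t * x)) + sem p (restr {..<N} (t * x) - t * x)"
      using sem_diff[OF X_restr X_diff[OF X_restr mX], of "{..<N}" "{..<N}" p "t * x" "t * x"]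
      by (simp only: finite_lessThan diff_diff_eq2 add_diff_cancel_left' simp_thms)
    moreover have "sem p (restr {..<N} (t * x)) \<le> 4 * (max M 1 * sem q x)"
    proof (rule sem_multiplier_le[OF _ t])
      fix J' assume "J' \<subseteq> {..<N}"
      then have "sem p (restr J' x) \<le> M * sem q x" using finite_subset by (intro M x) blast
      also have "\<dots> \<le> max M 1 * sem q x" using sem_nonneg[OF x] by (intro mult_right_mono) auto
      finally show "sem p (restr J' x) \<le> max M 1 * sem q x" .
    qed auto
    ultimately show "sem p (t * x) \<le> (4 * max M 1) * sem q x + e" using N by linarith
  qed
  moreover have "4 * max M 1 > 0" by auto
  ultimately show ?thesis by blast
qed

end

section \<open>Solid seminorms\<close>

lemma sparse_sum_apply:
  assumes "finite A" "inj_on g A" "k \<in> A"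
  shows "(\<Sum>j\<in>A. cscale (a j) (unit_seq (g j))) (g k) = a k"
proof -
  have "(\<Sum>j\<in>A. cscale (a j) (unit_seq (g j))) (g k) = (\<Sum>j\<in>A. if k = j then a j else 0)"
    unfolding sum_fun_apply
    by (rule sum.cong) (use assms in \<open>auto simp: unit_seq_def inj_on_def\<close>)
  then show ?thesis using assms by simp
qed

lemma sparse_sum_apply_outside:
  assumes "n \<notin> g ` A"
  shows "(\<Sum>j\<in>A. cscale (a j) (unit_seq (g j))) n = 0"
  unfolding sum_fun_apply by (rule sum.neutral) (use assms in \<open>auto simp: unit_seq_def\<close>)

context unconditional_frechet
begin

text \<open>This is the least solid seminorm above \<open>sem p\<close>. By
  \<open>multiplier_bound\<close> the supremum is finite and dominated by a multiple of some
  \<open>sem q\<close>, so the topology does not change.\<close>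

definition sn :: "nat \<Rightarrow> (nat \<Rightarrow> complex) \<Rightarrow> real" where
  "sn p x = (SUP t\<in>{t. \<forall>n. cmod (t n) \<le> 1}. sem p (t * x))"

lemma sem_multiplier_le_sn:
  assumes "x \<in> X" "\<And>n. cmod (t n) \<le> 1"
  shows "sem p (t * x) \<le> sn p x"
proof -
  obtain q M where "\<forall>x\<in>X. \<forall>t. (\<forall>n. cmod (t n) \<le> 1) \<longrightarrow> sem p (t * x) \<le> M * sem q x"
    using multiplier_bound by meson
  then have "bdd_above ((\<lambda>t. sem p (t * x)) ` {t. \<forall>n. cmod (t n) \<le> 1})"
    using assms(1) by (intro bdd_aboveI2[of _ _ "M * sem q x"]) auto
  then show ?thesis
    unfolding sn_def by (rule cSUP_upper[rotated]) (use assms in auto)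
qed

lemma sn_least:
  assumes "\<And>t. (\<And>n. cmod (t n) \<le> 1) \<Longrightarrow> sem p (t * x) \<le> M"
  shows "sn p x \<le> M"
  unfolding sn_def by (rule cSUP_least) (use assms in \<open>auto intro: exI[of _ "\<lambda>_. 0"]\<close>)

lemma sem_le_sn: "x \<in> X \<Longrightarrow> sem p x \<le> sn p x"
  using sem_multiplier_le_sn[of x 1 p] by simp

lemma sn_nonneg: "x \<in> X \<Longrightarrow> 0 \<le> sn p x"
  using sem_le_sn sem_nonneg order_trans by blast

lemma sn_le_sem: "\<exists>q M. M > 0 \<and> (\<forall>x\<in>X. sn p x \<le> M * sem q x)"
  using multiplier_bound[of p] sn_least by meson

lemma sn_mono: "p \<le> q \<Longrightarrow> x \<in> X \<Longrightarrow> sn p x \<le> sn q x"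
  by (rule sn_least) (meson multiplier_in_X(1) order_trans sem_mono sem_multiplier_le_sn)

lemma sn_triangle: "x \<in> X \<Longrightarrow> y \<in> X \<Longrightarrow> sn p (x + y) \<le> sn p x + sn p y"
proof (rule sn_least)
  fix t :: "nat \<Rightarrow> complex" assume xy: "x \<in> X" "y \<in> X" and t: "\<And>n. cmod (t n) \<le> 1"
  have "sem p (t * (x + y)) \<le> sem p (t * x) + sem p (t * y)"
    unfolding distrib_left by (intro sem_triangle multiplier_in_X xy t)
  also have "\<dots> \<le> sn p x + sn p y"
    by (intro add_mono sem_multiplier_le_sn xy t)
  finally show "sem p (t * (x + y)) \<le> sn p x + sn p y" .
qed

lemma sn_scale_le: "x \<in> X \<Longrightarrow> sn p (cscale a x) \<le> cmod a * sn p x"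
proof (rule sn_least)
  fix t :: "nat \<Rightarrow> complex" assume x: "x \<in> X" and t: "\<And>n. cmod (t n) \<le> 1"
  have "t * cscale a x = cscale a (t * x)" by (simp add: fun_eq_iff)
  then have "sem p (t * cscale a x) = cmod a * sem p (t * x)"
    using sem_scale[OF multiplier_in_X(1)[OF x t]] by simp
  then show "sem p (t * cscale a x) \<le> cmod a * sn p x"
    using sem_multiplier_le_sn[OF x t] by (simp add: mult_left_mono)
qed

lemma sn_0: "sn p 0 = 0"
  using sn_scale_le[OF X_0, of p 0] sn_nonneg[OF X_0, of p] by (simp add: cseq.scale_zero_left)

lemma sn_sum: "(\<And>k. k \<in> A \<Longrightarrow> g k \<in> X) \<Longrightarrow> sn p (\<Sum>k\<in>A. g k) \<le> (\<Sum>k\<in>A. sn p (g k))"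
proof (induction A rule: infinite_finite_induct)
  case (insert a A)
  have "sn p (g a + sum g A) \<le> sn p (g a) + sn p (sum g A)"
    using sn_triangle[OF insert.prems[of a] X_sum[of A g], of p] insert.prems by blast
  moreover have "sn p (sum g A) \<le> (\<Sum>k\<in>A. sn p (g k))"
    using insert by blast
  ultimately show ?case
    unfolding sum.insert[OF insert.hyps] by linarith
qed (auto simp: sn_0)

lemma solid:
  assumes x: "x \<in> X" and M: "0 \<le> M" and le: "\<And>n. cmod (y n) \<le> M * cmod (x n)"
  shows "y \<in> X" and "sn p y \<le> M * sn p x"
proof -
  \<comment> \<open>The bracket equals M except for M = 0, where it is 1; in that case y vanishes
    and so does s.\<close>
  define s where "s n = (if x n = 0 then 0 else y n / (of_real (M + of_bool (M = 0)) * x n))" for n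
  have s1: "cmod (s n) \<le> 1" for n
  proof (cases "x n = 0 \<or> M = 0")
    case True
    then show ?thesis using le[of n] by (auto simp: s_def)
  next
    case False
    then show ?thesis using le[of n] M by (simp add: s_def norm_divide norm_mult divide_simps)
  qed
  have y: "y = cscale (of_real M) (s * x)"
  proof
    fix n
    show "y n = cscale (of_real M) (s * x) n"
      using le[of n] by (auto simp: s_def)
  qed
  have sX: "s * x \<in> X" using multiplier_in_X(1)[OF x s1] .
  then show "y \<in> X" unfolding y by (rule X_scale)
  have "sn p (s * x) \<le> sn p x"
  proof (rule sn_least)
    fix t :: "nat \<Rightarrow> complex" assume t: "\<And>n. cmod (t n) \<le> 1"
    have "cmod ((t * s) n) \<le> 1" for n
      using mult_mono[OF t[of n] s1[of n]] by (simp add: norm_mult)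
    then have "sem p ((t * s) * x) \<le> sn p x" by (intro sem_multiplier_le_sn x)
    then show "sem p (t * (s * x)) \<le> sn p x" by (simp add: mult.assoc)
  qed
  then show "sn p y \<le> M * sn p x"
    unfolding y using sn_scale_le[OF sX, of p "of_real M"] M mult_left_mono order_trans by fastforce
qed

lemma solid1:
  assumes x: "x \<in> X" and le: "\<And>n. cmod (y n) \<le> cmod (x n)"
  shows "y \<in> X" and "sn p y \<le> sn p x"
  using solid[OF x zero_le_one, of y] le by auto

lemma X_restr_any: "x \<in> X \<Longrightarrow> restr J x \<in> X"
  by (erule solid1) (simp add: restr_def)

lemma sn_minus_commute: "x \<in> X \<Longrightarrow> y \<in> X \<Longrightarrow> sn p (x - y) = sn p (y - x)"
  by (intro antisym solid1(2) X_diff) (auto simp: norm_minus_commute)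

lemma coord_le_sn: "y \<in> X \<Longrightarrow> cmod (y l) * sn p (unit_seq l) \<le> sn p y"
proof (cases "y l = 0")
  case False
  assume y: "y \<in> X"
  have "sn p (unit_seq l) \<le> (1 / cmod (y l)) * sn p y"
    by (rule solid(2)[OF y]) (use False in \<open>auto simp: unit_seq_def\<close>)
  then show ?thesis using False by (simp add: field_simps)
qed (auto simp: sn_nonneg)

text \<open>The form in which solidity is applied to (ii) and (iii): distinct positions
  \<open>g k\<close> keep the terms from overlapping, so only single coefficients have to be
  compared with coordinates of y.\<close>

lemma sn_sparse_sum:
  assumes A: "finite A" "inj_on g A" and y: "y \<in> X" and M: "M \<ge> 0"
    and le: "\<And>k. k \<in> A \<Longrightarrow> cmod (a k) \<le> M * cmod (y (g k))"
  shows "sn p (\<Sum>k\<in>A. cscale (a k) (unit_seq (g k))) \<le> M * sn p y"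
proof (rule solid(2)[OF y M])
  fix n
  show "cmod ((\<Sum>k\<in>A. cscale (a k) (unit_seq (g k))) n) \<le> M * cmod (y n)"
  proof (cases "n \<in> g ` A")
    case True
    then show ?thesis using sparse_sum_apply[OF A] le by auto
  next
    case False
    then show ?thesis using M by (simp add: sparse_sum_apply_outside)
  qed
qed

lemma sn_tail_small:
  assumes x: "x \<in> X" and e: "\<epsilon> > 0"
  shows "\<exists>N. \<forall>m\<ge>N. sn p (restr {m..} x) < \<epsilon>"
proof -
  obtain q M where M: "M > 0" "\<And>x. x \<in> X \<Longrightarrow> sn p x \<le> M * sem q x" using sn_le_sem by blast
  have e': "\<epsilon> / M > 0" using e M by simp
  have "limitin (seqtop X nrm) (\<lambda>N. restr {..<N} x) x sequentially"
    using series_expansion[OF x] by (simp add: series_to_iff_restr)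
  from limitin_imp_sem_tendsto[OF this e', of q]
  obtain N where N: "\<And>m. m \<ge> N \<Longrightarrow> sem q (restr {..<m} x - x) < \<epsilon> / M"
    unfolding eventually_sequentially by blast
  have "sn p (restr {m..} x) < \<epsilon>" if "m \<ge> N" for m
  proof -
    have eq: "restr {m..} x = x - restr {..<m} x" by (auto simp: restr_def fun_eq_iff)
    have "sn p (restr {m..} x) \<le> M * sem q (x - restr {..<m} x)"
      unfolding eq by (intro M X_diff x X_restr) auto
    also have "\<dots> = M * sem q (restr {..<m} x - x)"
      using sem_minus_commute[OF x X_restr[of "{..<m}" x]] by simp
    also have "\<dots> < \<epsilon>" using N[OF that] M(1) by (simp add: field_simps)
    finally show ?thesis .
  qed
  then show ?thesis by blast
qed

text \<open>Each unit sequence is nonzero, hence seen by some seminorm; as the seminorms increase,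
  one index serves finitely many of them.\<close>

lemma sn_unit_pos: "\<exists>p. \<forall>l\<le>N. sn p (unit_seq l) > 0"
proof (induction N)
  case 0
  have "\<exists>p. sn p (unit_seq 0) > 0"
  proof (rule ccontr)
    assume "\<not> ?thesis"
    then have "sem p (unit_seq 0) = 0" for p
      using sem_le_sn[OF X_unit[of 0]] sem_nonneg[OF X_unit[of 0]] by (meson antisym not_less order_trans)
    then have "unit_seq 0 = 0" by (rule sem_separates[OF X_unit])
    then show False by (metis one_neq_zero unit_seq_def zero_fun_apply)
  qed
  then show ?case by auto
next
  case (Suc N)
  then obtain p where p: "\<And>l. l \<le> N \<Longrightarrow> sn p (unit_seq l) > 0" by blast
  have "\<exists>q. sn q (unit_seq (Suc N)) > 0"
  proof (rule ccontr)
    assume "\<not> ?thesis"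
    then have "sem p (unit_seq (Suc N)) = 0" for p
      using sem_le_sn[OF X_unit[of "Suc N"]] sem_nonneg[OF X_unit[of "Suc N"]]
      by (meson antisym not_less order_trans)
    then have "unit_seq (Suc N) = 0" by (rule sem_separates[OF X_unit])
    then show False by (metis one_neq_zero unit_seq_def zero_fun_apply)
  qed
  then obtain q where q: "sn q (unit_seq (Suc N)) > 0" by blast
  have "sn (max p q) (unit_seq l) > 0" if "l \<le> Suc N" for l
  proof (cases "l = Suc N")
    case True
    then show ?thesis using q sn_mono[OF max.cobounded2 X_unit] by (metis less_le_trans)
  next
    case False
    then show ?thesis using p[of l] that sn_mono[OF max.cobounded1 X_unit] by (metis le_SucE less_le_trans)
  qed
  then show ?case by blast
qed

lemma sn_small_imp_Fnorm_small:
  assumes "\<epsilon> > 0"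
  obtains p where "\<And>q x. x \<in> X \<Longrightarrow> p \<le> q \<Longrightarrow> sn q x < \<epsilon> / 2 \<Longrightarrow> Fnorm nrm x < \<epsilon>"
  using sem_small_imp_Fnorm_small[OF assms] sem_le_sn by (metis le_less_trans)

lemma Fnorm_small_imp_sn_small:
  assumes "\<epsilon> > 0"
  obtains \<delta> where "\<delta> > 0" "\<And>x. x \<in> X \<Longrightarrow> Fnorm nrm x < \<delta> \<Longrightarrow> sn p x < \<epsilon>"
proof -
  obtain q M where M: "M > 0" "\<And>x. x \<in> X \<Longrightarrow> sn p x \<le> M * sem q x" using sn_le_sem by blast
  obtain \<delta> where d: "\<delta> > 0" "\<And>x. x \<in> X \<Longrightarrow> Fnorm nrm x < \<delta> \<Longrightarrow> sem q x < \<epsilon> / M"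
    using Fnorm_small_imp_sem_small[of "\<epsilon> / M" q] assms M(1) by (metis divide_pos_pos)
  have "sn p x < \<epsilon>" if "x \<in> X" "Fnorm nrm x < \<delta>" for x
    using M(2)[OF that(1)] d(2)[OF that] M(1) by (simp add: field_simps)
  with d(1) show ?thesis using that by blast
qed

lemma openin_seqtop_iff:
  "openin (seqtop X nrm) U \<longleftrightarrow>
    U \<subseteq> X \<and> (\<forall>x\<in>U. \<exists>p. \<exists>\<delta>>0. \<forall>y\<in>X. sn p (y - x) < \<delta> \<longrightarrow> y \<in> U)"
proof -
  have "(\<exists>p. \<exists>\<delta>>0. \<forall>y\<in>X. sem p (y - x) < \<delta> \<longrightarrow> y \<in> U) \<longleftrightarrow>
        (\<exists>p. \<exists>\<delta>>0. \<forall>y\<in>X. sn p (y - x) < \<delta> \<longrightarrow> y \<in> U)" if "U \<subseteq> X" "x \<in> U" for x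
  proof
    assume "\<exists>p. \<exists>\<delta>>0. \<forall>y\<in>X. sem p (y - x) < \<delta> \<longrightarrow> y \<in> U"
    then show "\<exists>p. \<exists>\<delta>>0. \<forall>y\<in>X. sn p (y - x) < \<delta> \<longrightarrow> y \<in> U"
      using sem_le_sn X_diff that by (meson le_less_trans subsetD)
  next
    assume "\<exists>p. \<exists>\<delta>>0. \<forall>y\<in>X. sn p (y - x) < \<delta> \<longrightarrow> y \<in> U"
    then obtain p \<delta> where d: "\<delta> > 0" "\<And>y. y \<in> X \<Longrightarrow> sn p (y - x) < \<delta> \<Longrightarrow> y \<in> U" by blast
    obtain q M where M: "M > 0" "\<And>x. x \<in> X \<Longrightarrow> sn p x \<le> M * sem q x" using sn_le_sem by blast
    have "y \<in> U" if "y \<in> X" "sem q (y - x) < \<delta> / M" for y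
    proof (rule d(2)[OF that(1)])
      have "sn p (y - x) \<le> M * sem q (y - x)" using that \<open>U \<subseteq> X\<close> \<open>x \<in> U\<close> by (intro M X_diff) auto
      also have "\<dots> < \<delta>" using that M(1) by (simp add: field_simps)
      finally show "sn p (y - x) < \<delta>" .
    qed
    moreover have "\<delta> / M > 0" using d M by simp
    ultimately show "\<exists>p. \<exists>\<delta>>0. \<forall>y\<in>X. sem p (y - x) < \<delta> \<longrightarrow> y \<in> U" by blast
  qed
  then show ?thesis unfolding openin_seqtop_sem by blast
qed

lemma openin_sn_ball: "x \<in> X \<Longrightarrow> openin (seqtop X nrm) {y \<in> X. sn p (y - x) < \<epsilon>}"
  unfolding openin_seqtop_iff
proof safe
  fix y assume xy: "x \<in> X" "y \<in> X" and y: "sn p (y - x) < \<epsilon>"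
  have "sn p (z - x) < \<epsilon>" if "z \<in> X" "sn p (z - y) < \<epsilon> - sn p (y - x)" for z
    using sn_triangle[OF X_diff[OF that(1) xy(2)] X_diff[OF xy(2,1)], of p] that(2) by simp
  then show "\<exists>q. \<exists>\<delta>>0. \<forall>z\<in>X. sn q (z - y) < \<delta> \<longrightarrow> z \<in> {y \<in> X. sn p (y - x) < \<epsilon>}"
    using y by (intro exI[of _ p] exI[of _ "\<epsilon> - sn p (y - x)"]) auto
qed

end

section \<open>Powers of weighted shifts\<close>

text \<open>With l the target position and n the length, this is the factor acquired when the n-th
  power takes the unit sequence of index l + n to that of index l. Concatenation then becomes the
  cocycle rule \<open>wprod_add\<close>.\<close>

definition wprod :: "(nat \<Rightarrow> real) \<Rightarrow> nat \<Rightarrow> nat \<Rightarrow> real" where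
  "wprod v l n = (\<Prod>m=l+1..l+n. v m)"

lemma wprod_0 [simp]: "wprod v l 0 = 1"
  by (simp add: wprod_def)

lemma wprod_Suc: "wprod v l (Suc n) = v (Suc l) * wprod v (Suc l) n"
  by (simp add: wprod_def prod.atLeast_Suc_atMost)

lemma wprod_add: "wprod v l (m + n) = wprod v l m * wprod v (l + m) n"
  unfolding wprod_def using prod.ub_add_nat[of "l + 1" "l + m" v n] by (simp add: add.assoc)

lemma wprod_pos: "(\<And>n. n \<ge> 1 \<Longrightarrow> v n > 0) \<Longrightarrow> wprod v l n > 0"
  unfolding wprod_def by (intro prod_pos) auto

lemma wprod_mono:
  "(\<And>n. n \<ge> 1 \<Longrightarrow> 0 < v n \<and> v n \<le> v' n) \<Longrightarrow> wprod v l n \<le> wprod v' l n"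
  unfolding wprod_def by (intro prod_mono) (simp add: less_imp_le)

lemma wshift_funpow: "(wshift v ^^ n) x = (\<lambda>l. of_real (wprod v l n) * x (l + n))"
  by (induction n) (auto simp: wshift_def wprod_Suc)

lemma wshift_funpow_add: "(wshift v ^^ n) (x + y) = (wshift v ^^ n) x + (wshift v ^^ n) y"
  and wshift_funpow_diff: "(wshift v ^^ n) (x - y) = (wshift v ^^ n) x - (wshift v ^^ n) y"
  and wshift_funpow_scale: "(wshift v ^^ n) (cscale a x) = cscale a ((wshift v ^^ n) x)"
  and wshift_funpow_0: "(wshift v ^^ n) 0 = 0"
  unfolding wshift_funpow by (auto simp: fun_eq_iff distrib_left right_diff_distrib)

lemma wshift_funpow_sum: "(wshift v ^^ n) (\<Sum>k\<in>A. g k) = (\<Sum>k\<in>A. (wshift v ^^ n) (g k))"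
proof (induction A rule: infinite_finite_induct)
  case (insert a A)
  then show ?case by (metis sum.insert wshift_funpow_add)
qed (simp_all only: sum.infinite sum.empty wshift_funpow_0 not_False_eq_True)

lemma wshift_funpow_unit:
  "n \<le> t \<Longrightarrow> (wshift v ^^ n) (unit_seq t) = cscale (of_real (wprod v (t - n) n)) (unit_seq (t - n))"
  "t < n \<Longrightarrow> (wshift v ^^ n) (unit_seq t) = 0"
  unfolding wshift_funpow by (auto simp: fun_eq_iff unit_seq_def)

locale weighted_shift_family = unconditional_frechet X nrm
  for X :: "(nat \<Rightarrow> complex) set" and nrm +
  fixes I :: "real set" and w :: "real \<Rightarrow> nat \<Rightarrow> real" and c :: real
  assumes I_nonempty: "I \<noteq> {}"
    and w_pos: "\<And>a n. a \<in> I \<Longrightarrow> n \<ge> 1 \<Longrightarrow> w a n > 0"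
    and shift_continuous: "\<And>a. a \<in> I \<Longrightarrow> continuous_map (seqtop X nrm) (seqtop X nrm) (wshift (w a))"
    and w_continuous: "\<And>n. n \<ge> 1 \<Longrightarrow> continuous_on I (\<lambda>a. w a n)"
    and c_pos: "c > 0"
    and w_ratio: "\<And>a b n. a \<in> I \<Longrightarrow> b \<in> I \<Longrightarrow> n \<ge> 1 \<Longrightarrow> w a n / w b n \<ge> c"
begin

abbreviation B :: "real \<Rightarrow> nat \<Rightarrow> (nat \<Rightarrow> complex) \<Rightarrow> nat \<Rightarrow> complex" where
  "B a n \<equiv> wshift (w a) ^^ n"

lemma W_pos: "a \<in> I \<Longrightarrow> wprod (w a) l n > 0"
  by (intro wprod_pos w_pos)

lemma W_ratio: "a \<in> I \<Longrightarrow> b \<in> I \<Longrightarrow> c ^ n * wprod (w b) l n \<le> wprod (w a) l n"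
proof (induction n arbitrary: l)
  case (Suc n)
  have "c * w b (Suc l) \<le> w a (Suc l)"
    using w_ratio[OF Suc.prems, of "Suc l"] w_pos[OF Suc.prems(2), of "Suc l"] by (simp add: field_simps)
  then have "(c * w b (Suc l)) * (c ^ n * wprod (w b) (Suc l) n) \<le> w a (Suc l) * wprod (w a) (Suc l) n"
    using Suc c_pos w_pos[of _ "Suc l"] W_pos[of b "Suc l" n] by (intro mult_mono) (auto intro: less_imp_le)
  then show ?case by (simp add: wprod_Suc mult_ac)
qed simp

lemma W_le: "a \<in> I \<Longrightarrow> b \<in> I \<Longrightarrow> wprod (w b) l n \<le> (1/c) ^ n * wprod (w a) l n"
  using W_ratio[of a b n l] c_pos by (simp add: field_simps power_one_over)

lemma W_continuous: "continuous_on I (\<lambda>a. wprod (w a) l n)"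
  unfolding wprod_def by (intro continuous_on_prod w_continuous) auto

lemma B_in_X: "a \<in> I \<Longrightarrow> x \<in> X \<Longrightarrow> B a n x \<in> X"
proof (induction n)
  case (Suc n)
  then show ?case
    using continuous_map_funspace[OF shift_continuous[OF Suc.prems(1)]] topspace_seqtop[OF system] by auto
qed simp

text \<open>Each of the n weights changes by a factor at most 1/c when the parameter changes, and
  solidity turns this into an inequality of seminorms. One continuous operator thus controls the
  whole family.\<close>

lemma B_dominated:
  assumes "a \<in> I" "b \<in> I" "x \<in> X"
  shows "sn p (B a n x) \<le> (1/c) ^ n * sn p (B b n x)"
proof (rule solid(2)[OF B_in_X[OF assms(2,3)]])
  fix l
  have "cmod (B a n x l) = wprod (w a) l n * cmod (x (l + n))"
    using W_pos[OF assms(1)] by (simp add: wshift_funpow norm_mult less_imp_le)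
  also have "\<dots> \<le> ((1/c) ^ n * wprod (w b) l n) * cmod (x (l + n))"
    using W_le[OF assms(2,1)] by (intro mult_right_mono) auto
  also have "\<dots> = (1/c) ^ n * cmod (B b n x l)"
    using W_pos[OF assms(2)] by (simp add: wshift_funpow norm_mult less_imp_le)
  finally show "cmod (B a n x l) \<le> (1/c) ^ n * cmod (B b n x l)" .
qed (use c_pos in auto)

lemma B_continuous_at_0:
  assumes a: "a \<in> I"
  shows "\<epsilon> > 0 \<Longrightarrow> \<exists>q. \<exists>\<delta>>0. \<forall>x\<in>X. sn q x < \<delta> \<longrightarrow> sn p (B a n x) < \<epsilon>"
proof (induction n arbitrary: \<epsilon> p)
  case 0
  then show ?case by auto
next
  case (Suc n)
  have B0: "wshift (w a) 0 = 0" by (simp add: wshift_def fun_eq_iff)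
  let ?U = "{x \<in> topspace (seqtop X nrm). wshift (w a) x \<in> {y \<in> X. sn p (y - 0) < \<epsilon>}}"
  have "openin (seqtop X nrm) ?U"
    using openin_sn_ball[OF X_0] shift_continuous[OF a] by (rule openin_continuous_map_preimage[rotated])
  moreover have "0 \<in> ?U"
    using topspace_seqtop[OF system] X_0 Suc.prems by (simp add: B0 sn_0)
  ultimately obtain q \<delta> where "\<delta> > 0" and d: "\<And>y. y \<in> X \<Longrightarrow> sn q (y - 0) < \<delta> \<Longrightarrow> y \<in> ?U"
    unfolding openin_seqtop_iff by meson
  then obtain q' \<delta>' where d': "\<delta>' > 0" "\<And>x. x \<in> X \<Longrightarrow> sn q' x < \<delta>' \<Longrightarrow> sn q (B a n x) < \<delta>"
    using Suc.IH by meson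
  have "sn p (B a (Suc n) x) < \<epsilon>" if "x \<in> X" "sn q' x < \<delta>'" for x
    using d[OF B_in_X[OF a that(1)], of n] d'(2)[OF that] by simp
  with d'(1) show ?case by blast
qed

text \<open>Continuity at 0 is used for one fixed parameter b with the smaller tolerance
  \<open>c ^ n * \<epsilon>\<close>, since passing from b to a costs at most (1/c)^n. Finitely many
  times are handled by a larger index and a smaller radius.\<close>

lemma B_equicontinuous:
  assumes e: "\<epsilon> > 0" and S: "finite S"
  shows "\<exists>q. \<exists>\<delta>>0. \<forall>n\<in>S. \<forall>a\<in>I. \<forall>x\<in>X. sn q x < \<delta> \<longrightarrow> sn p (B a n x) < \<epsilon>"
  using S
proof (induction S rule: finite_induct)
  case empty
  then show ?case by (auto intro: exI[of _ 1])
next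
  case (insert n S)
  obtain q \<delta> where d: "\<delta> > 0"
    "\<And>n a x. n \<in> S \<Longrightarrow> a \<in> I \<Longrightarrow> x \<in> X \<Longrightarrow> sn q x < \<delta> \<Longrightarrow> sn p (B a n x) < \<epsilon>"
    using insert.IH by blast
  obtain b where b: "b \<in> I" using I_nonempty by auto
  have cn: "c ^ n > 0" using c_pos by simp
  obtain q' \<delta>' where d': "\<delta>' > 0" "\<And>x. x \<in> X \<Longrightarrow> sn q' x < \<delta>' \<Longrightarrow> sn p (B b n x) < c ^ n * \<epsilon>"
    using B_continuous_at_0[OF b, of "c ^ n * \<epsilon>"] e cn by (metis mult_pos_pos)
  have new: "sn p (B a n x) < \<epsilon>" if "a \<in> I" "x \<in> X" "sn q' x < \<delta>'" for a x
  proof -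
    have "sn p (B a n x) \<le> (1/c) ^ n * sn p (B b n x)" using B_dominated that b by blast
    also have "\<dots> < \<epsilon>" using d'(2)[OF that(2,3)] cn by (simp add: field_simps)
    finally show ?thesis .
  qed
  have "sn p (B a k x) < \<epsilon>"
    if "k \<in> insert n S" "a \<in> I" "x \<in> X" "sn (max q q') x < min \<delta> \<delta>'" for k a x
    using that d(2)[of k a x] new[of a x] sn_mono[of q "max q q'" x] sn_mono[of q' "max q q'" x]
    by (metis insertE max.cobounded1 max.cobounded2 min_less_iff_conj order_le_less_trans)
  moreover have "min \<delta> \<delta>' > 0" using d d' by simp
  ultimately show ?case by blast
qed

text \<open>Continuity of the weights is available one weight at a time, so it settles only finitely
  many coordinates. On the others the orbit at b is dominated by the fixed vector at a, whose tail
  is small, uniformly in b.\<close>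

lemma B_orbit_continuous:
  assumes x: "x \<in> X" and v: "v \<in> X"
  shows "continuous_on I (\<lambda>a. sn p (B a n x - v))"
proof (rule continuous_on_iff[THEN iffD2], intro ballI allI impI)
  fix a and \<epsilon> :: real assume a: "a \<in> I" and e: "\<epsilon> > 0"
  \<comment> \<open>Both weight products are positive, so their difference is at most (1/c)^n + 1
    times the product at a.\<close>
  define K where "K = (1/c) ^ n + 1"
  have K: "K > 0" using c_pos by (simp add: K_def add_pos_pos)
  obtain N where N: "sn p (restr {N..} (B a n x)) < \<epsilon> / (2 * K)"
    using sn_tail_small[OF B_in_X[OF a x]] e K by (metis divide_pos_pos mult_pos_pos order_refl zero_less_numeral)
  define g where "g b = (\<Sum>l<N. \<bar>wprod (w b) l n - wprod (w a) l n\<bar> * (cmod (x (l + n)) * sn p (unit_seq l)))" for b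
  have "continuous_on I g"
    unfolding g_def by (intro continuous_intros W_continuous)
  moreover have "g a = 0" by (simp add: g_def)
  ultimately obtain \<delta> where d: "\<delta> > 0" "\<And>b. b \<in> I \<Longrightarrow> dist b a < \<delta> \<Longrightarrow> \<bar>g b\<bar> < \<epsilon> / 2"
    unfolding continuous_on_iff using a e by (metis dist_real_def diff_zero half_gt_zero)
  have main: "sn p (B b n x - B a n x) < \<epsilon>" if b: "b \<in> I" "dist b a < \<delta>" for b
  proof -
    let ?y = "B b n x - B a n x"
    have yX: "?y \<in> X" by (intro X_diff B_in_X a b x)
    have eq: "?y = (\<Sum>l<N. cscale (?y l) (unit_seq l)) + restr {N..} ?y"
      unfolding restr_eq_sum[OF finite_lessThan] by (auto simp: restr_def fun_eq_iff)
    have y_apply: "?y l = of_real (wprod (w b) l n - wprod (w a) l n) * x (l + n)" for l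
      by (simp add: wshift_funpow left_diff_distrib)
    have head: "sn p (\<Sum>l<N. cscale (?y l) (unit_seq l)) \<le> g b"
      unfolding g_def
    proof (rule order_trans[OF sn_sum sum_mono])
      show "sn p (cscale (?y l) (unit_seq l))
        \<le> \<bar>wprod (w b) l n - wprod (w a) l n\<bar> * (cmod (x (l + n)) * sn p (unit_seq l))" for l
        using sn_scale_le[OF X_unit, of p "?y l" l] unfolding y_apply norm_mult norm_of_real by (simp add: mult.assoc)
    qed (intro X_scale X_unit)
    have tail: "sn p (restr {N..} ?y) \<le> K * sn p (restr {N..} (B a n x))"
    proof (rule solid(2)[OF X_restr_any[OF B_in_X[OF a x]] less_imp_le[OF K]])
      fix l
      have "\<bar>wprod (w b) l n - wprod (w a) l n\<bar> \<le> K * wprod (w a) l n"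
        using W_le[OF a b(1), of l n] W_pos[OF a, of l n] W_pos[OF b(1), of l n] unfolding K_def distrib_right by linarith
      then have "\<bar>wprod (w b) l n - wprod (w a) l n\<bar> * cmod (x (l + n)) \<le> K * wprod (w a) l n * cmod (x (l + n))"
        by (intro mult_right_mono) auto
      moreover have "cmod (?y l) = \<bar>wprod (w b) l n - wprod (w a) l n\<bar> * cmod (x (l + n))"
        unfolding y_apply norm_mult norm_of_real ..
      moreover have "cmod (B a n x l) = wprod (w a) l n * cmod (x (l + n))"
        using W_pos[OF a, of l n] by (simp add: wshift_funpow norm_mult)
      ultimately have "cmod (?y l) \<le> K * cmod (B a n x l)"
        by (simp only: mult.assoc)
      then show "cmod (restr {N..} ?y l) \<le> K * cmod (restr {N..} (B a n x) l)"
        by (simp add: restr_def)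
    qed
    have "sn p ?y \<le> sn p (\<Sum>l<N. cscale (?y l) (unit_seq l)) + sn p (restr {N..} ?y)"
      using sn_triangle[OF X_sum X_restr_any[OF yX], of "{..<N}" "\<lambda>l. cscale (?y l) (unit_seq l)" p "{N..}"]
      eq X_scale[OF X_unit] by metis
    also have "\<dots> < \<epsilon> / 2 + \<epsilon> / 2"
    proof (rule add_le_less_mono)
      show "sn p (\<Sum>l<N. cscale (?y l) (unit_seq l)) \<le> \<epsilon> / 2" using head d(2)[OF b] by linarith
      show "sn p (restr {N..} ?y) < \<epsilon> / 2"
        by (rule le_less_trans[OF tail]) (use N K in \<open>simp add: field_simps\<close>)
    qed
    finally show ?thesis by simp
  qed
  have "dist (sn p (B b n x - v)) (sn p (B a n x - v)) < \<epsilon>" if b: "b \<in> I" "dist b a < \<delta>" for b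
  proof -
    have bX: "B b n x \<in> X" "B a n x \<in> X" by (intro B_in_X a b x)+
    have "sn p (B b n x - v) \<le> sn p (B b n x - B a n x) + sn p (B a n x - v)"
      using sn_triangle[OF X_diff[OF bX] X_diff[OF bX(2) v], of p] by simp
    moreover have "sn p (B a n x - v) \<le> sn p (B b n x - B a n x) + sn p (B b n x - v)"
      using sn_triangle[OF X_diff[OF bX(2,1)] X_diff[OF bX(1) v], of p] sn_minus_commute[OF bX, of p] by simp
    ultimately show ?thesis using main[OF b] by (simp add: dist_real_def)
  qed
  with d(1) show "\<exists>\<delta>>0. \<forall>b\<in>I. dist b a < \<delta> \<longrightarrow> dist (sn p (B b n x - v)) (sn p (B a n x - v)) < \<epsilon>"
    by blast
qed

end

section \<open>From a common hypercyclic vector to coverings\<close>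

text \<open>Return times will arise as an unordered finite set, while (c) numbers them increasingly
  from 1; hence the shift by one against list positions.\<close>

lemma finite_nat_set_enumeration:
  fixes S :: "nat set"
  assumes "finite S"
  obtains n where "S = n ` {1..card S}" "\<And>j k. 1 \<le> j \<Longrightarrow> j < k \<Longrightarrow> k \<le> card S \<Longrightarrow> n j < n k"
proof
  let ?L = "sorted_list_of_set S"
  have len: "length ?L = card S" by simp
  show "S = (\<lambda>k. ?L ! (k - 1)) ` {1..card S}"
  proof -
    have "(\<lambda>k. ?L ! (k - 1)) ` {1..card S} = (\<lambda>k. ?L ! k) ` ((\<lambda>k. k - 1) ` {1..card S})"
      by (simp add: image_image)
    also have "(\<lambda>k. k - 1) ` {1..card S} = {..<card S}"
      by (auto simp: image_iff intro!: bexI[of _ "Suc _"])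
    also have "(\<lambda>k. ?L ! k) ` {..<card S} = set ?L"
      unfolding set_conv_nth len by blast
    finally show ?thesis using assms by simp
  qed
  show "?L ! (j - 1) < ?L ! (k - 1)" if "1 \<le> j" "j < k" "k \<le> card S" for j k
  proof -
    have "sorted_wrt (<) ?L" by simp
    then show ?thesis using that len sorted_wrt_nth_less[of "(<)" ?L "j - 1" "k - 1"] by simp
  qed
qed

lemma gap_le:
  fixes n :: "nat \<Rightarrow> nat"
  assumes gap: "\<And>k. k \<in> {1..<q} \<Longrightarrow> n k + N \<le> n (Suc k)" and "1 \<le> j" "j < k" "k \<le> q"
  shows "n j + N \<le> n k"
  using \<open>j < k\<close> \<open>k \<le> q\<close>
proof (induction k)
  case (Suc k)
  show ?case
  proof (cases "j = k")
    case True
    then show ?thesis using gap[of k] Suc.prems \<open>1 \<le> j\<close> by auto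
  next
    case False
    then have "n j + N \<le> n k" using Suc by auto
    then show ?thesis using gap[of k] Suc.prems \<open>1 \<le> j\<close> by auto
  qed
qed simp

lemma prod_op_funpow: "(prod_op S ^^ n) x = (\<lambda>i. (S i ^^ n) (x i))"
  by (induction n) (auto simp: prod_op_def)

section \<open>The product topology on the d-fold power, and late visits of a dense orbit\<close>

context unconditional_frechet
begin

abbreviation P :: "('d::finite \<Rightarrow> nat \<Rightarrow> complex) topology" where
  "P \<equiv> power_space (seqtop X nrm)"

lemma topspace_P: "topspace P = {y. \<forall>i. y i \<in> X}"
  by (auto simp: power_space_def topspace_seqtop[OF system] PiE_iff)

lemma openin_P_box:
  assumes "\<And>i. v i \<in> X"
  shows "openin P {y. \<forall>i. y i \<in> X \<and> sn p (y i - v i) < \<epsilon>}"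
proof -
  have "{y. \<forall>i. y i \<in> X \<and> sn p (y i - v i) < \<epsilon>} = (\<Pi>\<^sub>E i\<in>UNIV. {y \<in> X. sn p (y - v i) < \<epsilon>})"
    by (auto simp: PiE_iff)
  then show ?thesis
    unfolding power_space_def
    by (simp only:) (intro product_topology_basis openin_sn_ball assms finite)
qed

text \<open>There are finitely many factors, so the largest index and the smallest radius serve all
  of them.\<close>

lemma openin_P_contains_box:
  assumes W: "openin P W" and y: "y \<in> W"
  obtains p \<delta> where "\<delta> > 0" "\<And>z. (\<And>i. z i \<in> X \<and> sn p (z i - y i) < \<delta>) \<Longrightarrow> z \<in> W"
proof -
  obtain U where U: "\<And>i. openin (seqtop X nrm) (U i)" "y \<in> Pi\<^sub>E UNIV U" "Pi\<^sub>E UNIV U \<subseteq> W"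
    using bspec[OF W[unfolded power_space_def openin_product_topology_alt] y] by auto
  have "\<exists>p \<delta>. \<delta> > 0 \<and> (\<forall>z\<in>X. sn p (z - y i) < \<delta> \<longrightarrow> z \<in> U i)" for i
    using U(1)[of i] PiE_mem[OF U(2) UNIV_I, of i] unfolding openin_seqtop_iff by blast
  then obtain p \<delta> where d: "\<And>i. \<delta> i > 0" "\<And>i z. z \<in> X \<Longrightarrow> sn (p i) (z - y i) < \<delta> i \<Longrightarrow> z \<in> U i"
    by metis
  have yX: "y i \<in> X" for i
    using openin_subset[OF W] y topspace_P by blast
  show ?thesis
  proof
    show "Min (range \<delta>) > 0" using d(1) by (subst Min_gr_iff) auto
    fix z assume z: "\<And>i. z i \<in> X \<and> sn (Max (range p)) (z i - y i) < Min (range \<delta>)"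
    have "z i \<in> U i" for i
    proof (rule d(2))
      show "z i \<in> X" using z by blast
      have "sn (p i) (z i - y i) \<le> sn (Max (range p)) (z i - y i)"
        by (intro sn_mono X_diff yX) (use z in auto)
      also have "\<dots> < Min (range \<delta>)" using z by blast
      also have "\<dots> \<le> \<delta> i" by simp
      finally show "sn (p i) (z i - y i) < \<delta> i" .
    qed
    then show "z \<in> W" using U(3) by auto
  qed
qed

lemma completely_metrizable_P: "completely_metrizable_space P"
proof -
  interpret M: Metric_space X "Fdist X nrm" by (rule Metric_space_Fdist[OF system])
  have "completely_metrizable_space (seqtop X nrm)"
    unfolding seqtop_def using frechet
    by (intro M.completely_metrizable_space_mtopology) (simp add: frechet_sequence_space_def)
  then show ?thesis
    unfolding power_space_def completely_metrizable_space_product_topology by (auto intro: countable_finite)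
qed

text \<open>There are no isolated points, so removing finitely many points of the orbit from a nonempty open
  set leaves a nonempty open set.\<close>

lemma hypercyclic_hits_late:
  fixes x :: "'d::finite \<Rightarrow> nat \<Rightarrow> complex"
  assumes hc: "hypercyclic_vector P T x" and orbit: "\<And>n. (T ^^ n) x \<in> topspace P"
    and v: "\<And>i. v i \<in> X" and e: "\<epsilon> > 0"
  shows "\<exists>n\<ge>M. \<forall>i. sn p ((T ^^ n) x i - v i) < \<epsilon>"
proof -
  let ?F = "(\<lambda>n. (T ^^ n) x) ` {..<M}"
  have "t1_space (P :: ('d \<Rightarrow> nat \<Rightarrow> complex) topology)"
    by (intro Hausdorff_imp_t1_space metrizable_imp_Hausdorff_space
        completely_metrizable_imp_metrizable_space completely_metrizable_P)
  then have F: "closedin P ?F"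
    unfolding t1_space_closedin_finite by (rule allE[of _ ?F]) (use image_subsetI[of "{..<M}", OF orbit] in simp)
  \<comment> \<open>Any s with 0 < s < \<sigma> keeps v + s e_0 within \<epsilon> of v in every
    factor. These points are infinitely many, so one of them avoids the finite initial piece of the
    orbit.\<close>
  define \<sigma> where "\<sigma> = \<epsilon> / (sn p (unit_seq 0) + 1)"
  have s0: "sn p (unit_seq 0) \<ge> 0" by (rule sn_nonneg[OF X_unit])
  have \<sigma>: "\<sigma> > 0" using e s0 by (simp add: \<sigma>_def)
  define y where "y s = (\<lambda>i. v i + cscale (of_real s) (unit_seq 0))" for s
  have "inj_on y {0<..<\<sigma>}"
  proof
    fix s t assume "y s = y t"
    then have "y s undefined 0 = y t undefined 0" by simp
    then show "s = t" by (simp add: y_def unit_seq_def)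
  qed
  then have inf: "infinite (y ` {0<..<\<sigma>})"
    using finite_imageD infinite_Ioo[OF \<sigma>] by blast
  obtain s where s: "0 < s" "s < \<sigma>" "y s \<notin> ?F"
  proof -
    have "\<not> y ` {0<..<\<sigma>} \<subseteq> ?F"
      using inf finite_subset by blast
    then obtain s where "s \<in> {0<..<\<sigma>}" "y s \<notin> ?F" by blast
    then show ?thesis using that[of s] unfolding greaterThanLessThan_iff by blast
  qed
  let ?V = "{z. \<forall>i. z i \<in> X \<and> sn p (z i - v i) < \<epsilon>}"
  have "y s \<in> ?V"
  proof (intro CollectI allI conjI)
    fix i
    show "y s i \<in> X" unfolding y_def by (intro X_add X_scale X_unit v)
    have eq: "y s i - v i = cscale (of_real s) (unit_seq 0)" by (simp add: y_def)
    have "sn p (y s i - v i) \<le> cmod (of_real s) * sn p (unit_seq 0)"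
      unfolding eq by (rule sn_scale_le[OF X_unit])
    also have "\<dots> = s * sn p (unit_seq 0)" using s(1) by simp
    also have "\<dots> \<le> s * (sn p (unit_seq 0) + 1)" using s(1) by simp
    also have "\<dots> < \<epsilon>" using s(2) s0 by (simp add: \<sigma>_def field_simps)
    finally show "sn p (y s i - v i) < \<epsilon>" .
  qed
  moreover have "openin P (?V - ?F)"
    by (rule openin_diff[OF openin_P_box[OF v] F])
  moreover have "\<forall>W. openin P W \<and> W \<noteq> {} \<longrightarrow> range (\<lambda>n. (T ^^ n) x) \<inter> W \<noteq> {}"
    using hc unfolding hypercyclic_vector_def dense_intersects_open by blast
  ultimately have "range (\<lambda>n. (T ^^ n) x) \<inter> (?V - ?F) \<noteq> {}"
    using s(3) by (metis (no_types, lifting) DiffI empty_iff)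
  then obtain n where n: "(T ^^ n) x \<in> ?V" "(T ^^ n) x \<notin> ?F" by blast
  have "n \<ge> M"
  proof (rule ccontr)
    assume "\<not> n \<ge> M"
    then have "n \<in> {..<M}" by simp
    then show False using n(2) by (rule notE[rotated, OF imageI])
  qed
  then show ?thesis using n(1) by (intro exI[of _ n]) simp
qed

end

section \<open>Coverings from the return times of a common hypercyclic vector\<close>

context weighted_shift_family
begin

text \<open>The body of (c), with products in the form \<open>wprod\<close>. The terms of (ii) are
  preimages of e_0 under the \<open>n k\<close>-th powers; in (iii) the preimages of e_l belonging
  to later times are mapped by the \<open>n k\<close>-th power for the parameter
  \<open>\<mu> k\<close>.\<close>

definition covering_family ::
    "(nat \<Rightarrow> nat) \<Rightarrow> real \<Rightarrow> nat \<Rightarrow> real \<Rightarrow> (real ^ 'd) set \<Rightarrow> nat \<Rightarrow> (nat \<Rightarrow> nat) \<Rightarrow> (nat \<Rightarrow> real ^ 'd) \<Rightarrow> bool" where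
  "covering_family F \<tau> N \<epsilon> K q n \<mu> \<longleftrightarrow>
     n 1 \<ge> N \<and> (\<forall>k\<in>{1..<q}. n (Suc k) \<ge> n k + N) \<and>
     (\<forall>k\<in>{1..q}. \<forall>i. \<mu> k $ i \<in> I) \<and>
     K \<subseteq> (\<Union>k\<in>{1..q}. {x. \<forall>i. x $ i \<in> {\<mu> k $ i - \<tau> / real (F (n k)) .. \<mu> k $ i}}) \<and>
     (\<forall>i. Fnorm nrm (\<Sum>k=1..q.
        cscale (of_real (1 / wprod (w (\<mu> k $ i)) 0 (n k))) (unit_seq (n k))) < \<epsilon>) \<and>
     (\<forall>k\<in>{1..<q}. \<forall>i. \<forall>l\<le>N.
        Fnorm nrm (\<Sum>j=Suc k..q.
          cscale (of_real (wprod (w (\<mu> k $ i)) (n j - n k + l) (n k) / wprod (w (\<mu> j $ i)) l (n j)))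
            (unit_seq (n j - n k + l))) < \<epsilon>)"

text \<open>Because of truncated subtraction, the product ranges are matched using
  \<open>n k \<le> n j\<close>. This follows from the gap condition, which \<open>conj_cong\<close>
  makes available for the last conjunct.\<close>

lemma covering_family_iff:
  "covering_family F \<tau> N \<epsilon> K q n \<mu> \<longleftrightarrow>
     n 1 \<ge> N \<and> (\<forall>k\<in>{1..<q}. n (Suc k) \<ge> n k + N) \<and>
     (\<forall>k\<in>{1..q}. \<forall>i. \<mu> k $ i \<in> I) \<and>
     K \<subseteq> (\<Union>k\<in>{1..q}. {x. \<forall>i. x $ i \<in> {\<mu> k $ i - \<tau> / real (F (n k)) .. \<mu> k $ i}}) \<and>
     (\<forall>i. Fnorm nrm (\<Sum>k=1..q.
        cscale (of_real (1 / (\<Prod>m=1..n k. w (\<mu> k $ i) m))) (unit_seq (n k))) < \<epsilon>) \<and>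
     (\<forall>k\<in>{1..<q}. \<forall>i. \<forall>l\<le>N.
        Fnorm nrm (\<Sum>j=Suc k..q.
          cscale (of_real ((\<Prod>m=n j - n k + l + 1..n j + l. w (\<mu> k $ i) m) /
                           (\<Prod>m=l + 1..n j + l. w (\<mu> j $ i) m)))
            (unit_seq (n j - n k + l))) < \<epsilon>)"
proof -
  have "(\<Sum>j=Suc k..q. cscale (of_real (wprod (w (\<mu> k $ i)) (n j - n k + l) (n k) / wprod (w (\<mu> j $ i)) l (n j)))
          (unit_seq (n j - n k + l))) =
      (\<Sum>j=Suc k..q. cscale (of_real ((\<Prod>m=n j - n k + l + 1..n j + l. w (\<mu> k $ i) m) /
                           (\<Prod>m=l + 1..n j + l. w (\<mu> j $ i) m))) (unit_seq (n j - n k + l)))"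
    if gap: "\<forall>k\<in>{1..<q}. n (Suc k) \<ge> n k + N" and k: "k \<in> {1..<q}" for k i l
  proof (rule sum.cong[OF refl])
    fix j assume j: "j \<in> {Suc k..q}"
    then have "n k + N \<le> n j" using k gap by (intro gap_le[of q n N k j]) auto
    then have "n j - n k + l + n k = n j + l" by simp
    then show "cscale (of_real (wprod (w (\<mu> k $ i)) (n j - n k + l) (n k) / wprod (w (\<mu> j $ i)) l (n j)))
          (unit_seq (n j - n k + l)) =
      cscale (of_real ((\<Prod>m=n j - n k + l + 1..n j + l. w (\<mu> k $ i) m) /
                           (\<Prod>m=l + 1..n j + l. w (\<mu> j $ i) m))) (unit_seq (n j - n k + l))"
      unfolding wprod_def by (simp only: add.commute[of l "n j"])
  qed
  then show ?thesis
    unfolding covering_family_def by (simp add: wprod_def cong: conj_cong)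
qed

text \<open>The approximation of v is exploited twice. Its coordinates in [0, N] fix size and sign
  of coordinates of x, and so locate parameters and times; beyond N the target is 0, so there the
  error itself dominates the sums of (iii).\<close>

lemma hypercyclic_imp_covering_family:
  fixes \<Lambda> :: "(real ^ 'd) set"
  assumes \<Lambda>: "\<And>\<mu> i. \<mu> \<in> \<Lambda> \<Longrightarrow> \<mu> $ i \<in> I"
    and F1: "\<And>n. n \<ge> 1 \<Longrightarrow> F n \<ge> 1"
    and lower: "\<And>n a b. n \<ge> 1 \<Longrightarrow> a \<in> I \<Longrightarrow> b \<in> I \<Longrightarrow>
        c * real (F n) * \<bar>a - b\<bar> \<le> \<bar>ln (wprod (w a) 0 n) - ln (wprod (w b) 0 n)\<bar>"
    and hc: "common_hypercyclic_vector P (\<lambda>\<mu>. prod_op (\<lambda>i. wshift (w (\<mu> $ i)))) \<Lambda> x"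
    and \<tau>: "\<tau> > 0" and N: "N \<ge> 1" and e: "\<epsilon> > 0" and K: "compact K" "K \<subseteq> \<Lambda>" and K_ne: "K \<noteq> {}"
  shows "\<exists>q n \<mu>. covering_family F \<tau> N \<epsilon> K q n \<mu>"
proof -
  have xX: "x i \<in> X" for i
    using hc topspace_P unfolding common_hypercyclic_vector_def by blast
  text \<open>The sign change in the target forces the return times of all parameters to be \<open>N\<close>-separated
    (or equal).\<close>
  define v :: "nat \<Rightarrow> complex" where "v = (\<lambda>m. if m = 0 then 1 else if m \<le> N then -1 else 0)"
  have vX: "v \<in> X"
  proof -
    have "v = restr {..N} v" by (auto simp: v_def restr_def)
    then show ?thesis using X_restr[of "{..N}" v] by simp
  qed
  obtain p1 where p1: "\<And>q x. x \<in> X \<Longrightarrow> p1 \<le> q \<Longrightarrow> sn q x < \<epsilon> / 2 \<Longrightarrow> Fnorm nrm x < \<epsilon>"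
    using sn_small_imp_Fnorm_small[OF e] by blast
  obtain p2 where p2: "\<And>l. l \<le> N \<Longrightarrow> sn p2 (unit_seq l) > 0"
    using sn_unit_pos by blast
  define p where "p = max p1 p2"
  \<comment> \<open>\<sigma> converts seminorm errors into coordinate errors: a seminorm error of at
    most \<open>\<eta> * \<sigma>\<close> forces an error of at most \<eta> at each position l \<le>
    N.\<close>
  define \<sigma> where "\<sigma> = Min ((\<lambda>l. sn p2 (unit_seq l)) ` {..N})"
  have \<sigma>: "\<sigma> > 0" unfolding \<sigma>_def using p2 by (subst Min_gr_iff) auto
  have \<sigma>_le: "\<sigma> \<le> sn p (unit_seq l)" if "l \<le> N" for l
  proof -
    have "\<sigma> \<le> sn p2 (unit_seq l)" unfolding \<sigma>_def using that by (intro Min_le) auto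
    also have "\<dots> \<le> sn p (unit_seq l)" unfolding p_def by (intro sn_mono X_unit) auto
    finally show ?thesis .
  qed
  have E: "exp (c * \<tau>) > 1" using \<tau> c_pos by simp
  \<comment> \<open>The bound 1/2 preserves signs. The other entry solves (1 + \<eta>) / (1 -
    \<eta>) = exp (c \<tau>), the ratio that will bound the diameters by \<tau> / F n.\<close>
  define \<eta> where "\<eta> = min (1/2) ((exp (c * \<tau>) - 1) / (exp (c * \<tau>) + 1))"
  have "(exp (c * \<tau>) - 1) / (exp (c * \<tau>) + 1) > 0" using E by (intro divide_pos_pos) linarith+
  then have \<eta>: "\<eta> > 0" "\<eta> \<le> 1/2" unfolding \<eta>_def by linarith+
  have \<eta>E: "1 + \<eta> \<le> exp (c * \<tau>) * (1 - \<eta>)"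
  proof -
    have "\<eta> \<le> (exp (c * \<tau>) - 1) / (exp (c * \<tau>) + 1)" by (simp add: \<eta>_def)
    then have "\<eta> * (exp (c * \<tau>) + 1) \<le> exp (c * \<tau>) - 1"
      using E pos_le_divide_eq[of "exp (c * \<tau>) + 1" \<eta> "exp (c * \<tau>) - 1"] by simp
    then show ?thesis by (simp add: algebra_simps)
  qed
  \<comment> \<open>An error of \<epsilon>/8, doubled by the domination below, stays under
    \<epsilon>/2, the level at which \<open>p1\<close> guarantees an F-norm below
    \<epsilon>.\<close>
  define \<delta> where "\<delta> = min (\<epsilon> / 8) (\<eta> * \<sigma>)"
  have \<delta>: "\<delta> > 0" "\<delta> \<le> \<epsilon> / 8" "\<delta> \<le> \<eta> * \<sigma>" using e \<eta> \<sigma> by (auto simp: \<delta>_def)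
  have "\<exists>n. \<forall>m\<ge>n. sn p (restr {m..} (x i)) < \<epsilon> / 8" for i
    using e by (intro sn_tail_small[OF xX]) simp
  then obtain Mi where Mi: "\<And>i m. m \<ge> Mi i \<Longrightarrow> sn p (restr {m..} (x i)) < \<epsilon> / 8"
    by metis
  define M where "M = max N (Max (range Mi))"
  have M: "M \<ge> N" "sn p (restr {M..} (x i)) < \<epsilon> / 8" for i
    using Mi[of i M] by (auto simp: M_def le_max_iff_disj)
  define J where "J i = (\<lambda>\<mu>. \<mu> $ i) ` K" for i
  have J: "compact (J i)" "J i \<subseteq> I" for i
    unfolding J_def using K \<Lambda> by (auto intro!: compact_continuous_image continuous_intros)
  have cont: "continuous_on (J i) (\<lambda>a. sn p (B a n (x i) - v))" for i n
    using B_orbit_continuous[OF xX vX] J(2) continuous_on_subset by blast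
  \<comment> \<open>One coordinate at a time and with a non-strict inequality, so that the set is
    compact and has a maximum once it is nonempty. Its strict counterpart \<open>Hit\<close> will
    provide the open cover.\<close>
  define A where "A n i = {a \<in> J i. sn p (B a n (x i) - v) \<le> \<delta>}" for n i
  have A_I: "a \<in> I" if "a \<in> A n i" for a n i using that J(2) by (auto simp: A_def)
  have A_compact: "compact (A n i)" for n i
  proof -
    have "A n i = J i \<inter> (\<lambda>a. sn p (B a n (x i) - v)) -` {..\<delta>}" by (auto simp: A_def)
    moreover have "closed (J i \<inter> (\<lambda>a. sn p (B a n (x i) - v)) -` {..\<delta>})"
      by (intro continuous_closed_preimage cont compact_imp_closed J closed_atMost)
    ultimately show ?thesis using J(1)[of i] by (metis compact_Int_closed inf.left_idem)
  qed
  have A_coord: "cmod (of_real (wprod (w a) l n) * x i (l + n) - v l) \<le> \<eta>"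
    if "a \<in> A n i" "l \<le> N" for a n i l
  proof -
    let ?y = "B a n (x i) - v"
    have "cmod (?y l) * sn p (unit_seq l) \<le> \<eta> * \<sigma>"
      using coord_le_sn[OF X_diff[OF B_in_X[OF A_I[OF that(1)] xX[of i], of n] vX], of l p] that(1) \<delta>(3)
      unfolding A_def by (auto intro: order_trans)
    also have "\<dots> \<le> \<eta> * sn p (unit_seq l)" using \<eta> \<sigma>_le[OF that(2)] by simp
    finally have "cmod (?y l) \<le> \<eta>" using \<sigma> \<sigma>_le[OF that(2)] by (simp add: mult_le_cancel_right)
    then show ?thesis by (simp add: wshift_funpow)
  qed
  have A_lower: "1 / wprod (w a) l n \<le> 2 * cmod (x i (l + n))" if "a \<in> A n i" "l \<le> N" for a n i l
  proof -
    have "cmod (v l) = 1" using that by (simp add: v_def)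
    then have "1 - \<eta> \<le> cmod (of_real (wprod (w a) l n) * x i (l + n))"
      using A_coord[OF that] norm_triangle_ineq3[of "of_real (wprod (w a) l n) * x i (l + n)" "v l"] by linarith
    then have "1 / 2 \<le> wprod (w a) l n * cmod (x i (l + n))"
      using \<eta> W_pos[OF A_I[OF that(1)], of l n] by (simp add: norm_mult)
    then show ?thesis using W_pos[OF A_I[OF that(1)], of l n] by (simp add: field_simps)
  qed
  \<comment> \<open>With n = m + r and 1 \<le> r \<le> N, coordinate r at time m is near -1 and
    coordinate 0 at time n is near 1. Both are positive multiples of the same number
    \<open>x i n\<close>, which is impossible.\<close>
  have A_sep: "m + N < n" if a: "a \<in> A m i" and b: "b \<in> A n i" and "m < n" for a b m n i
  proof (rule ccontr)
    assume neg: "\<not> m + N < n"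
    define r where "r = n - m"
    have r: "1 \<le> r" "r \<le> N" "r + m = n" using \<open>m < n\<close> neg by (auto simp: r_def)
    have "cmod (of_real (wprod (w a) r m) * x i n + 1) \<le> 1/2"
      using A_coord[OF a r(2)] r \<eta> by (simp add: v_def)
    then have "\<bar>Re (of_real (wprod (w a) r m) * x i n + 1)\<bar> \<le> 1/2"
      using abs_Re_le_cmod order_trans by blast
    then have "\<bar>wprod (w a) r m * Re (x i n) + 1\<bar> \<le> 1/2" by simp
    then have "wprod (w a) r m * Re (x i n) < 0" by linarith
    then have neg: "Re (x i n) < 0" using W_pos[OF A_I[OF a], of r m] by (simp add: mult_less_0_iff)
    have "cmod (of_real (wprod (w b) 0 n) * x i n - 1) \<le> 1/2"
      using A_coord[OF b, of 0] \<eta> by (simp add: v_def)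
    then have "\<bar>Re (of_real (wprod (w b) 0 n) * x i n - 1)\<bar> \<le> 1/2"
      using abs_Re_le_cmod order_trans by blast
    then have "\<bar>wprod (w b) 0 n * Re (x i n) - 1\<bar> \<le> 1/2" by simp
    then have "wprod (w b) 0 n * Re (x i n) > 0" by linarith
    then show False using neg W_pos[OF A_I[OF b], of 0 n] by (simp add: zero_less_mult_iff)
  qed
  \<comment> \<open>All parameters in \<open>A n i\<close> carry the same modulus of
    \<open>x i n\<close> into [1 - \<eta>, 1 + \<eta>], so the logarithms of their products differ
    by at most c \<tau>; the lower bound on these differences yields the distance.\<close>
  have A_diam: "\<bar>a - b\<bar> \<le> \<tau> / real (F n)" if a: "a \<in> A n i" and b: "b \<in> A n i" and n: "n \<ge> 1" for a b n i
  proof -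
    have bounds: "1 - \<eta> \<le> wprod (w a) 0 n * cmod (x i n) \<and> wprod (w a) 0 n * cmod (x i n) \<le> 1 + \<eta>"
      if "a \<in> A n i" for a
    proof -
      have "\<bar>cmod (of_real (wprod (w a) 0 n) * x i n) - cmod 1\<bar> \<le> \<eta>"
        using A_coord[OF that, of 0] norm_triangle_ineq3[of "of_real (wprod (w a) 0 n) * x i n" 1]
        by (simp add: v_def)
      then show ?thesis using W_pos[OF A_I[OF that], of 0 n] by (auto simp: norm_mult abs_le_iff)
    qed
    have x0: "cmod (x i n) > 0"
      using bounds[OF a] \<eta> by (cases "x i n = 0") auto
    have le: "ln (wprod (w a) 0 n) - ln (wprod (w b) 0 n) \<le> c * \<tau>"
      if a: "a \<in> A n i" and b: "b \<in> A n i" for a b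
    proof -
      have "wprod (w a) 0 n * cmod (x i n) \<le> 1 + \<eta>" using bounds[OF a] by simp
      also have "\<dots> \<le> exp (c * \<tau>) * (1 - \<eta>)" by (rule \<eta>E)
      also have "\<dots> \<le> exp (c * \<tau>) * (wprod (w b) 0 n * cmod (x i n))"
        using bounds[OF b] by simp
      finally have "wprod (w a) 0 n \<le> exp (c * \<tau>) * wprod (w b) 0 n"
        using x0 by simp
      then have "ln (wprod (w a) 0 n) \<le> ln (exp (c * \<tau>) * wprod (w b) 0 n)"
        using W_pos[OF A_I[OF a], of 0 n] W_pos[OF A_I[OF b], of 0 n] by simp
      then show ?thesis using W_pos[OF A_I[OF b], of 0 n] by (simp add: ln_mult)
    qed
    have "c * real (F n) * \<bar>a - b\<bar> \<le> c * \<tau>"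
      using lower[OF n A_I[OF a] A_I[OF b]] le[OF a b] le[OF b a] by linarith
    then have "real (F n) * \<bar>a - b\<bar> \<le> \<tau>" using c_pos by (simp add: mult.assoc)
    then show ?thesis using F1[OF n] by (simp add: field_simps)
  qed
  define Hit where "Hit n = {\<mu> \<in> K. \<forall>i. sn p (B (\<mu> $ i) n (x i) - v) < \<delta>}" for n
  have Hit_A: "\<mu> $ i \<in> A n i" if "\<mu> \<in> Hit n" for \<mu> n i
    using that by (auto simp: Hit_def A_def J_def less_imp_le)
  have Hit_open: "openin (top_of_set K) (Hit n)" for n
  proof -
    have "Hit n = (\<Inter>i. K \<inter> (\<lambda>\<mu>. sn p (B (\<mu> $ i) n (x i) - v)) -` {..<\<delta>})" by (auto simp: Hit_def)
    moreover have "openin (top_of_set K) (\<Inter>i. K \<inter> (\<lambda>\<mu>. sn p (B (\<mu> $ i) n (x i) - v)) -` {..<\<delta>})"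
    proof (intro openin_INT2 continuous_openin_preimage_gen)
      show "continuous_on K (\<lambda>\<mu>. sn p (B (\<mu> $ i) n (x i) - v))" for i
        by (rule continuous_on_compose2[OF cont[of i n]]) (auto simp: J_def intro!: continuous_intros)
    qed auto
    ultimately show ?thesis by simp
  qed
  have "K \<subseteq> \<Union>(Hit ` {M..})"
  proof
    fix \<mu> assume \<mu>: "\<mu> \<in> K"
    let ?T = "prod_op (\<lambda>i. wshift (w (\<mu> $ i)))"
    have "\<exists>n\<ge>M. \<forall>i. sn p ((?T ^^ n) x i - v) < \<delta>"
    proof (rule hypercyclic_hits_late[OF _ _ vX \<delta>(1)])
      show "hypercyclic_vector P ?T x"
        using hc \<mu> K(2) unfolding common_hypercyclic_vector_def by blast
      show "(?T ^^ n) x \<in> topspace P" for n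
        unfolding topspace_P prod_op_funpow using B_in_X \<Lambda> \<mu> K(2) xX by blast
    qed
    then show "\<mu> \<in> \<Union>(Hit ` {M..})" using \<mu> by (auto simp: Hit_def prod_op_funpow)
  qed
  then have "\<exists>D\<subseteq>Hit ` {M..}. finite D \<and> K \<subseteq> \<Union>D"
    using compact_eq_openin_cover[THEN iffD1, rule_format, OF K(1), of "Hit ` {M..}"] Hit_open by auto
  then obtain D where D: "D \<subseteq> Hit ` {M..}" "finite D" "K \<subseteq> \<Union>D" by blast
  obtain S0 where S0: "finite S0" "S0 \<subseteq> {M..}" "K \<subseteq> \<Union>(Hit ` S0)"
    using finite_subset_image[OF D(2,1)] D(3) by blast
  \<comment> \<open>Times hit by no parameter are dropped, so that for every remaining n the sets
    \<open>A n i\<close> are nonempty and have a maximum.\<close>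
  define S where "S = {n \<in> S0. Hit n \<noteq> {}}"
  have S: "finite S" "S \<subseteq> {M..}" "K \<subseteq> \<Union>(Hit ` S)" "\<And>n. n \<in> S \<Longrightarrow> Hit n \<noteq> {}"
    using S0 unfolding S_def by (auto, blast)
  have S_ne: "card S \<ge> 1"
    using S(1,3) K_ne by (cases "S = {}") (auto simp: Suc_le_eq card_gt_0_iff)
  obtain n where n: "S = n ` {1..card S}" "\<And>j k. 1 \<le> j \<Longrightarrow> j < k \<Longrightarrow> k \<le> card S \<Longrightarrow> n j < n k"
    using finite_nat_set_enumeration[OF S(1)] by blast
  let ?q = "card S"
  have nS: "n k \<in> S" "n k \<ge> M" "n k \<ge> 1" if "k \<in> {1..?q}" for k
  proof -
    show "n k \<in> S" using n(1) that by blast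
    then show "n k \<ge> M" using S(2) by auto
    then show "n k \<ge> 1" using M(1) N by linarith
  qed
  have "\<exists>a\<in>A (n k) i. \<forall>b\<in>A (n k) i. b \<le> a" if "k \<in> {1..?q}" for k i
    using S(4)[OF nS(1)[OF that]] Hit_A by (intro compact_attains_sup A_compact) blast
  then obtain m where m: "\<And>k i. k \<in> {1..?q} \<Longrightarrow> m k i \<in> A (n k) i"
    "\<And>k i b. k \<in> {1..?q} \<Longrightarrow> b \<in> A (n k) i \<Longrightarrow> b \<le> m k i"
    by metis
  \<comment> \<open>The coordinates may stem from different elements of K, so membership in I is
    what is retained. As maxima they are right endpoints, and the diameter bound supplies the left
    ones.\<close>
  define \<mu> :: "nat \<Rightarrow> real ^ 'd" where "\<mu> k = (\<chi> i. m k i)" for k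
  have \<mu>A: "\<mu> k $ i \<in> A (n k) i" if "k \<in> {1..?q}" for k i using m(1)[OF that] by (simp add: \<mu>_def)
  have sep: "n j + N < n k" if "1 \<le> j" "j < k" "k \<le> ?q" for j k
    using A_sep[OF \<mu>A[of j undefined] \<mu>A[of k undefined]] n(2)[OF that] that by auto
  have inj: "inj_on n {1..?q}"
    by (rule linorder_inj_onI) (use n(2) in force)+
  have "covering_family F \<tau> N \<epsilon> K ?q n \<mu>"
    unfolding covering_family_def
  proof (intro conjI ballI allI impI)
    show "n 1 \<ge> N" using nS(2)[of 1] S_ne M(1) by auto
    show "n k + N \<le> n (Suc k)" if "k \<in> {1..<?q}" for k
      using sep[of k "Suc k"] that by auto
    show "\<mu> k $ i \<in> I" if "k \<in> {1..?q}" for k i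
      using A_I \<mu>A[OF that] by blast
    show "K \<subseteq> (\<Union>k\<in>{1..?q}. {x. \<forall>i. x $ i \<in> {\<mu> k $ i - \<tau> / real (F (n k))..\<mu> k $ i}})"
    proof
      fix \<nu> assume "\<nu> \<in> K"
      then obtain s where s: "s \<in> S" "\<nu> \<in> Hit s" using S(3) by blast
      have "s \<in> n ` {1..?q}" unfolding n(1)[symmetric] by (rule s(1))
      then obtain k where k: "k \<in> {1..?q}" "\<nu> \<in> Hit (n k)" using s(2) by blast
      have "\<nu> $ i \<in> {\<mu> k $ i - \<tau> / real (F (n k))..\<mu> k $ i}" for i
        using A_diam[OF \<mu>A[OF k(1)] Hit_A[OF k(2)] nS(3)[OF k(1)], of i] m(2)[OF k(1) Hit_A[OF k(2)], of i]
        by (auto simp: \<mu>_def abs_le_iff)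
      then show "\<nu> \<in> (\<Union>k\<in>{1..?q}. {x. \<forall>i. x $ i \<in> {\<mu> k $ i - \<tau> / real (F (n k))..\<mu> k $ i}})"
        using k(1) by blast
    qed
    show "Fnorm nrm (\<Sum>k = 1..?q. cscale (of_real (1 / wprod (w (\<mu> k $ i)) 0 (n k))) (unit_seq (n k))) < \<epsilon>" for i
    proof (rule p1)
      show "(\<Sum>k = 1..?q. cscale (of_real (1 / wprod (w (\<mu> k $ i)) 0 (n k))) (unit_seq (n k))) \<in> X"
        by (intro X_sum X_scale X_unit)
      show "p1 \<le> p" by (simp add: p_def)
      \<comment> \<open>By \<open>A_lower\<close> each coefficient is at most twice the modulus of a
        coordinate of \<open>x i\<close> at a position \<ge> M.\<close>
      have "sn p (\<Sum>k = 1..?q. cscale (of_real (1 / wprod (w (\<mu> k $ i)) 0 (n k))) (unit_seq (n k)))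
          \<le> 2 * sn p (restr {M..} (x i))"
      proof (rule sn_sparse_sum[OF _ inj X_restr_any[OF xX]])
        fix k assume k: "k \<in> {1..?q}"
        have "cmod (of_real (1 / wprod (w (\<mu> k $ i)) 0 (n k))) = 1 / wprod (w (\<mu> k $ i)) 0 (n k)"
          using W_pos[OF A_I[OF \<mu>A[OF k]], of i 0 "n k"] by (simp only: norm_of_real) simp
        then show "cmod (of_real (1 / wprod (w (\<mu> k $ i)) 0 (n k))) \<le> 2 * cmod (restr {M..} (x i) (n k))"
          using A_lower[OF \<mu>A[OF k], of 0 i] nS(2)[OF k] by (simp add: restr_def)
      qed auto
      also have "\<dots> < \<epsilon> / 2" using M(2)[of i] e by linarith
      finally show "sn p (\<Sum>k = 1..?q. cscale (of_real (1 / wprod (w (\<mu> k $ i)) 0 (n k))) (unit_seq (n k))) < \<epsilon> / 2" .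
    qed
    show "Fnorm nrm (\<Sum>j=Suc k..?q.
          cscale (of_real (wprod (w (\<mu> k $ i)) (n j - n k + l) (n k) / wprod (w (\<mu> j $ i)) l (n j)))
            (unit_seq (n j - n k + l))) < \<epsilon>" (is "Fnorm nrm ?s < _")
      if k: "k \<in> {1..<?q}" and l: "l \<le> N" for k i l
    proof (rule p1)
      show "?s \<in> X" by (intro X_sum X_scale X_unit)
      show "p1 \<le> p" by (simp add: p_def)
      have k': "k \<in> {1..?q}" using k by auto
      let ?y = "B (\<mu> k $ i) (n k) (x i) - v"
      have lt: "n k + N < n j" if "j \<in> {Suc k..?q}" for j using sep[of k j] that k by auto
      have "sn p ?s \<le> 2 * sn p ?y"
      proof (rule sn_sparse_sum)
        show "inj_on (\<lambda>j. n j - n k + l) {Suc k..?q}"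
        proof
          fix j j' assume jj: "j \<in> {Suc k..?q}" "j' \<in> {Suc k..?q}" "n j - n k + l = n j' - n k + l"
          then have "n j = n j'" using lt[OF jj(1)] lt[OF jj(2)] by linarith
          then show "j = j'" using inj jj k by (auto dest: inj_onD)
        qed
        show "?y \<in> X" by (intro X_diff B_in_X A_I[OF \<mu>A[OF k']] xX vX)
        fix j assume j: "j \<in> {Suc k..?q}"
        then have j': "j \<in> {1..?q}" by auto
        have idx: "n j - n k + l + n k = l + n j" using lt[OF j] by simp
        \<comment> \<open>Strict separation puts this position outside the support of v, so the
          error there is the full coordinate of the orbit.\<close>
        have "v (n j - n k + l) = 0" using lt[OF j] N by (simp add: v_def)
        then have y: "cmod (?y (n j - n k + l)) = wprod (w (\<mu> k $ i)) (n j - n k + l) (n k) * cmod (x i (l + n j))"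
          using W_pos[OF A_I[OF \<mu>A[OF k']], of i "n j - n k + l" "n k"] idx
          by (simp add: wshift_funpow norm_mult add.commute[of l "n j"])
        have "cmod (of_real (wprod (w (\<mu> k $ i)) (n j - n k + l) (n k) / wprod (w (\<mu> j $ i)) l (n j)))
            = wprod (w (\<mu> k $ i)) (n j - n k + l) (n k) * (1 / wprod (w (\<mu> j $ i)) l (n j))"
          using W_pos[OF A_I[OF \<mu>A[OF k']], of i "n j - n k + l" "n k"] W_pos[OF A_I[OF \<mu>A[OF j']], of i l "n j"]
          by (simp only: norm_of_real) simp
        also have "\<dots> \<le> wprod (w (\<mu> k $ i)) (n j - n k + l) (n k) * (2 * cmod (x i (l + n j)))"
          using W_pos[OF A_I[OF \<mu>A[OF k']], of i "n j - n k + l" "n k"] A_lower[OF \<mu>A[OF j'] l, of i]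
          by (intro mult_left_mono) auto
        also have "\<dots> = 2 * cmod (?y (n j - n k + l))" unfolding y by simp
        finally show "cmod (of_real (wprod (w (\<mu> k $ i)) (n j - n k + l) (n k) / wprod (w (\<mu> j $ i)) l (n j)))
            \<le> 2 * cmod (?y (n j - n k + l))" .
      qed auto
      also have "\<dots> < \<epsilon> / 2"
        using \<mu>A[OF k', of i] \<delta>(2) e by (simp add: A_def)
      finally show "sn p ?s < \<epsilon> / 2" .
    qed
  qed
  then show ?thesis by blast
qed

end

section \<open>From coverings to common hypercyclic vectors\<close>

context weighted_shift_family
begin

text \<open>At time n the terms before k have been shifted out. The k-th one is kept apart because
  it will reproduce the target, while the later ones form the error governed by (iii).\<close>

lemma B_sparse_sum:
  assumes "k \<in> {1..q}"
    and below: "\<And>j. j \<in> {1..<k} \<Longrightarrow> g j < n" and above: "\<And>j. j \<in> {k..q} \<Longrightarrow> n \<le> g j"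
  shows "B a n (\<Sum>j=1..q. cscale (\<alpha> j) (unit_seq (g j))) =
    cscale (\<alpha> k * of_real (wprod (w a) (g k - n) n)) (unit_seq (g k - n)) +
    (\<Sum>j=Suc k..q. cscale (\<alpha> j * of_real (wprod (w a) (g j - n) n)) (unit_seq (g j - n)))"
proof -
  let ?h = "\<lambda>j. cscale (\<alpha> j * of_real (wprod (w a) (g j - n) n)) (unit_seq (g j - n))"
  have zero: "B a n (cscale (\<alpha> j) (unit_seq (g j))) = 0" if "j \<in> {1..<k}" for j
    using wshift_funpow_unit(2)[OF below[OF that]] by (simp only: wshift_funpow_scale cseq.scale_zero_right)
  have shift: "B a n (cscale (\<alpha> j) (unit_seq (g j))) = ?h j" if "j \<in> {k..q}" for j
    using wshift_funpow_unit(1)[OF above[OF that]] by (simp only: wshift_funpow_scale cseq.scale_scale)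
  have "B a n (\<Sum>j=1..q. cscale (\<alpha> j) (unit_seq (g j))) = (\<Sum>j=1..q. B a n (cscale (\<alpha> j) (unit_seq (g j))))"
    by (rule wshift_funpow_sum)
  also have "\<dots> = (\<Sum>j\<in>{1..<k} \<union> {k..q}. B a n (cscale (\<alpha> j) (unit_seq (g j))))"
    using assms(1) by (intro sum.cong) auto
  also have "\<dots> = (\<Sum>j\<in>{1..<k}. B a n (cscale (\<alpha> j) (unit_seq (g j)))) + (\<Sum>j\<in>{k..q}. B a n (cscale (\<alpha> j) (unit_seq (g j))))"
    by (rule sum.union_disjoint) auto
  also have "(\<Sum>j\<in>{1..<k}. B a n (cscale (\<alpha> j) (unit_seq (g j)))) = 0"
    by (rule sum.neutral) (use zero in blast)
  also have "(\<Sum>j\<in>{k..q}. B a n (cscale (\<alpha> j) (unit_seq (g j)))) = (\<Sum>j\<in>{k..q}. ?h j)"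
    by (rule sum.cong[OF refl]) (rule shift)
  also have "(\<Sum>j\<in>{k..q}. ?h j) = ?h k + (\<Sum>j=Suc k..q. ?h j)"
    using assms(1) by (intro sum.atLeast_Suc_atMost) auto
  finally show ?thesis by (simp only: add_0)
qed

text \<open>A finite set S of times accompanies x because equicontinuity holds over finitely many
  times only; this later turns a single vector into a whole neighbourhood.\<close>

lemma covering_family_imp_approximation:
  fixes u v :: "'d::finite \<Rightarrow> nat \<Rightarrow> complex"
  assumes w_mono: "\<And>n a b. n \<ge> 1 \<Longrightarrow> a \<in> I \<Longrightarrow> b \<in> I \<Longrightarrow> a \<le> b \<Longrightarrow> w a n \<le> w b n"
    and F1: "\<And>n. n \<ge> 1 \<Longrightarrow> F n \<ge> 1"
    and F_mono: "\<And>m n. 1 \<le> m \<Longrightarrow> m \<le> n \<Longrightarrow> F m \<le> F n"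
    and C: "C > 0"
    and upper: "\<And>n a b. n \<ge> 1 \<Longrightarrow> a \<in> I \<Longrightarrow> b \<in> I \<Longrightarrow>
        \<bar>ln (wprod (w a) 0 n) - ln (wprod (w b) 0 n)\<bar> \<le> C * real (F n) * \<bar>a - b\<bar>"
    and K: "\<And>\<mu> i. \<mu> \<in> K \<Longrightarrow> \<mu> $ i \<in> I"
    and family: "\<And>\<tau> N \<epsilon>. \<tau> > 0 \<Longrightarrow> N \<ge> 1 \<Longrightarrow> \<epsilon> > 0 \<Longrightarrow> \<exists>q n \<mu>. covering_family F \<tau> N \<epsilon> K q n \<mu>"
    and L: "L \<ge> 1" and u: "\<And>i m. m \<ge> L \<Longrightarrow> u i m = 0" and v: "\<And>i m. m \<ge> L \<Longrightarrow> v i m = 0"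
    and \<delta>: "\<delta> > 0"
  shows "\<exists>x S. finite S \<and> (\<forall>i. x i \<in> X \<and> sn p (x i - u i) < \<delta>) \<and>
    (\<forall>\<mu>\<in>K. \<exists>n\<in>S. \<forall>i. sn p (B (\<mu> $ i) n (x i) - v i) < \<delta>)"
proof -
  obtain \<beta> where \<beta>: "\<beta> \<in> I" using I_nonempty by blast
  have finite_support: "y = (\<Sum>l<L. cscale (y l) (unit_seq l))" if "\<And>m. m \<ge> L \<Longrightarrow> y m = 0" for y
  proof -
    have "y = restr {..<L} y" using that by (auto simp: restr_def fun_eq_iff)
    then show ?thesis by (simp only: restr_eq_sum[OF finite_lessThan])
  qed
  have uX: "u i \<in> X" and vX: "v i \<in> X" for i
  proof -
    have "y \<in> X" if "\<And>m. m \<ge> L \<Longrightarrow> y m = 0" for y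
    proof -
      have "restr {..<L} y = y" using that by (auto simp: restr_def fun_eq_iff)
      then show ?thesis using X_restr[of "{..<L}" y] by simp
    qed
    then show "u i \<in> X" "v i \<in> X" using u v by blast+
  qed
  define R where "R = 1 + (\<Sum>i\<in>UNIV. \<Sum>l<L. cmod (v i l))"
  have R: "R \<ge> 1" by (simp add: R_def sum_nonneg)
  have vR: "cmod (v i l) \<le> R" if "l < L" for i l
  proof -
    have "cmod (v i l) \<le> (\<Sum>l<L. cmod (v i l))" using that by (intro member_le_sum) auto
    also have "\<dots> \<le> (\<Sum>i\<in>UNIV. \<Sum>l<L. cmod (v i l))"
      by (rule member_le_sum[of i UNIV "\<lambda>i. \<Sum>l<L. cmod (v i l)"]) (auto intro: sum_nonneg)
    finally show ?thesis by (simp add: R_def)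
  qed
  define A where "A = (\<Sum>l<L. sn p (unit_seq l))"
  have A: "A \<ge> 0" unfolding A_def by (intro sum_nonneg sn_nonneg X_unit)
  \<comment> \<open>G bounds the products of the first l < L weights at the reference parameter
    \<beta>, and D below pays for exchanging L weights between two parameters.\<close>
  define G where "G = (\<Sum>l<L. wprod (w \<beta>) 0 l)"
  have G: "wprod (w \<beta>) 0 l \<le> G" if "l < L" for l
    unfolding G_def using that W_pos[OF \<beta>] by (intro member_le_sum) (auto intro: less_imp_le)
  have G0: "G \<ge> 0" unfolding G_def using W_pos[OF \<beta>] by (intro sum_nonneg) (auto intro: less_imp_le)
  define D where "D = (1/c) ^ L"
  have D: "D > 0" using c_pos by (simp add: D_def)
  \<comment> \<open>The constants \<delta>1, \<delta>2 and \<theta> are solved backwards from the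
    final estimates, which sum over l < L with coordinates of v bounded by R. The summand 1 in each
    denominator makes these estimates strict.\<close>
  define \<delta>1 where "\<delta>1 = \<delta> / (real L * R * (G * D) + 1)"
  have pos1: "real L * R * (G * D) \<ge> 0" using R G0 D by simp
  have \<delta>1: "\<delta>1 > 0" "real L * R * (G * D) * \<delta>1 < \<delta>"
    using \<delta> pos1 by (auto simp: \<delta>1_def field_simps)
  obtain q0 \<delta>0 where \<delta>0: "\<delta>0 > 0"
    "\<And>n a x. n \<le> L \<Longrightarrow> a \<in> I \<Longrightarrow> x \<in> X \<Longrightarrow> sn q0 x < \<delta>0 \<Longrightarrow> sn p (B a n x) < \<delta>1"
    using B_equicontinuous[OF \<delta>1(1) finite_atMost, of L p] by (metis atMost_iff)
  obtain \<epsilon>1 where \<epsilon>1: "\<epsilon>1 > 0" "\<And>x. x \<in> X \<Longrightarrow> Fnorm nrm x < \<epsilon>1 \<Longrightarrow> sn q0 x < \<delta>0"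
    using Fnorm_small_imp_sn_small[OF \<delta>0(1)] by blast
  define \<delta>2 where "\<delta>2 = \<delta> / (2 * (real L * R * D + 1))"
  have pos2: "real L * R * D \<ge> 0" using R D by simp
  have \<delta>2: "\<delta>2 > 0" "real L * R * D * \<delta>2 < \<delta> / 2"
    using \<delta> pos2 by (auto simp: \<delta>2_def field_simps)
  obtain \<epsilon>2 where \<epsilon>2: "\<epsilon>2 > 0" "\<And>x. x \<in> X \<Longrightarrow> Fnorm nrm x < \<epsilon>2 \<Longrightarrow> sn p x < \<delta>2"
    using Fnorm_small_imp_sn_small[OF \<delta>2(1)] by blast
  define \<theta> where "\<theta> = \<delta> / (2 * (R * A + 1))"
  have pos3: "R * A \<ge> 0" using R A by simp
  have \<theta>: "\<theta> > 0" "R * A * \<theta> < \<delta> / 2"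
    using \<delta> pos3 by (auto simp: \<theta>_def field_simps)
  \<comment> \<open>This gives exp (2 C \<tau>) = 1 + \<theta>, where \<theta> is the permitted
    relative error of weight products within a cube.\<close>
  define \<tau> where "\<tau> = ln (1 + \<theta>) / (2 * C)"
  have \<tau>: "\<tau> > 0" "2 * (C * \<tau>) = ln (1 + \<theta>)" using \<theta>(1) C by (auto simp: \<tau>_def)
  \<comment> \<open>The value 2 * L leaves L \<le> m k after the times are lowered by L, so the
    powers kill u. It also keeps m j + l below m k for earlier j and l < L, and admits every such l
    in (iii).\<close>
  obtain q n \<mu> where fam: "covering_family F \<tau> (2 * L) (min \<epsilon>1 \<epsilon>2) K q n \<mu>"
    using family[of \<tau> "2 * L" "min \<epsilon>1 \<epsilon>2"] \<tau>(1) L \<epsilon>1(1) \<epsilon>2(1) by auto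
  note fam = fam[unfolded covering_family_def]
  have n1: "2 * L \<le> n 1" by (rule conjunct1[OF fam])
  note fam = conjunct2[OF fam]
  have gap: "n k + 2 * L \<le> n (Suc k)" if "k \<in> {1..<q}" for k by (rule bspec[OF conjunct1[OF fam] that])
  note fam = conjunct2[OF fam]
  have \<mu>I: "\<mu> k $ i \<in> I" if "k \<in> {1..q}" for k i by (rule spec[OF bspec[OF conjunct1[OF fam] that]])
  note fam = conjunct2[OF fam]
  note cover = conjunct1[OF fam] and small1 = spec[OF conjunct1[OF conjunct2[OF fam]]]
    and small2 = spec[OF spec[OF bspec[OF conjunct2[OF conjunct2[OF fam]]]], rule_format]
  have n_gap: "n j + 2 * L \<le> n k" if "1 \<le> j" "j < k" "k \<le> q" for j k
    using gap_le[of q n "2 * L", OF gap] that by blast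
  have n_ge: "2 * L \<le> n k" if "k \<in> {1..q}" for k
    using that n1 n_gap[of 1 k] by (cases "k = 1") auto
  have n_inj: "j = k" if "j \<in> {1..q}" "k \<in> {1..q}" "n j = n k" for j k
    using that n_gap[of j k] n_gap[of k j] L by (cases j k rule: linorder_cases) auto
  text \<open>Shifting the times by \<open>L\<close> turns the smallness of (ii), which only involves the vectors
    \<open>e\<^sub>n\<close>, into smallness of the preimages of all vectors supported in \<open>[0, L)\<close>.\<close>
  define m where "m k = n k - L" for k
  have nm: "n k = m k + L" "L \<le> m k" "1 \<le> m k" if "k \<in> {1..q}" for k
    using n_ge[OF that] L by (auto simp: m_def)
  have m_gap: "m j + 2 * L \<le> m k" if "1 \<le> j" "j < k" "k \<le> q" for j k
    using n_gap[OF that] nm(1)[of j] nm(1)[of k] that by auto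
  \<comment> \<open>\<open>Y i l\<close> collects the preimages of e_l for all k at once: at time m
    k and parameter \<open>\<mu> k\<close> its k-th term returns exactly to e_l.\<close>
  define Y where "Y i l = (\<Sum>k=1..q. cscale (of_real (1 / wprod (w (\<mu> k $ i)) l (m k))) (unit_seq (m k + l)))" for i l
  define z where "z i = (\<Sum>l<L. cscale (v i l) (Y i l))" for i
  have YX: "Y i l \<in> X" for i l unfolding Y_def by (intro X_sum X_scale X_unit)
  have zX: "z i \<in> X" for i unfolding z_def by (intro X_sum X_scale YX)
  have Y_small: "sn p (Y i l) \<le> G * D * \<delta>1" if l: "l < L" for i l
  proof -
    let ?s = "\<Sum>k=1..q. cscale (of_real (1 / wprod (w (\<mu> k $ i)) 0 (n k))) (unit_seq (n k))"
    have sX: "?s \<in> X" by (intro X_sum X_scale X_unit)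
    \<comment> \<open>L - l shifts move position n k to m k + l, where \<open>Y i l\<close> has its
      k-th term. Hence the vector of (ii), shifted with the reference parameter, dominates all these
      preimages.\<close>
    have "sn p (Y i l) \<le> (G * D) * sn p (B \<beta> (L - l) ?s)"
      unfolding Y_def
    proof (rule sn_sparse_sum)
      show "inj_on (\<lambda>k. m k + l) {1..q}"
      proof (rule inj_onI)
        fix j k assume jk: "j \<in> {1..q}" "k \<in> {1..q}" "m j + l = m k + l"
        then have "n j = n k" unfolding nm(1)[OF jk(1)] nm(1)[OF jk(2)] by simp
        then show "j = k" by (rule n_inj[OF jk(1,2)])
      qed
      show "B \<beta> (L - l) ?s \<in> X" by (rule B_in_X[OF \<beta> sX])
      show "0 \<le> G * D" using G0 D by simp
      fix k assume k: "k \<in> {1..q}"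
      let ?a = "\<mu> k $ i"
      have aI: "?a \<in> I" by (rule \<mu>I[OF k])
      have s_nk: "?s (n k) = of_real (1 / wprod (w ?a) 0 (n k))"
        by (rule sparse_sum_apply[OF finite_atLeastAtMost _ k]) (rule inj_onI, rule n_inj)
      have idx: "m k + l + (L - l) = n k" using nm(1)[OF k] l by simp
      \<comment> \<open>The weights up to n k are split at l and at l + m k. The middle piece is the
        wanted one; the outer ones, of lengths l and L - l, are compared with \<beta> at total cost
        G * D.\<close>
      have W1: "wprod (w ?a) 0 (n k) = wprod (w ?a) 0 l * (wprod (w ?a) l (m k) * wprod (w ?a) (l + m k) (L - l))"
        using wprod_add[of "w ?a" 0 l "m k + (L - l)"] wprod_add[of "w ?a" l "m k" "L - l"] idx
        by (simp add: add.assoc add.left_commute[of l "m k"])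
      have y: "cmod (B \<beta> (L - l) ?s (m k + l)) = wprod (w \<beta>) (m k + l) (L - l) / wprod (w ?a) 0 (n k)"
      proof -
        have "B \<beta> (L - l) ?s (m k + l) = of_real (wprod (w \<beta>) (m k + l) (L - l)) * ?s (m k + l + (L - l))"
          by (simp only: wshift_funpow)
        also have "\<dots> = of_real (wprod (w \<beta>) (m k + l) (L - l) / wprod (w ?a) 0 (n k))"
          unfolding idx s_nk by simp
        finally show ?thesis
          using W_pos[OF \<beta>, of "m k + l" "L - l"] W_pos[OF aI, of 0 "n k"] by (simp only: norm_of_real) simp
      qed
      have "wprod (w ?a) 0 l * wprod (w ?a) (l + m k) (L - l)
          \<le> ((1/c) ^ l * G) * ((1/c) ^ (L - l) * wprod (w \<beta>) (l + m k) (L - l))"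
      proof (rule mult_mono)
        show "wprod (w ?a) 0 l \<le> (1/c) ^ l * G"
          using W_le[OF \<beta> aI, of 0 l] G[OF l] c_pos by (meson mult_left_mono order_trans zero_le_divide_1_iff zero_le_power less_imp_le)
      qed (use W_le[OF \<beta> aI] W_pos[OF aI] G0 c_pos in \<open>auto intro: less_imp_le\<close>)
      also have "\<dots> = G * D * wprod (w \<beta>) (m k + l) (L - l)"
        unfolding D_def using power_add[of "1/c" l "L - l"] l by (simp add: add.commute mult_ac)
      finally have W2: "wprod (w ?a) 0 l * wprod (w ?a) (l + m k) (L - l) \<le> G * D * wprod (w \<beta>) (m k + l) (L - l)" .
      have "1 / wprod (w ?a) l (m k) = (wprod (w ?a) 0 l * wprod (w ?a) (l + m k) (L - l)) / wprod (w ?a) 0 (n k)"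
        unfolding W1 using W_pos[OF aI, of 0 l] W_pos[OF aI, of "l + m k" "L - l"] W_pos[OF aI, of l "m k"]
        by (simp add: field_simps)
      also have "\<dots> \<le> (G * D * wprod (w \<beta>) (m k + l) (L - l)) / wprod (w ?a) 0 (n k)"
        using W2 W_pos[OF aI, of 0 "n k"] by (intro divide_right_mono) auto
      also have "\<dots> = G * D * cmod (B \<beta> (L - l) ?s (m k + l))" unfolding y by simp
      finally show "cmod (of_real (1 / wprod (w ?a) l (m k))) \<le> G * D * cmod (B \<beta> (L - l) ?s (m k + l))"
        using W_pos[OF aI, of l "m k"] by (simp only: norm_of_real) simp
    qed simp
    also have "\<dots> \<le> (G * D) * \<delta>1"
    proof (rule mult_left_mono)
      have "sn q0 ?s < \<delta>0" using small1[of i] by (intro \<epsilon>1(2) sX) simp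
      then show "sn p (B \<beta> (L - l) ?s) \<le> \<delta>1"
        by (rule less_imp_le[OF \<delta>0(2)[OF diff_le_self \<beta> sX]])
    qed (use G0 D in simp)
    finally show ?thesis .
  qed
  have z_small: "sn p (z i) < \<delta>" for i
  proof -
    have "sn p (z i) \<le> (\<Sum>l<L. sn p (cscale (v i l) (Y i l)))"
      unfolding z_def by (intro sn_sum X_scale YX)
    also have "\<dots> \<le> (\<Sum>l<L. R * (G * D * \<delta>1))"
    proof (rule sum_mono)
      fix l assume "l \<in> {..<L}"
      then have l: "l < L" by simp
      have "sn p (cscale (v i l) (Y i l)) \<le> cmod (v i l) * sn p (Y i l)" by (rule sn_scale_le[OF YX])
      also have "\<dots> \<le> R * (G * D * \<delta>1)"
        using vR[OF l] Y_small[OF l] R sn_nonneg[OF YX] by (intro mult_mono) auto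
      finally show "sn p (cscale (v i l) (Y i l)) \<le> R * (G * D * \<delta>1)" .
    qed
    also have "\<dots> = real L * R * (G * D) * \<delta>1" by simp
    also have "\<dots> < \<delta>" by (rule \<delta>1(2))
    finally show ?thesis .
  qed
  define x where "x i = u i + z i" for i
  have orbit: "sn p (B (\<nu> $ i) (m k) (x i) - v i) < \<delta>"
    if \<nu>: "\<nu> \<in> K" and k: "k \<in> {1..q}" and cube: "\<nu> $ i \<in> {\<mu> k $ i - \<tau> / real (F (n k)) .. \<mu> k $ i}" for \<nu> k i
  proof -
    let ?a = "\<nu> $ i" and ?b = "\<mu> k $ i"
    have aI: "?a \<in> I" by (rule K[OF \<nu>])
    have bI: "?b \<in> I" by (rule \<mu>I[OF k])
    have ab: "?a \<le> ?b" using cube by simp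
    \<comment> \<open>\<open>\<mu> k\<close> is the right corner of the cube, so its products
      majorise those of \<nu>; therefore (iii), stated at the corner, controls the whole
      cube.\<close>
    have Wab: "wprod (w ?a) l t \<le> wprod (w ?b) l t" for l t
      by (intro wprod_mono conjI w_pos aI w_mono bI ab)
    have F_nk: "real (F (n k)) > 0" using F1[of "n k"] n_ge[OF k] L by simp
    \<comment> \<open>F is nondecreasing, so the side length \<tau> / F (n k) also controls all
      shorter products. The lengths l and l + m k will both be needed.\<close>
    have ln_close: "\<bar>ln (wprod (w ?a) 0 t) - ln (wprod (w ?b) 0 t)\<bar> \<le> C * \<tau>" if "t \<le> n k" for t
    proof (cases "t = 0")
      case True
      then show ?thesis using C \<tau>(1) by simp
    next
      case False
      have "\<bar>ln (wprod (w ?a) 0 t) - ln (wprod (w ?b) 0 t)\<bar> \<le> C * real (F t) * \<bar>?a - ?b\<bar>"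
        using False by (intro upper aI bI) simp
      also have "\<dots> \<le> C * real (F (n k)) * (\<tau> / real (F (n k)))"
      proof (intro mult_mono)
        show "real (F t) \<le> real (F (n k))" using F_mono[of t "n k"] that False by simp
        show "\<bar>?a - ?b\<bar> \<le> \<tau> / real (F (n k))" using cube by auto
      qed (use C in auto)
      also have "\<dots> = C * \<tau>" using F_nk by simp
      finally show ?thesis .
    qed
    define \<rho> where "\<rho> l = wprod (w ?a) l (m k) / wprod (w ?b) l (m k)" for l
    have \<rho>: "\<bar>\<rho> l - 1\<bar> \<le> \<theta>" if l: "l < L" for l
    proof -
      have pos: "wprod (w ?a) l (m k) > 0" "wprod (w ?b) l (m k) > 0" using W_pos aI bI by auto
      have ln_split: "ln (wprod (w a) 0 (l + m k)) = ln (wprod (w a) 0 l) + ln (wprod (w a) l (m k))" if "a \<in> I" for a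
        unfolding wprod_add using W_pos[OF that, of 0 l] W_pos[OF that, of l "m k"] by (simp add: ln_mult)
      have "ln (wprod (w ?b) l (m k)) - ln (wprod (w ?a) l (m k)) \<le> 2 * (C * \<tau>)"
        using ln_close[of "l + m k"] ln_close[of l] nm(1)[OF k] l ln_split[OF aI] ln_split[OF bI] by (simp add: abs_le_iff)
      then have "ln (wprod (w ?b) l (m k)) \<le> ln ((1 + \<theta>) * wprod (w ?a) l (m k))"
        using \<tau>(2) \<theta>(1) pos by (simp add: ln_mult)
      then have "wprod (w ?b) l (m k) \<le> (1 + \<theta>) * wprod (w ?a) l (m k)"
        using pos \<theta>(1) by simp
      then have "1 \<le> (1 + \<theta>) * \<rho> l" using pos by (simp add: \<rho>_def field_simps)
      moreover have "\<rho> l \<le> 1" using Wab pos by (simp add: \<rho>_def)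
      then have "\<theta> * \<rho> l \<le> \<theta>" using \<theta>(1) by (simp add: mult_left_le)
      ultimately show ?thesis using \<open>\<rho> l \<le> 1\<close> by (simp add: distrib_right)
    qed
    define T where "T l = (\<Sum>j=Suc k..q. cscale (of_real (1 / wprod (w (\<mu> j $ i)) l (m j)) *
        of_real (wprod (w ?a) (m j + l - m k) (m k))) (unit_seq (m j + l - m k)))" for l
    have TX: "T l \<in> X" for l unfolding T_def by (intro X_sum X_scale X_unit)
    have BY: "B ?a (m k) (Y i l) = cscale (of_real (\<rho> l)) (unit_seq l) + T l" if l: "l < L" for l
    proof -
      have "B ?a (m k) (Y i l) =
        cscale (of_real (1 / wprod (w ?b) l (m k)) * of_real (wprod (w ?a) (m k + l - m k) (m k))) (unit_seq (m k + l - m k)) + T l"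
        unfolding Y_def T_def
      proof (rule B_sparse_sum[OF k])
        show "m j + l < m k" if "j \<in> {1..<k}" for j using m_gap[of j k] that k l by auto
        show "m k \<le> m j + l" if "j \<in> {k..q}" for j
          using m_gap[of k j] that k by (cases "j = k") auto
      qed
      also have "of_real (1 / wprod (w ?b) l (m k)) * of_real (wprod (w ?a) (m k + l - m k) (m k)) = complex_of_real (\<rho> l)"
        by (simp add: \<rho>_def)
      also have "m k + l - m k = l" by simp
      finally show ?thesis .
    qed
    have T_small: "sn p (T l) \<le> D * \<delta>2" if l: "l < L" for l
    proof -
      let ?s = "\<Sum>j=Suc k..q. cscale (of_real (wprod (w ?b) (n j - n k + l) (n k) / wprod (w (\<mu> j $ i)) l (n j)))
            (unit_seq (n j - n k + l))"
      have sX: "?s \<in> X" by (intro X_sum X_scale X_unit)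
      have range: "j \<in> {1..q}" "m j + l - m k = n j - n k + l" "n k < n j" if "j \<in> {Suc k..q}" for j
      proof -
        show j: "j \<in> {1..q}" using that by auto
        show "n k < n j" using n_gap[of k j] that k L by auto
        then show "m j + l - m k = n j - n k + l" using nm(1)[OF j] nm(1)[OF k] by auto
      qed
      have inj: "inj_on (\<lambda>j. n j - n k + l) {Suc k..q}"
      proof (rule inj_onI)
        fix j j' assume jj: "j \<in> {Suc k..q}" "j' \<in> {Suc k..q}" "n j - n k + l = n j' - n k + l"
        then have "n j = n j'" using range(3)[OF jj(1)] range(3)[OF jj(2)] by linarith
        then show "j = j'" using n_inj range(1) jj by blast
      qed
      have T_eq: "T l = (\<Sum>j=Suc k..q. cscale (of_real (1 / wprod (w (\<mu> j $ i)) l (m j)) *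
        of_real (wprod (w ?a) (n j - n k + l) (m k))) (unit_seq (n j - n k + l)))"
        unfolding T_def by (rule sum.cong[OF refl]) (simp only: range(2))
      \<comment> \<open>Both sums occupy the same positions. Passing from m to n adds the same L
        weight indices above and below the fraction, with parameter \<open>\<mu> k\<close> above and
        \<open>\<mu> j\<close> below; exchanging these costs D.\<close>
      have "sn p (T l) \<le> D * sn p ?s"
        unfolding T_eq
      proof (rule sn_sparse_sum[OF _ inj sX])
        show "0 \<le> D" using D by simp
        fix j assume j: "j \<in> {Suc k..q}"
        let ?d = "\<mu> j $ i" and ?t = "n j - n k + l"
        have dI: "?d \<in> I" by (rule \<mu>I[OF range(1)[OF j]])
        have s_j: "?s ?t = of_real (wprod (w ?b) ?t (n k) / wprod (w ?d) l (n j))"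
          by (rule sparse_sum_apply[OF _ inj j]) simp
        have idx: "?t + m k = l + m j" "n k = m k + L" "n j = m j + L"
          using nm(1)[OF k] nm(1)[OF range(1)[OF j]] range(3)[OF j] by auto
        have Wb: "wprod (w ?b) ?t (n k) = wprod (w ?b) ?t (m k) * wprod (w ?b) (l + m j) L"
          using wprod_add[of "w ?b" ?t "m k" L] by (simp only: idx(1) idx(2)[symmetric])
        have Wd: "wprod (w ?d) l (n j) = wprod (w ?d) l (m j) * wprod (w ?d) (l + m j) L"
          using wprod_add[of "w ?d" l "m j" L] by (simp only: idx(3)[symmetric])
        have pos: "wprod (w ?b) ?t (m k) > 0" "wprod (w ?d) l (m j) > 0"
          "wprod (w ?d) (l + m j) L > 0" "wprod (w ?a) ?t (m k) > 0" "wprod (w ?b) (l + m j) L > 0"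
          using W_pos aI bI dI by auto
        have "wprod (w ?a) ?t (m k) / wprod (w ?d) l (m j) \<le> wprod (w ?b) ?t (m k) / wprod (w ?d) l (m j)"
          using Wab pos by (intro divide_right_mono) auto
        also have "\<dots> = wprod (w ?b) ?t (m k) * wprod (w ?d) (l + m j) L / wprod (w ?d) l (n j)"
          unfolding Wd using pos by simp
        also have "\<dots> \<le> wprod (w ?b) ?t (m k) * (D * wprod (w ?b) (l + m j) L) / wprod (w ?d) l (n j)"
          unfolding D_def using W_le[OF bI dI, of "l + m j" L] pos W_pos[OF dI, of l "n j"]
          by (intro divide_right_mono mult_left_mono) auto
        also have "\<dots> = D * (wprod (w ?b) ?t (n k) / wprod (w ?d) l (n j))"
          unfolding Wb by simp
        also have "\<dots> = D * cmod (?s ?t)"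
          unfolding s_j norm_of_real using W_pos[OF bI, of ?t "n k"] W_pos[OF dI, of l "n j"] by simp
        finally have "wprod (w ?a) ?t (m k) / wprod (w ?d) l (m j) \<le> D * cmod (?s ?t)" .
        moreover have "cmod (of_real (1 / wprod (w ?d) l (m j)) * of_real (wprod (w ?a) ?t (m k)))
            = wprod (w ?a) ?t (m k) / wprod (w ?d) l (m j)"
          using pos by (simp add: norm_mult norm_divide)
        ultimately show "cmod (of_real (1 / wprod (w ?d) l (m j)) * of_real (wprod (w ?a) ?t (m k))) \<le> D * cmod (?s ?t)"
          by linarith
      qed simp
      also have "sn p ?s \<le> \<delta>2"
      \<comment> \<open>Condition (iii) is stated for k < q; for k = q the sum is empty.\<close>
      proof (cases "k = q")
        case True
        then have "?s = 0" by simp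
        then show ?thesis using sn_0[of p] \<delta>2(1) by (simp only: less_imp_le)
      next
        case False
        then have "Fnorm nrm ?s < \<epsilon>2" using small2[of k l i] k l by simp
        then show ?thesis using \<epsilon>2(2)[OF sX] by simp
      qed
      finally show ?thesis using D by simp
    qed
    have Bu: "B ?a (m k) (u i) = 0"
      using nm(2)[OF k] u by (auto simp: wshift_funpow fun_eq_iff)
    have eq: "B ?a (m k) (x i) - v i = (\<Sum>l<L. cscale (v i l) (cscale (of_real (\<rho> l - 1)) (unit_seq l) + T l))"
    proof -
      have "B ?a (m k) (x i) = B ?a (m k) (z i)"
        unfolding x_def wshift_funpow_add Bu by simp
      also have "\<dots> = (\<Sum>l<L. cscale (v i l) (B ?a (m k) (Y i l)))"
        unfolding z_def wshift_funpow_sum wshift_funpow_scale ..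
      also have "\<dots> = (\<Sum>l<L. cscale (v i l) (cscale (of_real (\<rho> l)) (unit_seq l) + T l))"
        by (rule sum.cong[OF refl]) (simp only: BY lessThan_iff)
      finally have 1: "B ?a (m k) (x i) = (\<Sum>l<L. cscale (v i l) (cscale (of_real (\<rho> l)) (unit_seq l) + T l))" .
      have "B ?a (m k) (x i) - v i
          = (\<Sum>l<L. cscale (v i l) (cscale (of_real (\<rho> l)) (unit_seq l) + T l)) - (\<Sum>l<L. cscale (v i l) (unit_seq l))"
        using 1 finite_support[of "v i", OF v] by metis
      also have "\<dots> = (\<Sum>l<L. cscale (v i l) (cscale (of_real (\<rho> l)) (unit_seq l) + T l) - cscale (v i l) (unit_seq l))"
        by (rule sum_subtractf[symmetric])
      also have "\<dots> = (\<Sum>l<L. cscale (v i l) (cscale (of_real (\<rho> l - 1)) (unit_seq l) + T l))"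
      proof (rule sum.cong[OF refl])
        fix l
        show "cscale (v i l) (cscale (of_real (\<rho> l)) (unit_seq l) + T l) - cscale (v i l) (unit_seq l)
          = cscale (v i l) (cscale (of_real (\<rho> l - 1)) (unit_seq l) + T l)"
          by (rule ext) (simp add: algebra_simps)
      qed
      finally show ?thesis .
    qed
    have hX: "cscale (of_real (\<rho> l - 1)) (unit_seq l) + T l \<in> X" for l
      by (intro X_add X_scale X_unit TX)
    have "sn p (B ?a (m k) (x i) - v i) \<le> (\<Sum>l<L. sn p (cscale (v i l) (cscale (of_real (\<rho> l - 1)) (unit_seq l) + T l)))"
      unfolding eq by (intro sn_sum X_scale hX)
    also have "\<dots> \<le> (\<Sum>l<L. R * (\<theta> * sn p (unit_seq l) + D * \<delta>2))"
    proof (rule sum_mono)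
      fix l assume "l \<in> {..<L}"
      then have l: "l < L" by simp
      have "sn p (cscale (of_real (\<rho> l - 1)) (unit_seq l) + T l) \<le> sn p (cscale (of_real (\<rho> l - 1)) (unit_seq l)) + sn p (T l)"
        by (intro sn_triangle X_scale X_unit TX)
      also have "\<dots> \<le> \<bar>\<rho> l - 1\<bar> * sn p (unit_seq l) + D * \<delta>2"
        using sn_scale_le[OF X_unit, of p "of_real (\<rho> l - 1)" l] T_small[OF l] unfolding norm_of_real by linarith
      also have "\<dots> \<le> \<theta> * sn p (unit_seq l) + D * \<delta>2"
        using \<rho>[OF l] sn_nonneg[OF X_unit] by (intro add_right_mono mult_right_mono) auto
      finally have 1: "sn p (cscale (of_real (\<rho> l - 1)) (unit_seq l) + T l) \<le> \<theta> * sn p (unit_seq l) + D * \<delta>2" .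
      have "sn p (cscale (v i l) (cscale (of_real (\<rho> l - 1)) (unit_seq l) + T l))
          \<le> cmod (v i l) * sn p (cscale (of_real (\<rho> l - 1)) (unit_seq l) + T l)"
        by (rule sn_scale_le[OF hX])
      also have "\<dots> \<le> R * (\<theta> * sn p (unit_seq l) + D * \<delta>2)"
        using vR[OF l] 1 R sn_nonneg[OF hX] by (intro mult_mono) auto
      finally show "sn p (cscale (v i l) (cscale (of_real (\<rho> l - 1)) (unit_seq l) + T l))
          \<le> R * (\<theta> * sn p (unit_seq l) + D * \<delta>2)" .
    qed
    also have "\<dots> = R * A * \<theta> + real L * R * D * \<delta>2"
      unfolding A_def by (simp add: sum.distrib distrib_left sum_distrib_left sum_distrib_right mult_ac)
    also have "\<dots> < \<delta>" using \<delta>2(2) \<theta>(2) by linarith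
    finally show ?thesis .
  qed
  show ?thesis
  proof (intro exI[of _ x] exI[of _ "m ` {1..q}"] conjI allI ballI)
    show "x i \<in> X" for i unfolding x_def by (intro X_add uX zX)
    have "x i - u i = z i" for i by (simp add: x_def)
    then show "sn p (x i - u i) < \<delta>" for i using z_small by simp
    fix \<nu> assume \<nu>: "\<nu> \<in> K"
    then obtain k where k: "k \<in> {1..q}" "\<forall>i. \<nu> $ i \<in> {\<mu> k $ i - \<tau> / real (F (n k)) .. \<mu> k $ i}"
      using cover by blast
    then show "\<exists>n\<in>m ` {1..q}. \<forall>i. sn p (B (\<nu> $ i) n (x i) - v i) < \<delta>"
      using orbit[OF \<nu> k(1)] by blast
  qed simp
qed

end

section \<open>A countable dense set of finitely supported vectors\<close>

context unconditional_frechet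
begin

text \<open>The tail of y is small, and its finitely many other coordinates are approximated from a
  countable dense set of complex numbers. Finite support is what the approximation step demands of
  its source and target vectors.\<close>

lemma countable_dense_finite_support:
  obtains V where "countable V" "V \<subseteq> X" "\<And>v. v \<in> V \<Longrightarrow> \<exists>L. \<forall>m\<ge>L. v m = 0"
    "\<And>y p \<epsilon>. y \<in> X \<Longrightarrow> \<epsilon> > 0 \<Longrightarrow> \<exists>v\<in>V. sn p (v - y) < \<epsilon>"
proof -
  obtain Q :: "complex set" where Q: "countable Q" "\<And>U. open U \<Longrightarrow> U \<noteq> {} \<Longrightarrow> \<exists>d\<in>Q. d \<in> U"
    using countable_dense_setE by blast
  define vec :: "complex list \<Rightarrow> nat \<Rightarrow> complex"
    where "vec xs = (\<lambda>m. if m < length xs then xs ! m else 0)" for xs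
  show ?thesis
  proof (rule that[of "vec ` lists Q"])
    show "countable (vec ` lists Q)" using Q(1) by simp
    have "vec xs = restr {..<length xs} (vec xs)" for xs by (auto simp: vec_def restr_def)
    then have "vec xs \<in> X" for xs using X_restr[of "{..<length xs}" "vec xs"] by simp
    then show "vec ` lists Q \<subseteq> X" by blast
    show "\<exists>L. \<forall>m\<ge>L. v m = 0" if v: "v \<in> vec ` lists Q" for v
    proof -
      obtain xs where "v = vec xs" using v by blast
      then show ?thesis by (intro exI[of _ "length xs"]) (simp add: vec_def)
    qed
    fix y p and \<epsilon> :: real assume y: "y \<in> X" and e: "\<epsilon> > 0"
    obtain N where N: "sn p (restr {N..} y) < \<epsilon> / 2"
      using sn_tail_small[OF y, of "\<epsilon>/2" p] e by auto
    define A where "A = (\<Sum>l<N. sn p (unit_seq l))"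
    have A: "A \<ge> 0" unfolding A_def by (intro sum_nonneg sn_nonneg X_unit)
    define \<eta> where "\<eta> = \<epsilon> / (2 * (A + 1))"
    have \<eta>: "\<eta> > 0" "\<eta> * A \<le> \<epsilon> / 2" using e A by (auto simp: \<eta>_def field_simps)
    have "\<exists>d\<in>Q. d \<in> ball (y l) \<eta>" for l using \<eta>(1) by (intro Q(2)) auto
    then obtain d where d: "\<And>l. d l \<in> Q" "\<And>l. cmod (y l - d l) < \<eta>"
      unfolding mem_ball dist_norm by metis
    define v where "v = vec (map d [0..<N])"
    have v: "v = (\<lambda>m. if m < N then d m else 0)" by (auto simp: v_def vec_def)
    have eq: "v - y = (\<Sum>l<N. cscale ((v - y) l) (unit_seq l)) + restr {N..} (- y)"
      unfolding restr_eq_sum[OF finite_lessThan] by (auto simp: v restr_def fun_eq_iff)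
    have tail: "restr {N..} (- y) \<in> X" "sn p (restr {N..} (- y)) \<le> sn p (restr {N..} y)"
      by (rule solid1[OF X_restr_any[OF y, of "{N..}"]], simp add: restr_def)+
    have head: "sn p (\<Sum>l<N. cscale ((v - y) l) (unit_seq l)) \<le> \<epsilon> / 2"
    proof -
      have "sn p (\<Sum>l<N. cscale ((v - y) l) (unit_seq l)) \<le> (\<Sum>l<N. sn p (cscale ((v - y) l) (unit_seq l)))"
        by (intro sn_sum X_scale X_unit)
      also have "\<dots> \<le> (\<Sum>l<N. \<eta> * sn p (unit_seq l))"
      proof (rule sum_mono)
        fix l assume l: "l \<in> {..<N}"
        have "sn p (cscale ((v - y) l) (unit_seq l)) \<le> cmod ((v - y) l) * sn p (unit_seq l)"
          by (rule sn_scale_le[OF X_unit])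
        also have "\<dots> \<le> \<eta> * sn p (unit_seq l)"
          using d(2)[of l] l sn_nonneg[OF X_unit] by (intro mult_right_mono) (auto simp: v norm_minus_commute)
        finally show "sn p (cscale ((v - y) l) (unit_seq l)) \<le> \<eta> * sn p (unit_seq l)" .
      qed
      also have "\<dots> \<le> \<epsilon> / 2" using \<eta>(2) by (simp add: A_def sum_distrib_left)
      finally show ?thesis .
    qed
    have "sn p (v - y) \<le> sn p (\<Sum>l<N. cscale ((v - y) l) (unit_seq l)) + sn p (restr {N..} (- y))"
      using sn_triangle[OF X_sum tail(1), of "{..<N}" "\<lambda>l. cscale ((v - y) l) (unit_seq l)" p]
        X_scale[OF X_unit] eq by metis
    then have "sn p (v - y) < \<epsilon>" using head tail(2) N by linarith
    moreover have "v \<in> vec ` lists Q" unfolding v_def lists_eq_set using d(1) by (intro imageI) auto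
    ultimately show "\<exists>v\<in>vec ` lists Q. sn p (v - y) < \<epsilon>" by blast
  qed
qed

end

section \<open>The Baire category argument for (a)\<close>

context weighted_shift_family
begin

text \<open>The condition on \<open>n 1\<close> is imposed even for q = 0, and the constant sequence
  N meets it. This settles an empty K, for which no return time can be selected.\<close>

lemma covering_family_empty: "\<epsilon> > 0 \<Longrightarrow> covering_family F \<tau> N \<epsilon> {} 0 (\<lambda>_. N) \<mu>"
proof -
  assume e: "\<epsilon> > 0"
  then obtain p where "\<And>q x. x \<in> X \<Longrightarrow> p \<le> q \<Longrightarrow> sn q x < \<epsilon> / 2 \<Longrightarrow> Fnorm nrm x < \<epsilon>"
    using sn_small_imp_Fnorm_small by blast
  then have "Fnorm nrm 0 < \<epsilon>" using X_0 sn_0 e half_gt_zero by (metis order_refl)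
  moreover have "{1..0::nat} = {}" by simp
  ultimately show ?thesis unfolding covering_family_def by (simp only: sum.empty) simp
qed

text \<open>The dense open sets are interiors of sets H, so only density needs proof: since finitely
  many times suffice, equicontinuity makes the vector found by approximation an interior point of
  H.\<close>

lemma dense_gdelta_of_common_hypercyclic_vectors:
  fixes \<Lambda> :: "(real ^ 'd) set"
  assumes \<Lambda>: "\<And>\<mu> i. \<mu> \<in> \<Lambda> \<Longrightarrow> \<mu> $ i \<in> I" and sigma: "sigma_compact \<Lambda>"
    and approx: "\<And>K p \<delta> L (u :: 'd \<Rightarrow> nat \<Rightarrow> complex) v.
      compact K \<Longrightarrow> K \<subseteq> \<Lambda> \<Longrightarrow> \<delta> > 0 \<Longrightarrow> L \<ge> 1 \<Longrightarrow> (\<And>i m. m \<ge> L \<Longrightarrow> u i m = 0) \<Longrightarrow> (\<And>i m. m \<ge> L \<Longrightarrow> v i m = 0) \<Longrightarrow>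
      \<exists>x S. finite S \<and> (\<forall>i. x i \<in> X \<and> sn p (x i - u i) < \<delta>) \<and>
        (\<forall>\<mu>\<in>K. \<exists>n\<in>S. \<forall>i. sn p (B (\<mu> $ i) n (x i) - v i) < \<delta>)"
  shows "\<exists>G. gdelta_in P G \<and> P closure_of G = topspace P \<and>
    (\<forall>x\<in>G. common_hypercyclic_vector P (\<lambda>\<mu>. prod_op (\<lambda>i. wshift (w (\<mu> $ i)))) \<Lambda> x)"
proof -
  let ?P = "P :: ('d \<Rightarrow> nat \<Rightarrow> complex) topology"
  obtain K where K: "\<And>n::nat. compact (K n)" "\<Lambda> = (\<Union>n. K n)"
    using sigma unfolding sigma_compact_def by blast
  obtain V where V: "countable V" "V \<subseteq> X" "\<And>v. v \<in> V \<Longrightarrow> \<exists>L. \<forall>m\<ge>L. v m = 0"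
    "\<And>y p \<epsilon>. y \<in> X \<Longrightarrow> \<epsilon> > 0 \<Longrightarrow> \<exists>v\<in>V. sn p (v - y) < \<epsilon>"
    using countable_dense_finite_support by metis
  define V' where "V' = (\<Pi>\<^sub>E i\<in>(UNIV :: 'd set). V)"
  have V': "countable V'" unfolding V'_def by (intro countable_PiE V(1)) auto
  have V'_dense: "\<exists>v\<in>V'. \<forall>i. sn p (v i - y i) < \<epsilon>" if "\<And>i. y i \<in> X" "\<epsilon> > 0" for y :: "'d \<Rightarrow> nat \<Rightarrow> complex" and p \<epsilon>
  proof -
    have "\<forall>i. \<exists>v\<in>V. sn p (v - y i) < \<epsilon>" using V(4) that by blast
    then obtain v where "\<And>i. v i \<in> V" "\<And>i. sn p (v i - y i) < \<epsilon>" by metis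
    then show ?thesis by (intro bexI[of _ v]) (auto simp: V'_def)
  qed
  have V'_support: "\<exists>L. \<forall>i. \<forall>m\<ge>L. v i m = 0" if "v \<in> V'" for v
  proof -
    have "\<forall>i. \<exists>L. \<forall>m\<ge>L. v i m = 0" using that V(3) by (auto simp: V'_def PiE_iff)
    then obtain l where l: "\<And>i m. m \<ge> l i \<Longrightarrow> v i m = 0" by metis
    have "v i m = 0" if "m \<ge> Max (range l)" for i m
      by (rule l, rule order_trans[OF _ that]) simp
    then show ?thesis by blast
  qed
  have V'X: "v i \<in> X" if "v \<in> V'" for v i using that V(2) by (auto simp: V'_def PiE_iff)
  \<comment> \<open>The number m serves both as index of the seminorm and as precision, so one
    countable parameter covers every neighbourhood of v.\<close>
  define H where "H k v m = {x \<in> topspace ?P. \<forall>\<mu>\<in>K k. \<exists>n. \<forall>i. sn m (B (\<mu> $ i) n (x i) - v i) < 1 / real (Suc m)}"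
    for k v m
  define \<G> where "\<G> = (\<lambda>(k, v, m). ?P interior_of (H k v m)) ` (UNIV \<times> V' \<times> UNIV)"
  have "countable \<G>" unfolding \<G>_def using V' by (intro countable_image countable_SIGMA) auto
  have "\<exists>v. v \<in> V'" using V'_dense[of "\<lambda>_. 0" 1] X_0 by auto
  then have "\<G> \<noteq> {}" by (auto simp: \<G>_def)
  have dense: "?P closure_of (?P interior_of (H k v m)) = topspace ?P" if v: "v \<in> V'" for k v m
    unfolding dense_intersects_open
  proof (intro allI impI, elim conjE)
    fix W :: "('d \<Rightarrow> nat \<Rightarrow> complex) set" assume W: "openin ?P W" "W \<noteq> {}"
    then obtain y where y: "y \<in> W" by blast
    have yX: "y i \<in> X" for i using openin_subset[OF W(1)] y topspace_P by blast
    obtain p \<delta> where \<delta>: "\<delta> > 0" "\<And>z. (\<And>i. z i \<in> X \<and> sn p (z i - y i) < \<delta>) \<Longrightarrow> z \<in> W"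
      using openin_P_contains_box[OF W(1) y] by metis
    obtain u where u: "u \<in> V'" "\<And>i. sn p (u i - y i) < \<delta> / 2"
      using V'_dense[of y "\<delta> / 2" p, OF yX half_gt_zero[OF \<delta>(1)]] by blast
    obtain Lu where Lu: "\<And>i m. m \<ge> Lu \<Longrightarrow> u i m = 0" using V'_support[OF u(1)] by blast
    obtain Lv where Lv: "\<And>i m. m \<ge> Lv \<Longrightarrow> v i m = 0" using V'_support[OF v] by blast
    define L where "L = max 1 (max Lu Lv)"
    define r where "r = 1 / real (Suc m)"
    have r: "r > 0" by (simp add: r_def)
    \<comment> \<open>Half of each tolerance goes to the approximation; \<delta>/2 remains for
      replacing y by u, and r/2 for replacing x by a nearby z.\<close>
    define \<delta>' where "\<delta>' = min (\<delta> / 2) (r / 2)"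
    have \<delta>': "\<delta>' > 0" "\<delta>' \<le> \<delta> / 2" "\<delta>' \<le> r / 2" using \<delta>(1) r by (auto simp: \<delta>'_def)
    have "\<exists>x S. finite S \<and> (\<forall>i. x i \<in> X \<and> sn (max p m) (x i - u i) < \<delta>') \<and>
        (\<forall>\<mu>\<in>K k. \<exists>n\<in>S. \<forall>i. sn (max p m) (B (\<mu> $ i) n (x i) - v i) < \<delta>')"
      by (rule approx[OF K(1) _ \<delta>'(1), of _ L]) (use K(2) Lu Lv in \<open>auto simp: L_def\<close>)
    then obtain x S where S: "finite S" and x: "\<And>i. x i \<in> X" "\<And>i. sn (max p m) (x i - u i) < \<delta>'"
      and hit: "\<And>\<mu>. \<mu> \<in> K k \<Longrightarrow> \<exists>n\<in>S. \<forall>i. sn (max p m) (B (\<mu> $ i) n (x i) - v i) < \<delta>'"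
      by blast
    obtain q \<eta> where \<eta>: "\<eta> > 0"
      "\<And>n a z. n \<in> S \<Longrightarrow> a \<in> I \<Longrightarrow> z \<in> X \<Longrightarrow> sn q z < \<eta> \<Longrightarrow> sn m (B a n z) < r / 2"
      using B_equicontinuous[OF half_gt_zero[OF r] S, of m] by metis
    have "x \<in> W"
    proof (rule \<delta>(2), rule conjI[OF x(1)])
      fix i
      have "sn p (x i - y i) \<le> sn p (x i - u i) + sn p (u i - y i)"
        using sn_triangle[OF X_diff[OF x(1)[of i] V'X[OF u(1), of i]] X_diff[OF V'X[OF u(1), of i] yX[of i]], of p] by simp
      moreover have "sn p (x i - u i) \<le> sn (max p m) (x i - u i)"
        by (intro sn_mono X_diff x(1) V'X[OF u(1)]) simp
      ultimately show "sn p (x i - y i) < \<delta>" using x(2)[of i] u(2)[of i] \<delta>'(2) by linarith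
    qed
    have "{z. \<forall>i. z i \<in> X \<and> sn q (z i - x i) < \<eta>} \<subseteq> H k v m"
    proof
      fix z assume "z \<in> {z. \<forall>i. z i \<in> X \<and> sn q (z i - x i) < \<eta>}"
      then have z: "\<And>i. z i \<in> X" "\<And>i. sn q (z i - x i) < \<eta>" by auto
      have "\<exists>n. \<forall>i. sn m (B (\<mu> $ i) n (z i) - v i) < r" if \<mu>: "\<mu> \<in> K k" for \<mu>
      proof -
        obtain n where n: "n \<in> S" "\<And>i. sn (max p m) (B (\<mu> $ i) n (x i) - v i) < \<delta>'" using hit[OF \<mu>] by blast
        have \<mu>I: "\<mu> $ i \<in> I" for i using \<Lambda> K(2) \<mu> by blast
        have "sn m (B (\<mu> $ i) n (z i) - v i) < r" for i
        proof -
          have X1: "B (\<mu> $ i) n (z i - x i) \<in> X" "B (\<mu> $ i) n (x i) - v i \<in> X"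
            by (intro B_in_X X_diff \<mu>I z(1) x(1) V'X[OF v])+
          have eq: "B (\<mu> $ i) n (z i) - v i = B (\<mu> $ i) n (z i - x i) + (B (\<mu> $ i) n (x i) - v i)"
            unfolding wshift_funpow_diff by simp
          have "sn m (B (\<mu> $ i) n (z i) - v i) \<le> sn m (B (\<mu> $ i) n (z i - x i)) + sn m (B (\<mu> $ i) n (x i) - v i)"
            unfolding eq by (rule sn_triangle[OF X1])
          moreover have "sn m (B (\<mu> $ i) n (x i) - v i) \<le> sn (max p m) (B (\<mu> $ i) n (x i) - v i)"
            by (rule sn_mono[OF _ X1(2)]) simp
          moreover have "sn m (B (\<mu> $ i) n (z i - x i)) < r / 2"
            by (rule \<eta>(2)[OF n(1) \<mu>I X_diff[OF z(1) x(1)] z(2)])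
          ultimately show ?thesis using n(2)[of i] \<delta>'(3) by linarith
        qed
        then show ?thesis by blast
      qed
      then show "z \<in> H k v m" using z(1) unfolding H_def topspace_P r_def by blast
    qed
    moreover have "openin ?P {z. \<forall>i. z i \<in> X \<and> sn q (z i - x i) < \<eta>}" by (rule openin_P_box[OF x(1)])
    moreover have "x \<in> {z. \<forall>i. z i \<in> X \<and> sn q (z i - x i) < \<eta>}" using x(1) sn_0 \<eta>(1) by simp
    ultimately have "x \<in> ?P interior_of (H k v m)" unfolding interior_of_def by blast
    with \<open>x \<in> W\<close> show "?P interior_of (H k v m) \<inter> W \<noteq> {}" by blast
  qed
  show ?thesis
  proof (intro exI[of _ "\<Inter>\<G>"] conjI ballI)
    show "gdelta_in ?P (\<Inter>\<G>)"
    proof (rule gdelta_in_Inter[OF \<open>countable \<G>\<close> \<open>\<G> \<noteq> {}\<close>])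
      show "gdelta_in ?P S" if "S \<in> \<G>" for S
        using that open_imp_gdelta_in[OF openin_interior_of] by (auto simp: \<G>_def)
    qed
    show "?P closure_of (\<Inter>\<G>) = topspace ?P"
    proof (rule Baire_category[OF disjI1[OF completely_metrizable_P] \<open>countable \<G>\<close>])
      show "openin ?P S \<and> ?P closure_of S = topspace ?P" if "S \<in> \<G>" for S
        using that dense by (auto simp: \<G>_def)
    qed
    fix x :: "'d \<Rightarrow> nat \<Rightarrow> complex" assume x: "x \<in> \<Inter>\<G>"
    have xH: "x \<in> H k v m" if "v \<in> V'" for k v m
    proof -
      have "?P interior_of (H k v m) \<in> \<G>" unfolding \<G>_def using that by (intro image_eqI[of _ _ "(k, v, m)"]) auto
      from InterD[OF x this] show ?thesis by (rule subsetD[OF interior_of_subset])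
    qed
    obtain v0 where "v0 \<in> V'" using \<open>\<exists>v. v \<in> V'\<close> by blast
    then have xP: "x \<in> topspace ?P" using xH[of v0 0 0] by (simp add: H_def)
    then have xX: "x i \<in> X" for i unfolding topspace_P by blast
    show "common_hypercyclic_vector ?P (\<lambda>\<mu>. prod_op (\<lambda>i. wshift (w (\<mu> $ i)))) \<Lambda> x"
      unfolding common_hypercyclic_vector_def hypercyclic_vector_def
    proof (intro conjI ballI xP)
      fix \<mu> assume \<mu>: "\<mu> \<in> \<Lambda>"
      let ?T = "prod_op (\<lambda>i. wshift (w (\<mu> $ i)))"
      obtain k where k: "\<mu> \<in> K k" using \<mu> K(2) by blast
      show "?P closure_of range (\<lambda>n. (?T ^^ n) x) = topspace ?P"
        unfolding dense_intersects_open
      proof (intro allI impI, elim conjE)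
        fix W :: "('d \<Rightarrow> nat \<Rightarrow> complex) set" assume W: "openin ?P W" "W \<noteq> {}"
        then obtain y where y: "y \<in> W" by blast
        have yX: "y i \<in> X" for i using openin_subset[OF W(1)] y topspace_P by blast
        obtain p \<delta> where \<delta>: "\<delta> > 0" "\<And>z. (\<And>i. z i \<in> X \<and> sn p (z i - y i) < \<delta>) \<Longrightarrow> z \<in> W"
          using openin_P_contains_box[OF W(1) y] by metis
        obtain m0 where m0: "1 / real (Suc m0) < \<delta> / 2"
          using reals_Archimedean[OF half_gt_zero[OF \<delta>(1)]] by (auto simp: inverse_eq_divide)
        \<comment> \<open>A larger index both sharpens the precision and makes the seminorm at least
          as strong as the one describing W.\<close>
        define m where "m = max p m0"
        have "1 / real (Suc m) \<le> 1 / real (Suc m0)" unfolding m_def by (intro divide_left_mono) auto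
        then have m: "1 / real (Suc m) < \<delta> / 2" "p \<le> m" using m0 by (auto simp: m_def)
        obtain v where v: "v \<in> V'" "\<And>i. sn m (v i - y i) < \<delta> / 2"
          using V'_dense[of y "\<delta> / 2" m, OF yX half_gt_zero[OF \<delta>(1)]] by blast
        obtain n where n: "\<And>i. sn m (B (\<mu> $ i) n (x i) - v i) < 1 / real (Suc m)"
          using xH[OF v(1), of k m] k unfolding H_def by blast
        have "(?T ^^ n) x \<in> W"
        proof (rule \<delta>(2))
          fix i
          have X1: "B (\<mu> $ i) n (x i) \<in> X" by (rule B_in_X[OF \<Lambda>[OF \<mu>] xX])
          have "sn m (B (\<mu> $ i) n (x i) - y i) \<le> sn m (B (\<mu> $ i) n (x i) - v i) + sn m (v i - y i)"
            using sn_triangle[OF X_diff[OF X1 V'X[OF v(1), of i]] X_diff[OF V'X[OF v(1), of i] yX[of i]], of m] by simp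
          then have "sn m (B (\<mu> $ i) n (x i) - y i) < \<delta>" using n[of i] v(2)[of i] m(1) by linarith
          moreover have "sn p (B (\<mu> $ i) n (x i) - y i) \<le> sn m (B (\<mu> $ i) n (x i) - y i)"
            by (intro sn_mono m(2) X_diff X1 yX)
          ultimately show "(?T ^^ n) x i \<in> X \<and> sn p ((?T ^^ n) x i - y i) < \<delta>"
            using X1 by (simp only: prod_op_funpow) simp
        qed
        then show "range (\<lambda>n. (?T ^^ n) x) \<inter> W \<noteq> {}" by blast
      qed
    qed
  qed
qed

end

theorem theorem2p1:
  fixes X :: "(nat \<Rightarrow> complex) set"
    and nrm :: "nat \<Rightarrow> (nat \<Rightarrow> complex) \<Rightarrow> real"
    and I :: "real set"
    and \<Lambda> :: "(real ^ 'd) set"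
    and w :: "real \<Rightarrow> nat \<Rightarrow> real"
    and f :: "nat \<Rightarrow> real \<Rightarrow> real"
    and F :: "nat \<Rightarrow> nat"
    and c C :: real
  assumes "frechet_sequence_space X nrm"
    and "unconditional_basis_of (seqtop X nrm) unit_seq"
    and "is_interval I" and "I \<noteq> {}"
    and "\<forall>\<mu>\<in>\<Lambda>. \<forall>i. \<mu> $ i \<in> I" and "sigma_compact \<Lambda>"
    and "\<forall>a\<in>I. \<forall>n\<ge>1. w a n > 0"
    and "\<forall>a\<in>I. continuous_map (seqtop X nrm) (seqtop X nrm) (wshift (w a))"
    and "\<forall>n\<ge>1. continuous_on I (\<lambda>a. w a n)"
    and "\<forall>n\<ge>1. mono_on I (\<lambda>a. w a n)"
    and "\<forall>n\<ge>1. \<forall>a\<in>I. f n a = (\<Sum>k=1..n. ln (w a k))"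
    and "\<forall>n\<ge>1. F n \<ge> 1" and "mono_on {1..} F"
    and "c > 0" and "C > 0"
    and "\<forall>n\<ge>1. \<forall>a\<in>I. \<forall>b\<in>I.
           c * real (F n) * \<bar>a - b\<bar> \<le> \<bar>f n a - f n b\<bar> \<and>
           \<bar>f n a - f n b\<bar> \<le> C * real (F n) * \<bar>a - b\<bar>"
    and "\<forall>n\<ge>1. \<forall>a\<in>I. \<forall>b\<in>I. w a n / w b n \<ge> c"
  shows "((\<exists>G. gdelta_in (power_space (seqtop X nrm)) G \<and>
               power_space (seqtop X nrm) closure_of G = topspace (power_space (seqtop X nrm)) \<and>
               (\<forall>x\<in>G. common_hypercyclic_vector (power_space (seqtop X nrm))
                 (\<lambda>\<mu>. prod_op (\<lambda>i. wshift (w (\<mu> $ i)))) \<Lambda> x))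
          \<longleftrightarrow>
          (\<exists>x. common_hypercyclic_vector (power_space (seqtop X nrm))
                 (\<lambda>\<mu>. prod_op (\<lambda>i. wshift (w (\<mu> $ i)))) \<Lambda> x))
         \<and>
         ((\<exists>x. common_hypercyclic_vector (power_space (seqtop X nrm))
                 (\<lambda>\<mu>. prod_op (\<lambda>i. wshift (w (\<mu> $ i)))) \<Lambda> x)
          \<longleftrightarrow>
          (\<forall>\<tau>>0. \<forall>N\<ge>1. \<forall>\<epsilon>>0. \<forall>K. compact K \<and> K \<subseteq> \<Lambda> \<longrightarrow>
             (\<exists>(q::nat) (n :: nat \<Rightarrow> nat) (\<mu> :: nat \<Rightarrow> real ^ 'd).
                n 1 \<ge> N \<and> (\<forall>k\<in>{1..<q}. n (Suc k) \<ge> n k + N) \<and>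
                (\<forall>k\<in>{1..q}. \<forall>i. \<mu> k $ i \<in> I) \<and>
                K \<subseteq> (\<Union>k\<in>{1..q}. {x. \<forall>i. x $ i \<in> {\<mu> k $ i - \<tau> / real (F (n k)) .. \<mu> k $ i}}) \<and>
                (\<forall>i. Fnorm nrm (\<Sum>k=1..q.
                        cscale (of_real (1 / (\<Prod>m=1..n k. w (\<mu> k $ i) m))) (unit_seq (n k))) < \<epsilon>) \<and>
                (\<forall>k\<in>{1..<q}. \<forall>i. \<forall>l\<le>N.
                   Fnorm nrm (\<Sum>j=Suc k..q.
                     cscale (of_real ((\<Prod>m=n j - n k + l + 1..n j + l. w (\<mu> k $ i) m) /
                                      (\<Prod>m=l + 1..n j + l. w (\<mu> j $ i) m)))
                       (unit_seq (n j - n k + l))) < \<epsilon>))))"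
proof -
  note \<Lambda> = assms(5)[rule_format] and C = assms(15) and F1 = assms(12)[rule_format]
  interpret weighted_shift_family X nrm I w c
    by unfold_locales (use assms in auto)
  have f: "f n a = ln (wprod (w a) 0 n)" if "n \<ge> 1" "a \<in> I" for n a
  proof -
    have "ln (wprod (w a) 0 n) = (\<Sum>k=1..n. ln (w a k))"
      unfolding wprod_def add_0 using w_pos[OF that(2)] by (intro ln_prod) force+
    then show ?thesis using assms(11) that by simp
  qed
  have lower: "c * real (F n) * \<bar>a - b\<bar> \<le> \<bar>ln (wprod (w a) 0 n) - ln (wprod (w b) 0 n)\<bar>"
    and upper: "\<bar>ln (wprod (w a) 0 n) - ln (wprod (w b) 0 n)\<bar> \<le> C * real (F n) * \<bar>a - b\<bar>"
    if "n \<ge> 1" "a \<in> I" "b \<in> I" for n a b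
    using assms(16)[rule_format, OF that] f[OF that(1,2)] f[OF that(1,3)] by auto
  have w_mono: "w a n \<le> w b n" if "n \<ge> 1" "a \<in> I" "b \<in> I" "a \<le> b" for n a b
    using assms(10)[rule_format, OF that(1)] that(2-4) by (rule mono_onD)
  have F_mono: "F m \<le> F n" if "1 \<le> m" "m \<le> n" for m n
    using mono_onD[OF assms(13), of m n] that by simp
  let ?P = "P :: ('d \<Rightarrow> nat \<Rightarrow> complex) topology"
  let ?hc = "common_hypercyclic_vector ?P (\<lambda>\<mu>. prod_op (\<lambda>i. wshift (w (\<mu> $ i)))) \<Lambda>"
  let ?a = "\<exists>G. gdelta_in ?P G \<and> ?P closure_of G = topspace ?P \<and> (\<forall>x\<in>G. ?hc x)"
  let ?c = "\<forall>\<tau>>0. \<forall>N\<ge>1. \<forall>\<epsilon>>0. \<forall>K. compact K \<and> K \<subseteq> \<Lambda> \<longrightarrow> (\<exists>q n \<mu>. covering_family F \<tau> N \<epsilon> K q n \<mu>)"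
  \<comment> \<open>The closure of the empty set is empty while the product space contains 0, so a
    dense set has an element.\<close>
  have ab: "\<exists>x. ?hc x" if a: ?a
  proof -
    obtain G where G: "?P closure_of G = topspace ?P" "\<forall>x\<in>G. ?hc x" using a by blast
    have "(\<lambda>_. 0) \<in> topspace ?P" unfolding topspace_P using X_0 by blast
    then have "G \<noteq> {}" using G(1) by (metis closure_of_empty empty_iff)
    then show ?thesis using G(2) by blast
  qed
  have bc: ?c if b: "\<exists>x. ?hc x"
  proof (intro allI impI, elim conjE)
    fix \<tau> \<epsilon> :: real and N :: nat and K :: "(real ^ 'd) set"
    assume *: "\<tau> > 0" "N \<ge> 1" "\<epsilon> > 0" "compact K" "K \<subseteq> \<Lambda>"
    obtain x where x: "?hc x" using b by blast
    show "\<exists>q n \<mu>. covering_family F \<tau> N \<epsilon> K q n \<mu>"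
    proof (cases "K = {}")
      case True
      then show ?thesis using covering_family_empty[OF *(3)] by blast
    next
      case False
      show ?thesis
        by (rule hypercyclic_imp_covering_family[OF \<Lambda> F1 lower x * False])
    qed
  qed
  have ca: ?a if c: ?c
  proof (rule dense_gdelta_of_common_hypercyclic_vectors[OF \<Lambda> assms(6)])
    fix K p \<delta> L and u v :: "'d \<Rightarrow> nat \<Rightarrow> complex"
    assume K: "compact K" "K \<subseteq> \<Lambda>" and *: "\<delta> > (0::real)" "L \<ge> (1::nat)"
      "\<And>i m. m \<ge> L \<Longrightarrow> u i m = 0" "\<And>i m. m \<ge> L \<Longrightarrow> v i m = 0"
    have KI: "\<mu> $ i \<in> I" if "\<mu> \<in> K" for \<mu> i using \<Lambda> K(2) that by blast
    have fam: "\<exists>q n \<mu>. covering_family F \<tau> N \<epsilon> K q n \<mu>" if "\<tau> > 0" "N \<ge> 1" "\<epsilon> > 0" for \<tau> N \<epsilon>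
      using c that K by blast
    show "\<exists>x S. finite S \<and> (\<forall>i. x i \<in> X \<and> sn p (x i - u i) < \<delta>) \<and>
        (\<forall>\<mu>\<in>K. \<exists>n\<in>S. \<forall>i. sn p (B (\<mu> $ i) n (x i) - v i) < \<delta>)"
      by (rule covering_family_imp_approximation[OF w_mono F1 F_mono C upper KI fam *(2-4,1)])
  qed
  have "(?a \<longleftrightarrow> (\<exists>x. ?hc x)) \<and> ((\<exists>x. ?hc x) \<longleftrightarrow> ?c)"
    using ab bc ca by argo
  then show ?thesis unfolding covering_family_iff .
qed

end
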